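(* Fix an integer $n\geq 2$ and $0<\rho\leq\infty$, let $I=(0,\rho)$ and $J=(-\infty,\log\rho)$ (with $\log\infty:=\infty$), and let $f:I\to\mathbb{R}$ be an arbitrary function. Define $g:J\to\mathbb{R}$ by $g(t)=f(e^t)$. Then the following assertions are equivalent. (i) For every $A\in\mathbb{P}_n(I)$, one has $f[A]\succeq 0$. (ii) The function $f$ is continuous; $D^kf\geq 0$ in $\mathcal{D}'(I)$ for every integer $0\leq k\leq n-1$; and $\mathbf{H}_n^{\mathrm{dist}}(g)\succeq 0$, that is, for every nonnegative $\psi\in C_c^\infty(J)$ the matrix $$\bigl[\langle D^{i+j}g,\psi\rangle\bigr]_{i,j=0}^{n-1}$$ is positive semidefinite.
   Context: For an interval $I\subset(0,\infty)$, $\mathbb{P}_n(I)$ denotes the set of real symmetric positive semidefinite $n\times n$ matrices all of whose entries lie in $I$; $f[A]:=[f(a_{ij})]_{i,j=1}^n$ is the entrywise application of $f$; $\succeq 0$ means positive semidefinite. For an open set $U\subset\mathbb{R}$, $\mathcal{D}(U)=C_c^\infty(U)$ is the space of smooth compactly supported functions on $U$ and $\mathcal{D}'(U)$ is the space of distributions on $U$. A locally integrable function $h$ on $U$ is identified with the distribution $\varphi\mapsto\int_U h\varphi\,\mathrm{d}x$, and its $k$th distributional derivative is $\langle D^kh,\varphi\rangle:=(-1)^k\int_U h(x)\varphi^{(k)}(x)\,\mathrm{d}x$. A distribution $T\in\mathcal{D}'(U)$ is called positive, written $T\geq 0$, if $\langle T,\varphi\rangle\geq 0$ for every nonnegative $\varphi\in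 C_c^\infty(U)$. The distributional Hankel matrix is $\mathbf{H}_n^{\mathrm{dist}}(g):=[D^{i+j}g]_{i,j=0}^{n-1}$. *)

theory Defs
  imports "HOL-Analysis.Analysis" "Jordan_Normal_Form.Matrix"
begin

definition psd_mat :: "real mat \<Rightarrow> bool" where
  "psd_mat A \<longleftrightarrow> square_mat A \<and> transpose_mat A = A \<and>
     (\<forall>v \<in> carrier_vec (dim_row A). 0 \<le> scalar_prod v (A *\<^sub>v v))"

definition psd_mats_over :: "nat \<Rightarrow> real set \<Rightarrow> real mat set" where
  "psd_mats_over n I = {A \<in> carrier_mat n n. psd_mat A \<and> elements_mat A \<subseteq> I}"

text \<open>The space of smooth compactly supported functions on an open set \<open>U\<close>. Its elements
  are represented by their extensions by zero to the whole real line.\<close>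

definition test_functions :: "real set \<Rightarrow> (real \<Rightarrow> real) set" where
  "test_functions U =
     {\<phi>. (\<forall>k x. (deriv ^^ k) \<phi> differentiable (at x)) \<and>
         compact (closure {x. \<phi> x \<noteq> 0}) \<and> closure {x. \<phi> x \<noteq> 0} \<subseteq> U}"

text \<open>The \<open>k\<close>-th distributional derivative on \<open>U\<close> of a locally integrable function \<open>h\<close>, as a
  functional on \<^term>\<open>test_functions U\<close>. Only the values of \<open>h\<close> on \<open>U\<close> matter. For \<open>h\<close> that is
  not locally integrable the Bochner integral may be the default value \<open>0\<close>.\<close>

definition dist_deriv :: "real set \<Rightarrow> nat \<Rightarrow> (real \<Rightarrow> real) \<Rightarrow> (real \<Rightarrow> real) \<Rightarrow> real" where
  "dist_deriv U k h \<phi> = (-1) ^ k * (LINT x:U|lebesgue. h x * (deriv ^^ k) \<phi> x)"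

definition dist_nonneg :: "real set \<Rightarrow> ((real \<Rightarrow> real) \<Rightarrow> real) \<Rightarrow> bool" where
  "dist_nonneg U T \<longleftrightarrow> (\<forall>\<phi> \<in> test_functions U. (\<forall>x\<in>U. 0 \<le> \<phi> x) \<longrightarrow> 0 \<le> T \<phi>)"

text \<open>The distributional Hankel matrix of \<open>g\<close>, paired entrywise with the test function \<open>\<psi>\<close>.\<close>

definition hankel_dist :: "nat \<Rightarrow> real set \<Rightarrow> (real \<Rightarrow> real) \<Rightarrow> (real \<Rightarrow> real) \<Rightarrow> real mat" where
  "hankel_dist n U g \<psi> = mat n n (\<lambda>(i, j). dist_deriv U (i + j) g \<psi>)"

definition hankel_dist_psd :: "nat \<Rightarrow> real set \<Rightarrow> (real \<Rightarrow> real) \<Rightarrow> bool" where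
  "hankel_dist_psd n U g \<longleftrightarrow>
     (\<forall>\<psi> \<in> test_functions U. (\<forall>x\<in>U. 0 \<le> \<psi> x) \<longrightarrow> psd_mat (hankel_dist n U g \<psi>))"

definition log_ereal :: "ereal \<Rightarrow> ereal" where
  "log_ereal r = (case r of ereal x \<Rightarrow> ereal (ln x) | PInfty \<Rightarrow> \<infinity> | MInfty \<Rightarrow> -\<infinity>)"

end

theory Submission
  imports Defs "Jordan_Normal_Form.Determinant" "HOL-Combinatorics.Stirling"
begin

text \<open>
  Necessity tests the hypothesis on explicit matrices. Matrices of size 2 show that \<open>f\<close> is monotone and
  \<open>g\<close> is midpoint log-convex, which gives continuity. For a nonnegative test function \<open>\<psi>\<close> the function
  \<open>\<Phi>(u) = \<integral> h(x + u) \<psi>(x) dx\<close> is smooth, with derivatives at \<open>0\<close> equal to \<open>\<langle>D\<^sup>k h, \<psi>\<rangle>\<close>. The matrices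
  \<open>exp (x + \<epsilon> (i + j))\<close> and \<open>x + \<epsilon> i j\<close> show that \<open>\<Phi>(\<epsilon> (i + j))\<close> for \<open>h = g\<close>, respectively \<open>\<Phi>(\<epsilon> i j)\<close> for \<open>h = f\<close>,
  is positive semidefinite; finite differences give the claims as \<open>\<epsilon> \<rightarrow> 0\<close>.

  For preserver_if_dist_conditions, convolving \<open>g\<close> with a mollifier supported in \<open>(0, \<infinity>)\<close> preserves all the conditions, so \<open>f\<close> may
  be assumed smooth. The proof is by induction on \<open>n\<close>, along the lines of FitzGerald and Horn: a positive
  semidefinite \<open>A\<close> is joined by a segment to the rank-one matrix \<open>B\<close> with the same last row and column. On the
  segment the quadratic form of \<open>f[\<cdot>]\<close> is nondecreasing because \<open>f'\<close> preserves positivity in size \<open>n - 1\<close>, and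
  \<open>f[B]\<close> is positive semidefinite because the kernel \<open>g(s + t)\<close> is: after a perturbation the Hankel matrices of
  \<open>g\<close> are positive definite, so its derivatives form a Chebyshev system, the matrices \<open>g(t\<^sub>i + t\<^sub>j)\<close> are
  nonsingular, and a homotopy to an explicit exponential sum settles the sign.

  The induction needs the Hankel condition for \<open>f'\<close>, that is, for \<open>g'\<close>. View the derivatives of \<open>g\<close> at \<open>t\<close> as
  moments. The monic orthogonal polynomials \<open>P\<^sub>k\<close> then satisfy a Toda equation in \<open>t\<close>, which implies that for
  \<open>s < t\<close> the moment functional at \<open>s\<close> has sign \<open>(- 1)\<^sup>k\<close> on the polynomial \<open>P\<^sub>k\<close> at \<open>t\<close>. As \<open>s \<rightarrow> - \<infinity>\<close>
  the conditions \<open>D\<^sup>k f \<ge> 0\<close> make the moments of positive order vanish along a sequence, so \<open>(- 1)\<^sup>k P\<^sub>k(0) \<ge> 0\<close>, and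
  Christoffel's formula yields the positivity of the shifted Hankel matrix.
\<close>

section \<open>Positive semidefinite kernels\<close>

definition quad_form :: "nat \<Rightarrow> (nat \<Rightarrow> nat \<Rightarrow> real) \<Rightarrow> (nat \<Rightarrow> real) \<Rightarrow> real" where
  "quad_form n K c = (\<Sum>i<n. \<Sum>j<n. c i * c j * K i j)"

text \<open>Symmetry is not included; lemmas that need it assume \<open>K i j = K j i\<close> for
  all indices, although only entries below \<open>n\<close> enter the form.\<close>

definition psd_kernel :: "nat \<Rightarrow> (nat \<Rightarrow> nat \<Rightarrow> real) \<Rightarrow> bool" where
  "psd_kernel n K \<longleftrightarrow> (\<forall>c. 0 \<le> quad_form n K c)"

text \<open>Nonsingularity of the \<open>n\<close> by \<open>n\<close> block: kernel means null
  space here, unlike in \<open>psd_kernel\<close>.\<close>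

definition trivial_kernel :: "nat \<Rightarrow> (nat \<Rightarrow> nat \<Rightarrow> real) \<Rightarrow> bool" where
  "trivial_kernel n K \<longleftrightarrow> (\<forall>c. (\<forall>i<n. (\<Sum>j<n. K i j * c j) = 0) \<longrightarrow> (\<forall>j<n. c j = 0))"

text \<open>A matrix and its transpose have the same determinant, and a zero determinant is the same
  as a nonzero null vector.\<close>

lemma trivial_kernel_transpose:
  assumes "trivial_kernel n K"
  shows "trivial_kernel n (\<lambda>i j. K j i)"
proof -
  define A where "A = mat n n (\<lambda>(i, j). K i j)"
  have A: "A \<in> carrier_mat n n" by (simp add: A_def)
  have AT: "transpose_mat A = mat n n (\<lambda>(i, j). K j i)" by (auto simp: A_def)
  have mv: "mat n n (\<lambda>(i, j). M i j) *\<^sub>v vec n c = vec n (\<lambda>i. \<Sum>j<n. M i j * c j)"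
    for M :: "nat \<Rightarrow> nat \<Rightarrow> real" and c
    by (auto simp: scalar_prod_def lessThan_atLeast0)
  have det: "det A \<noteq> 0"
  proof
    assume "det A = 0"
    then obtain v where v: "v \<in> carrier_vec n" "v \<noteq> 0\<^sub>v n" "A *\<^sub>v v = 0\<^sub>v n"
      using det_0_iff_vec_prod_zero[OF A] by blast
    have vv: "v = vec n (\<lambda>i. v $ i)" using v(1) by auto
    have "vec n (\<lambda>i. \<Sum>j<n. K i j * v $ j) = 0\<^sub>v n"
      using v(3) unfolding A_def mv[of K "\<lambda>i. v $ i", folded vv] .
    then have eq: "vec_index (vec n (\<lambda>i. \<Sum>j<n. K i j * v $ j)) i = vec_index (0\<^sub>v n) i" for i
      by simp
    have "(\<Sum>j<n. K i j * v $ j) = 0" if "i < n" for i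
      using that eq[of i] by simp
    then have "\<forall>j<n. v $ j = 0"
      using assms unfolding trivial_kernel_def by blast
    then show False using v(1,2) by auto
  qed
  have detT: "det (transpose_mat A) \<noteq> 0" using det det_transpose[OF A] by simp
  show ?thesis
    unfolding trivial_kernel_def
  proof (intro allI impI)
    fix c :: "nat \<Rightarrow> real" and j
    assume c: "\<forall>i<n. (\<Sum>j<n. K j i * c j) = 0" and j: "j < n"
    have "transpose_mat A *\<^sub>v vec n c = 0\<^sub>v n"
      unfolding AT mv using c by auto
    then have "vec n c = 0\<^sub>v n"
      using detT det_0_iff_vec_prod_zero[of "transpose_mat A" n] A vec_carrier[of n c]
      by (metis transpose_carrier_mat)
    from arg_cong[OF this, of "\<lambda>w. vec_index w j"] show "c j = 0" using j by simp
  qed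
qed

text \<open>Iterated Schur complements: \<open>schur_compl k K\<close> is \<open>K\<close> after elimination of the indices
  below \<open>k\<close>, so \<open>schur_compl k K k k\<close> is the \<open>k\<close>-th pivot of the factorization
  \<open>K = L D L\<^sup>T\<close>.\<close>

fun schur_compl :: "nat \<Rightarrow> (nat \<Rightarrow> nat \<Rightarrow> real) \<Rightarrow> nat \<Rightarrow> nat \<Rightarrow> real" where
  "schur_compl 0 K = K"
| "schur_compl (Suc k) K = (\<lambda>i j. schur_compl k K i j
     - schur_compl k K i k * schur_compl k K k j / schur_compl k K k k)"

lemma schur_compl_sym:
  assumes "\<And>i j. K i j = K j i"
  shows "schur_compl k K i j = schur_compl k K j i"
  by (induction k arbitrary: i j) (use assms in \<open>auto simp: mult.commute\<close>)

lemma schur_compl_zero: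
  assumes "\<And>l. l < k \<Longrightarrow> schur_compl l K l l \<noteq> 0" "i < k"
  shows "schur_compl k K i j = 0"
  using assms by (induction k arbitrary: i j) (auto simp: less_Suc_eq)

text \<open>Elimination is a column operation: column \<open>m\<close> of the Schur complement is
  column \<open>m\<close> of \<open>K\<close> plus a combination of the first \<open>k\<close>
  columns. With \<open>m = k\<close> this turns a zero pivot into a null vector, and shows that a
  pivot is a value of the quadratic form.\<close>

lemma schur_compl_combination:
  assumes "\<And>l. l < k \<Longrightarrow> schur_compl l K l l \<noteq> 0" "k \<le> m" "m < n"
  shows "\<exists>c. c m = 1 \<and> (\<forall>i. (\<Sum>j<n. K i j * c j) = schur_compl k K i m) \<and>
    (\<forall>j. k \<le> j \<longrightarrow> j \<noteq> m \<longrightarrow> c j = 0)"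
  using assms
proof (induction k arbitrary: m)
  case 0
  then show ?case
    by (intro exI[of _ "\<lambda>j. if j = m then 1 else 0"]) (auto simp: if_distrib cong: if_cong)
next
  case (Suc k)
  have d: "\<And>l. l < k \<Longrightarrow> schur_compl l K l l \<noteq> 0" using Suc.prems by auto
  obtain c where c: "c m = 1" "\<And>i. (\<Sum>j<n. K i j * c j) = schur_compl k K i m"
    "\<And>j. k \<le> j \<Longrightarrow> j \<noteq> m \<Longrightarrow> c j = 0"
    using Suc.IH[OF d, of m] Suc.prems by auto
  obtain c' where c': "c' k = 1" "\<And>i. (\<Sum>j<n. K i j * c' j) = schur_compl k K i k"
    "\<And>j. k \<le> j \<Longrightarrow> j \<noteq> k \<Longrightarrow> c' j = 0"
    using Suc.IH[OF d, of k] Suc.prems by auto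
  define r where "r = schur_compl k K k m / schur_compl k K k k"
  have "(\<Sum>j<n. K i j * (c j - r * c' j)) = schur_compl (Suc k) K i m" for i
  proof -
    have "(\<Sum>j<n. K i j * (c j - r * c' j)) = (\<Sum>j<n. K i j * c j) - r * (\<Sum>j<n. K i j * c' j)"
      by (simp add: algebra_simps sum_subtractf sum_distrib_left)
    then show ?thesis by (simp add: c c' r_def)
  qed
  moreover have "c m - r * c' m = 1" using c c' Suc.prems by auto
  moreover have "c j - r * c' j = 0" if "Suc k \<le> j" "j \<noteq> m" for j
    using c(3)[of j] c'(3)[of j] that by auto
  ultimately show ?case by (intro exI[of _ "\<lambda>j. c j - r * c' j"]) auto
qed

lemma schur_compl_expansion:
  "K i j = schur_compl n K i j +
    (\<Sum>l<n. schur_compl l K i l * schur_compl l K l j / schur_compl l K l l)"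
  by (induction n) auto

text \<open>With all pivots nonzero the remainder in \<open>schur_compl_expansion\<close> vanishes
  on the block, and the form becomes a sum of squares divided by the pivots.\<close>

lemma psd_kernel_if_pivots_pos:
  assumes sym: "\<And>i j. K i j = K j i" and piv: "\<And>l. l < n \<Longrightarrow> 0 < schur_compl l K l l"
  shows "psd_kernel n K"
  unfolding psd_kernel_def
proof
  fix c :: "nat \<Rightarrow> real"
  define d where "d l = schur_compl l K l l" for l
  have "quad_form n K c = (\<Sum>i<n. \<Sum>j<n. \<Sum>l<n. c i * c j * (schur_compl l K i l * schur_compl l K j l / d l))"
    unfolding quad_form_def
  proof (intro sum.cong refl, goal_cases)
    case (1 i j)
    have nz: "schur_compl l K l l \<noteq> 0" if "l < n" for l using piv[OF that] by simp
    have "schur_compl n K i j = 0"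
      using schur_compl_zero[OF nz] 1 by simp
    then show ?case
      unfolding d_def by (subst schur_compl_expansion[of K i j n])
        (simp add: sum_distrib_left schur_compl_sym[OF sym, of _ _ j])
  qed
  also have "\<dots> = (\<Sum>l<n. \<Sum>i<n. \<Sum>j<n. c i * c j * (schur_compl l K i l * schur_compl l K j l / d l))"
    by (subst (2) sum.swap, subst sum.swap) (auto intro: sum.cong)
  also have "\<dots> = (\<Sum>l<n. (\<Sum>i<n. c i * schur_compl l K i l)\<^sup>2 / d l)"
    by (intro sum.cong refl) (auto simp: power2_eq_square sum_product sum_divide_distrib algebra_simps)
  also have "\<dots> \<ge> 0"
    using piv by (intro sum_nonneg divide_nonneg_pos) (auto simp: d_def)
  finally show "0 \<le> quad_form n K c" .
qed

lemma pivot_nonzero: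
  assumes "trivial_kernel (Suc k) K" "\<And>l. l < k \<Longrightarrow> schur_compl l K l l \<noteq> 0"
  shows "schur_compl k K k k \<noteq> 0"
proof
  assume 0: "schur_compl k K k k = 0"
  obtain c where c: "c k = 1" "\<And>i. (\<Sum>j<Suc k. K i j * c j) = schur_compl k K i k"
    using schur_compl_combination[OF assms(2), of k k "Suc k"] by auto
  have "\<forall>i<Suc k. (\<Sum>j<Suc k. K i j * c j) = 0"
    using c(2) 0 schur_compl_zero[OF assms(2)] by (auto simp: less_Suc_eq)
  then have "c k = 0" using assms(1) unfolding trivial_kernel_def by blast
  then show False using c by simp
qed

lemma pivot_nonneg:
  assumes "psd_kernel n K" "k < n" "\<And>l. l < k \<Longrightarrow> schur_compl l K l l \<noteq> 0"
  shows "0 \<le> schur_compl k K k k"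
proof -
  obtain c where c: "c k = 1" "\<And>i. (\<Sum>j<n. K i j * c j) = schur_compl k K i k"
    "\<And>j. k \<le> j \<Longrightarrow> j \<noteq> k \<Longrightarrow> c j = 0"
    using schur_compl_combination[OF assms(3), of k k n] assms(2) by auto
  have "0 \<le> quad_form n K c" using assms(1) by (simp add: psd_kernel_def)
  also have "quad_form n K c = (\<Sum>i<n. c i * (\<Sum>j<n. K i j * c j))"
    by (simp add: quad_form_def sum_distrib_left algebra_simps)
  also have "\<dots> = (\<Sum>i<n. if i = k then schur_compl k K k k else 0)"
  proof (intro sum.cong refl)
    fix i
    show "c i * (\<Sum>j<n. K i j * c j) = (if i = k then schur_compl k K k k else 0)"
      using schur_compl_zero[OF assms(3), of k i k] c by (cases "i < k") auto
  qed
  also have "\<dots> = schur_compl k K k k" using assms(2) by simp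
  finally show ?thesis .
qed

lemma psd_kernel_limit:
  assumes "\<And>i j. i < n \<Longrightarrow> j < n \<Longrightarrow> ((\<lambda>x. K x i j) \<longlongrightarrow> L i j) F" "F \<noteq> bot"
    "\<forall>\<^sub>F x in F. psd_kernel n (K x)"
  shows "psd_kernel n L"
  unfolding psd_kernel_def
proof
  fix c
  have "((\<lambda>x. quad_form n (K x) c) \<longlongrightarrow> quad_form n L c) F"
    unfolding quad_form_def by (intro tendsto_sum tendsto_mult tendsto_const assms) auto
  moreover have "\<forall>\<^sub>F x in F. 0 \<le> quad_form n (K x) c"
    using assms(3) by eventually_elim (simp add: psd_kernel_def)
  ultimately show "0 \<le> quad_form n L c"
    using assms(2) tendsto_lowerbound by blast
qed

text \<open>The pivots along the segment from \<open>B\<close> to \<open>A\<close> cannot change sign.\<close>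

lemma psd_kernel_homotopy:
  assumes symA: "\<And>i j. A i j = A j i" and symB: "\<And>i j. B i j = B j i"
    and B: "psd_kernel n B"
    and nonsing: "\<And>\<theta> m. 0 < \<theta> \<Longrightarrow> \<theta> \<le> 1 \<Longrightarrow> m \<le> n \<Longrightarrow>
      trivial_kernel m (\<lambda>i j. (1 - \<theta>) * A i j + \<theta> * B i j)"
  shows "psd_kernel n A"
proof -
  define K where "K \<theta> i j = (1 - \<theta>) * A i j + \<theta> * B i j" for \<theta> and i j :: nat
  have nz: "schur_compl k (K \<theta>) k k \<noteq> 0" if "k < n" "0 < \<theta>" "\<theta> \<le> 1" for k \<theta>
    using that(1)
  proof (induction k rule: less_induct)
    case (less k)
    show ?case
      by (rule pivot_nonzero)
        (use nonsing[OF that(2,3), of "Suc k"] less in \<open>auto simp: K_def[abs_def]\<close>)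
  qed
  \<comment> \<open>The pivots are rational in \<theta> with nonvanishing denominators, hence
    continuous. The point \<open>\<theta> = 0\<close> is left out because \<open>A\<close> may be
    singular; it is reached at the end as a limit.\<close>
  have cont: "continuous_on {0<..1} (\<lambda>\<theta>. schur_compl k (K \<theta>) i j)" if "k \<le> n" for k i j
    using that
  proof (induction k arbitrary: i j)
    case 0
    then show ?case by (auto simp: K_def intro!: continuous_intros)
  next
    case (Suc k)
    then show ?case using nz by (auto intro!: continuous_intros)
  qed
  have K1: "K 1 = B" by (intro ext) (simp add: K_def)
  have pos1: "0 < schur_compl k (K 1) k k" if "k < n" for k
  proof -
    have "0 \<le> schur_compl k (K 1) k k"
      by (rule pivot_nonneg[of n]) (use nz[of _ 1] that B K1 in auto)
    then show ?thesis using nz[of k 1] that by simp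
  qed
  have pos: "0 < schur_compl k (K \<theta>) k k" if "k < n" "0 < \<theta>" "\<theta> \<le> 1" for k \<theta>
  proof (rule ccontr)
    assume "\<not> 0 < schur_compl k (K \<theta>) k k"
    then have "\<exists>x\<ge>\<theta>. x \<le> 1 \<and> schur_compl k (K x) k k = 0"
      using pos1[OF that(1)] that
      by (intro IVT' continuous_on_subset[OF cont]) auto
    then show False using nz that by force
  qed
  have psd: "psd_kernel n (K \<theta>)" if "0 < \<theta>" "\<theta> \<le> 1" for \<theta>
    by (rule psd_kernel_if_pivots_pos) (use symA symB pos that in \<open>auto simp: K_def\<close>)
  show ?thesis
  proof (rule psd_kernel_limit)
    show "((\<lambda>\<theta>. K \<theta> i j) \<longlongrightarrow> A i j) (at_right 0)" for i j
      unfolding K_def by (rule tendsto_eq_intros refl tendsto_ident_at | simp)+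
    show "\<forall>\<^sub>F \<theta> in at_right 0. psd_kernel n (K \<theta>)"
      unfolding eventually_at_right_field using psd by (intro exI[of _ 1]) auto
  qed simp
qed

section \<open>Principal submatrices, Gram vectors and Schur products\<close>

lemma psd_kernel_diag_nonneg:
  assumes "psd_kernel n K" "i < n"
  shows "0 \<le> K i i"
proof -
  have "quad_form n K (\<lambda>k. if k = i then 1 else 0) = K i i"
  proof -
    have "quad_form n K (\<lambda>k. if k = i then 1 else 0) =
        (\<Sum>a<n. if a = i then (\<Sum>b<n. if b = i then K a b else 0) else 0)"
      unfolding quad_form_def
    proof (intro sum.cong refl)
      fix a
      have "(\<Sum>b<n. (if a = i then 1 else 0) * (if b = i then 1 else 0) * K a b) =
          (\<Sum>b<n. if a = i then if b = i then K a b else 0 else 0)"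
        by (rule sum.cong) auto
      then show "(\<Sum>b<n. (if a = i then 1 else 0) * (if b = i then 1 else 0) * K a b) =
          (if a = i then \<Sum>b<n. if b = i then K a b else 0 else 0)" by simp
    qed
    then show ?thesis using assms(2) by simp
  qed
  then show ?thesis using assms(1) unfolding psd_kernel_def by metis
qed

lemma psd_kernel_cong:
  assumes "\<And>i j. i < n \<Longrightarrow> j < n \<Longrightarrow> K i j = K' i j"
  shows "psd_kernel n K = psd_kernel n K'"
proof -
  have "quad_form n K c = quad_form n K' c" for c
    unfolding quad_form_def using assms by (auto intro!: sum.cong)
  then show ?thesis by (simp add: psd_kernel_def)
qed

text \<open>The map \<pi> may repeat indices: the coefficients are summed over its fibres. This
  later permits coinciding points.\<close>

lemma psd_kernel_reindex:
  assumes "psd_kernel n K" "\<And>i. i < m \<Longrightarrow> \<pi> i < n"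
  shows "psd_kernel m (\<lambda>i j. K (\<pi> i) (\<pi> j))"
  unfolding psd_kernel_def
proof
  fix c :: "nat \<Rightarrow> real"
  define d :: "nat \<Rightarrow> real" where "d k = (\<Sum>i | i < m \<and> \<pi> i = k. c i)" for k
  have sub: "\<pi> ` {..<m} \<subseteq> {..<n}" using assms(2) by auto
  have group: "(\<Sum>i<m. c i * h (\<pi> i)) = (\<Sum>k<n. d k * h k)" for h :: "nat \<Rightarrow> real"
  proof -
    have "(\<Sum>i<m. c i * h (\<pi> i)) = (\<Sum>k<n. \<Sum>i | i \<in> {..<m} \<and> \<pi> i = k. c i * h (\<pi> i))"
      by (rule sum.group[symmetric]) (use sub in auto)
    also have "\<dots> = (\<Sum>k<n. d k * h k)"
      by (intro sum.cong refl) (auto simp: d_def sum_distrib_right intro!: sum.cong)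
    finally show ?thesis .
  qed
  have "quad_form m (\<lambda>i j. K (\<pi> i) (\<pi> j)) c = (\<Sum>i<m. c i * (\<Sum>j<m. c j * K (\<pi> i) (\<pi> j)))"
    by (simp add: quad_form_def sum_distrib_left mult.assoc)
  also have "\<dots> = (\<Sum>i<m. c i * (\<Sum>l<n. d l * K (\<pi> i) l))"
    by (subst group) simp
  also have "\<dots> = (\<Sum>k<n. d k * (\<Sum>l<n. d l * K k l))"
    by (rule group)
  also have "\<dots> = quad_form n K d" by (simp add: quad_form_def sum_distrib_left mult.assoc)
  finally show "0 \<le> quad_form m (\<lambda>i j. K (\<pi> i) (\<pi> j)) c"
    using assms(1) by (simp add: psd_kernel_def)
qed

lemma psd_kernel_mono:
  assumes "psd_kernel n K" "m \<le> n"
  shows "psd_kernel m K"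
  using psd_kernel_reindex[OF assms(1), of m id] assms(2) by simp

lemma psd_kernel_2:
  assumes "psd_kernel n K" "i < n" "j < n" "K i j = K j i"
  shows "(K i j)\<^sup>2 \<le> K i i * K j j"
proof -
  define L where "L a b = K (if a = (0::nat) then i else j) (if b = (0::nat) then i else j)" for a b
  have L: "psd_kernel 2 L"
    unfolding L_def by (rule psd_kernel_reindex[OF assms(1)]) (use assms in auto)
  have q: "0 \<le> x * x * K i i + 2 * (x * y * K i j) + y * y * K j j" for x y
  proof -
    have "0 \<le> quad_form 2 L (\<lambda>a. if a = 0 then x else y)"
      using L by (simp add: psd_kernel_def)
    then show ?thesis
      by (simp add: quad_form_def L_def numeral_2_eq_2 assms(4) algebra_simps)
  qed
  show ?thesis
  proof (cases "K i i = 0")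
    case True
    have "K i j = 0"
    proof (rule ccontr)
      assume nz: "K i j \<noteq> 0"
      \<comment> \<open>The witness makes the form equal to -1 when
        \<open>K i i = 0\<close>.\<close>
      have "0 \<le> 2 * ((-(K j j + 1) / (2 * K i j)) * 1 * K i j) + K j j"
        using q[of "-(K j j + 1) / (2 * K i j)" 1] True by simp
      then show False using nz by (simp add: field_simps)
    qed
    then show ?thesis using True by simp
  next
    case False
    then have pos: "0 < K i i" using psd_kernel_diag_nonneg[OF assms(1,2)] by simp
    have "0 \<le> K i i * (K i i * K j j - (K i j)\<^sup>2)"
      using q[of "- K i j" "K i i"] by (simp add: power2_eq_square algebra_simps)
    then show ?thesis using pos by (simp add: zero_le_mult_iff)
  qed
qed

text \<open>The convention \<open>x / 0 = 0\<close> covers a zero pivot, because then the whole last row vanishes.\<close>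

lemma psd_kernel_last_elim:
  assumes psd: "psd_kernel (Suc n) K" and sym: "\<And>i j. K i j = K j i"
  shows "psd_kernel (Suc n) (\<lambda>i j. K i j - K i n * K n j / K n n)"
  unfolding psd_kernel_def
proof
  fix c
  define s where "s = (\<Sum>j<Suc n. c j * K n j)"
  define r where "r = s / K n n"
  have s2: "r * s = r * r * K n n"
    by (cases "K n n = 0") (auto simp: r_def)
  have row: "K n n = 0 \<Longrightarrow> j < Suc n \<Longrightarrow> K n j = 0" for j
    using psd_kernel_2[OF psd, of n j] sym by auto
  \<comment> \<open>Only the last coefficient is moved, to the minimum of the form in that
    coordinate; the minimal value is the form of the Schur complement.\<close>
  have "0 \<le> quad_form (Suc n) K (\<lambda>i. c i - (if i = n then r else 0))"
    using psd by (simp add: psd_kernel_def)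
  also have "\<dots> = quad_form (Suc n) K c - (\<Sum>i<Suc n. c i * r * K i n) - (\<Sum>j<Suc n. r * c j * K n j) + r * r * K n n"
  proof -
    define e where "e i = (if i = n then r else 0)" for i
    have "quad_form (Suc n) K (\<lambda>i. c i - e i) = quad_form (Suc n) K c
      - (\<Sum>i<Suc n. \<Sum>j<Suc n. c i * e j * K i j) - (\<Sum>i<Suc n. \<Sum>j<Suc n. e i * c j * K i j)
      + (\<Sum>i<Suc n. \<Sum>j<Suc n. e i * e j * K i j)"
      unfolding quad_form_def sum_subtractf[symmetric] sum.distrib[symmetric]
      by (intro sum.cong refl) (simp add: algebra_simps)
    moreover have "(\<Sum>j<Suc n. c i * e j * K i j) = c i * r * K i n" for i
      by (simp add: e_def if_distrib if_distribR sum.delta cong: if_cong)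
    moreover have "(\<Sum>i<Suc n. \<Sum>j<Suc n. e i * h i j) = (\<Sum>j<Suc n. r * h n j)" for h
    proof -
      have "(\<Sum>j<Suc n. e i * h i j) = (if i = n then (\<Sum>j<Suc n. r * h n j) else 0)" for i
        by (auto simp: e_def)
      then show ?thesis by (simp add: sum.delta del: sum.lessThan_Suc)
    qed
    note this[of "\<lambda>i j. c j * K i j"] this[of "\<lambda>i j. e j * K i j"]
    moreover have "(\<Sum>j<Suc n. r * (e j * K n j)) = r * r * K n n"
      by (simp add: e_def if_distrib if_distribR sum.delta cong: if_cong)
    ultimately show ?thesis unfolding e_def[symmetric] by (simp only: mult.assoc)
  qed
  also have "\<dots> = quad_form (Suc n) K c - r * s"
  proof -
    have "(\<Sum>i<Suc n. c i * r * K i n) = r * s" "(\<Sum>j<Suc n. r * c j * K n j) = r * s"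
      unfolding s_def sum_distrib_left
      by (intro sum.cong refl; use sym[of _ n] in \<open>simp del: sum.lessThan_Suc\<close>)+
    then show ?thesis using s2 by linarith
  qed
  also have "\<dots> = quad_form (Suc n) (\<lambda>i j. K i j - K i n * K n j / K n n) c"
  proof -
    have "r * s = (\<Sum>i<Suc n. \<Sum>j<Suc n. c i * c j * (K i n * K n j / K n n))"
    proof -
      have "r * s = (\<Sum>i<Suc n. c i * K n i) * (\<Sum>j<Suc n. c j * K n j) / K n n"
        by (simp add: r_def s_def)
      also have "\<dots> = (\<Sum>i<Suc n. \<Sum>j<Suc n. c i * K n i * (c j * K n j) / K n n)"
        unfolding sum_product sum_divide_distrib ..
      also have "\<dots> = (\<Sum>i<Suc n. \<Sum>j<Suc n. c i * c j * (K i n * K n j / K n n))"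
      proof (intro sum.cong refl)
        fix i j
        show "c i * K n i * (c j * K n j) / K n n = c i * c j * (K i n * K n j / K n n)"
          unfolding sym[of i n] by simp
      qed
      finally show ?thesis .
    qed
    then show ?thesis
      unfolding quad_form_def by (simp only: right_diff_distrib sum_subtractf)
  qed
  finally show "0 \<le> quad_form (Suc n) (\<lambda>i j. K i j - K i n * K n j / K n n) c" .
qed

text \<open>Cholesky factorization. The eliminated kernel vanishes in its last row and column, so
  the vectors from the induction hypothesis are extended by 0, and the removed rank-one part
  contributes one more vector.\<close>

lemma psd_kernel_gram:
  assumes "psd_kernel n K" "\<And>i j. K i j = K j i"
  shows "\<exists>w. \<forall>i<n. \<forall>j<n. K i j = (\<Sum>k<n. w k i * w k j)"
  using assms
proof (induction n arbitrary: K)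
  case 0
  then show ?case by auto
next
  case (Suc n)
  define K' where "K' i j = K i j - K i n * K n j / K n n" for i j
  have K': "psd_kernel (Suc n) K'"
    unfolding K'_def by (rule psd_kernel_last_elim[OF Suc.prems])
  have sym': "K' i j = K' j i" for i j
    using Suc.prems(2) by (simp add: K'_def mult.commute)
  obtain w where w: "\<And>i j. i < n \<Longrightarrow> j < n \<Longrightarrow> K' i j = (\<Sum>k<n. w k i * w k j)"
    using Suc.IH[OF psd_kernel_mono[OF K'] sym'] by auto
  have nonneg: "0 \<le> K n n" using psd_kernel_diag_nonneg[OF Suc.prems(1)] by simp
  have row: "K n n = 0 \<Longrightarrow> j < Suc n \<Longrightarrow> K n j = 0" for j
    using psd_kernel_2[OF Suc.prems(1), of n j] Suc.prems(2) by auto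
  define v where "v k i = (if k = n then K n i / sqrt (K n n) else if i = n then 0 else w k i)" for k i
  have sq: "K n i * K n j / K n n = v n i * v n j" for i j
    using nonneg by (simp add: v_def)
  have "K i j = (\<Sum>k<Suc n. v k i * v k j)" if "i < Suc n" "j < Suc n" for i j
  proof -
    have "K' i j = (\<Sum>k<n. v k i * v k j)"
    proof (cases "i = n \<or> j = n")
      case True
      then have "K' i j = 0"
        using row[of i] row[of j] that Suc.prems(2)[of i n] by (cases "K n n = 0") (auto simp: K'_def)
      moreover have "(\<Sum>k<n. v k i * v k j) = 0" using True by (auto simp: v_def)
      ultimately show ?thesis by simp
    next
      case False
      then show ?thesis using that w[of i j] by (auto simp: v_def less_Suc_eq intro!: sum.cong)
    qed
    moreover have "K i j = K' i j + v n i * v n j"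
      unfolding sq[symmetric] K'_def Suc.prems(2)[of i n] by simp
    ultimately show ?thesis by simp
  qed
  then show ?case by (intro exI[of _ v]) blast
qed

lemma psd_kernel_schur_product:
  assumes "psd_kernel n K" "\<And>i j. K i j = K j i" "psd_kernel n L"
  shows "psd_kernel n (\<lambda>i j. K i j * L i j)"
  unfolding psd_kernel_def
proof
  fix c
  obtain w where w: "\<And>i j. i < n \<Longrightarrow> j < n \<Longrightarrow> K i j = (\<Sum>k<n. w k i * w k j)"
    using psd_kernel_gram[OF assms(1,2)] by auto
  have "quad_form n (\<lambda>i j. K i j * L i j) c =
      (\<Sum>i<n. \<Sum>j<n. \<Sum>k<n. (c i * w k i) * (c j * w k j) * L i j)"
    unfolding quad_form_def
    by (intro sum.cong refl) (simp add: w sum_distrib_left sum_distrib_right ac_simps)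
  also have "\<dots> = (\<Sum>k<n. quad_form n L (\<lambda>i. c i * w k i))"
    unfolding quad_form_def by (subst (2) sum.swap, subst sum.swap) (auto intro: sum.cong)
  also have "\<dots> \<ge> 0" using assms(3) by (intro sum_nonneg) (auto simp: psd_kernel_def)
  finally show "0 \<le> quad_form n (\<lambda>i j. K i j * L i j) c" .
qed

section \<open>Smooth functions and Chebyshev systems\<close>

text \<open>The derivative is an existential witness, so closure properties follow by induction on
  \<open>k\<close> without computing \<open>deriv\<close>. The class asks for \<open>k\<close>
  differentiations only; the last derivative need not be continuous.\<close>

primrec Ck :: "nat \<Rightarrow> real set \<Rightarrow> (real \<Rightarrow> real) \<Rightarrow> bool" where
  "Ck 0 S f = True"
| "Ck (Suc k) S f = (\<exists>f'. (\<forall>x\<in>S. (f has_real_derivative f' x) (at x)) \<and> Ck k S f')"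

definition smooth_on :: "real set \<Rightarrow> (real \<Rightarrow> real) \<Rightarrow> bool" where
  "smooth_on S f \<longleftrightarrow> (\<forall>k. Ck k S f)"

text \<open>Carries a function together with all its derivatives. For fixed \<open>x\<close> the
  values \<open>D i x\<close> are later read as a moment sequence in \<open>i\<close>.\<close>

definition deriv_tower :: "real set \<Rightarrow> (nat \<Rightarrow> real \<Rightarrow> real) \<Rightarrow> bool" where
  "deriv_tower S D \<longleftrightarrow> (\<forall>i. \<forall>x\<in>S. (D i has_real_derivative D (Suc i) x) (at x))"

lemma deriv_towerD: "deriv_tower S D \<Longrightarrow> x \<in> S \<Longrightarrow> (D i has_real_derivative D (Suc i) x) (at x)"
  by (simp add: deriv_tower_def)

lemma Ck_mono_Suc: "Ck (Suc k) S f \<Longrightarrow> Ck k S f"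
proof (induction k arbitrary: f)
  case (Suc k)
  obtain f' where "\<forall>x\<in>S. (f has_real_derivative f' x) (at x)" "Ck (Suc k) S f'"
    using Suc.prems by (subst (asm) Ck.simps) blast
  then show ?case using Suc.IH unfolding Ck.simps(2)[of k] by blast
qed simp

lemma Ck_const: "Ck k S (\<lambda>x. c)"
proof (induction k arbitrary: c)
  case (Suc k)
  then show ?case by (auto intro!: exI[of _ "\<lambda>x. 0"] derivative_eq_intros)
qed simp

lemma Ck_ident: "Ck k S (\<lambda>x. x)"
  by (cases k) (auto intro!: exI[of _ "\<lambda>x. 1"] derivative_eq_intros Ck_const)

lemma Ck_add: "Ck k S f \<Longrightarrow> Ck k S g \<Longrightarrow> Ck k S (\<lambda>x. f x + g x)"
proof (induction k arbitrary: f g)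
  case (Suc k)
  obtain f' where f': "\<forall>x\<in>S. (f has_real_derivative f' x) (at x)" "Ck k S f'"
    using Suc.prems by auto
  obtain g' where g': "\<forall>x\<in>S. (g has_real_derivative g' x) (at x)" "Ck k S g'"
    using Suc.prems by auto
  show ?case
    using f' g' Suc.IH[OF f'(2) g'(2)]
    by (auto intro!: exI[of _ "\<lambda>x. f' x + g' x"] derivative_eq_intros)
qed simp

lemma Ck_mult: "Ck k S f \<Longrightarrow> Ck k S g \<Longrightarrow> Ck k S (\<lambda>x. f x * g x)"
proof (induction k arbitrary: f g)
  case (Suc k)
  obtain f' where f': "\<forall>x\<in>S. (f has_real_derivative f' x) (at x)" "Ck k S f'"
    using Suc.prems by auto
  obtain g' where g': "\<forall>x\<in>S. (g has_real_derivative g' x) (at x)" "Ck k S g'"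
    using Suc.prems by auto
  show ?case
    using f' g' Suc.IH[OF f'(2) Ck_mono_Suc[OF Suc.prems(2)]]
      Suc.IH[OF Ck_mono_Suc[OF Suc.prems(1)] g'(2)]
    by (auto intro!: exI[of _ "\<lambda>x. f' x * g x + f x * g' x"] derivative_eq_intros Ck_add)
qed simp

lemma Ck_inverse:
  assumes "Ck k S f" "\<And>x. x \<in> S \<Longrightarrow> f x \<noteq> 0"
  shows "Ck k S (\<lambda>x. inverse (f x))"
  using assms
proof (induction k arbitrary: f)
  case (Suc k)
  obtain f' where f': "\<forall>x\<in>S. (f has_real_derivative f' x) (at x)" "Ck k S f'"
    using Suc.prems by auto
  have "Ck k S (\<lambda>x. inverse (f x))"
    using Suc.IH[OF Ck_mono_Suc[OF Suc.prems(1)] Suc.prems(2)] by simp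
  then have "Ck k S (\<lambda>x. (- 1) * (f' x * (inverse (f x) * inverse (f x))))"
    by (intro Ck_mult Ck_const f')
  then show ?case
    unfolding Ck.simps using f' Suc.prems(2)
    by (intro exI[of _ "\<lambda>x. (- 1) * (f' x * (inverse (f x) * inverse (f x)))"] conjI ballI)
      (auto intro!: derivative_eq_intros)
qed simp

lemma Ck_compose:
  assumes "Ck k T f" "Ck k S g" "\<And>x. x \<in> S \<Longrightarrow> g x \<in> T"
  shows "Ck k S (\<lambda>x. f (g x))"
  using assms
proof (induction k arbitrary: f)
  case (Suc k)
  obtain f' where f': "\<forall>x\<in>T. (f has_real_derivative f' x) (at x)" "Ck k T f'"
    using Suc.prems by auto
  obtain g' where g': "\<forall>x\<in>S. (g has_real_derivative g' x) (at x)" "Ck k S g'"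
    using Suc.prems by auto
  have "Ck k S (\<lambda>x. f' (g x) * g' x)"
    using Suc.IH[OF f'(2) Ck_mono_Suc[OF Suc.prems(2)] Suc.prems(3)] g'(2) by (rule Ck_mult)
  moreover have "((\<lambda>x. f (g x)) has_real_derivative f' (g x) * g' x) (at x)" if "x \<in> S" for x
    using f'(1) g'(1) Suc.prems(3) that by (intro DERIV_chain2) auto
  ultimately show ?case
    unfolding Ck.simps by (intro exI[of _ "\<lambda>x. f' (g x) * g' x"]) simp
qed simp

lemma Ck_cong:
  assumes "open S" "\<And>x. x \<in> S \<Longrightarrow> f x = g x" "Ck k S f"
  shows "Ck k S g"
proof (cases k)
  case (Suc m)
  then show ?thesis
    using assms by (auto intro: has_field_derivative_transform_within_open)
qed simp

lemma Ck_Suc_deriv: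
  assumes "open S"
  shows "Ck (Suc k) S f \<longleftrightarrow> (\<forall>x\<in>S. f differentiable (at x)) \<and> Ck k S (deriv f)"
proof
  assume "Ck (Suc k) S f"
  then obtain f' where f': "\<forall>x\<in>S. (f has_real_derivative f' x) (at x)" "Ck k S f'"
    by auto
  then show "(\<forall>x\<in>S. f differentiable (at x)) \<and> Ck k S (deriv f)"
    using Ck_cong[OF assms, of f' "deriv f" k] DERIV_imp_deriv
    by (metis real_differentiable_def)
next
  assume *: "(\<forall>x\<in>S. f differentiable (at x)) \<and> Ck k S (deriv f)"
  then have "(f has_real_derivative deriv f x) (at x)" if "x \<in> S" for x
    using that by (auto simp: real_differentiable_def DERIV_deriv_iff_real_differentiable)
  then show "Ck (Suc k) S f" using * by auto
qed

text \<open>For \<open>S = UNIV\<close> the right-hand side is the smoothness clause of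
  \<open>test_functions\<close>. Openness lets \<open>deriv\<close> replace the witnesses in
  \<open>Ck\<close>.\<close>

lemma smooth_on_iff:
  assumes "open S"
  shows "smooth_on S f \<longleftrightarrow> (\<forall>k. \<forall>x\<in>S. (deriv ^^ k) f differentiable (at x))"
proof -
  have "Ck k S f \<longleftrightarrow> (\<forall>i<k. \<forall>x\<in>S. (deriv ^^ i) f differentiable (at x))" for k
  proof (induction k arbitrary: f)
    case (Suc k)
    have "(\<forall>i<Suc k. \<forall>x\<in>S. (deriv ^^ i) f differentiable (at x)) \<longleftrightarrow>
      (\<forall>x\<in>S. f differentiable (at x)) \<and>
      (\<forall>i<k. \<forall>x\<in>S. (deriv ^^ i) (deriv f) differentiable (at x))"
      unfolding All_less_Suc2 by (simp add: funpow_swap1)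
    then show ?case using Suc.IH[of "deriv f"] Ck_Suc_deriv[OF assms] by simp
  qed simp
  then show ?thesis unfolding smooth_on_def by blast
qed

lemma smooth_on_deriv_tower:
  assumes "open S" "smooth_on S f"
  shows "deriv_tower S (\<lambda>i. (deriv ^^ i) f)"
  using assms by (auto simp: deriv_tower_def smooth_on_iff DERIV_deriv_iff_real_differentiable)

lemma deriv_tower_smooth:
  assumes "deriv_tower S D"
  shows "smooth_on S (D i)"
proof -
  have "Ck k S (D i)" for k
    by (induction k arbitrary: i) (use assms in \<open>auto simp: deriv_tower_def\<close>)
  then show ?thesis by (simp add: smooth_on_def)
qed

lemma smooth_on_deriv: "open S \<Longrightarrow> smooth_on S f \<Longrightarrow> smooth_on S (deriv f)"
  using Ck_Suc_deriv unfolding smooth_on_def by blast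

lemma smooth_on_DERIV: "open S \<Longrightarrow> smooth_on S f \<Longrightarrow> x \<in> S \<Longrightarrow> (f has_real_derivative deriv f x) (at x)"
  using Ck_Suc_deriv[of S 0 f] unfolding smooth_on_def
  by (auto simp: DERIV_deriv_iff_real_differentiable)

text \<open>Vanishing to order \<open>k\<close> in the form \<open>F s = O(|s - t|^k)\<close>, which
  passes through products and primitives without a Leibniz formula. The neighbourhood contains
  \<open>t\<close> itself, so positive order forces \<open>F t = 0\<close>.\<close>

definition flat :: "nat \<Rightarrow> (real \<Rightarrow> real) \<Rightarrow> real \<Rightarrow> bool" where
  "flat k F t \<longleftrightarrow> (\<exists>C. \<forall>\<^sub>F s in nhds t. \<bar>F s\<bar> \<le> C * \<bar>s - t\<bar> ^ k)"

lemma flat_0: 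
  assumes "isCont F t"
  shows "flat 0 F t"
proof -
  have "((\<lambda>s. \<bar>F s\<bar>) \<longlongrightarrow> \<bar>F t\<bar>) (nhds t)"
    using assms by (intro tendsto_rabs) (simp add: continuous_within tendsto_nhds_iff)
  then have "\<forall>\<^sub>F s in nhds t. \<bar>F s\<bar> < \<bar>F t\<bar> + 1"
    by (rule order_tendstoD) simp
  then show ?thesis unfolding flat_def
    by (intro exI[of _ "\<bar>F t\<bar> + 1"]) (auto elim: eventually_mono)
qed

lemma flat_cong:
  assumes "\<forall>\<^sub>F s in nhds t. F s = G s" "flat k F t"
  shows "flat k G t"
proof -
  obtain C where "\<forall>\<^sub>F s in nhds t. \<bar>F s\<bar> \<le> C * \<bar>s - t\<bar> ^ k" using assms by (auto simp: flat_def)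
  with assms(1) have "\<forall>\<^sub>F s in nhds t. \<bar>G s\<bar> \<le> C * \<bar>s - t\<bar> ^ k" by eventually_elim simp
  then show ?thesis by (auto simp: flat_def)
qed

lemma flat_mult:
  assumes "flat k F t" "isCont G t"
  shows "flat k (\<lambda>s. F s * G s) t"
proof -
  obtain C where C: "\<forall>\<^sub>F s in nhds t. \<bar>F s\<bar> \<le> C * \<bar>s - t\<bar> ^ k" using assms by (auto simp: flat_def)
  obtain B where B: "\<forall>\<^sub>F s in nhds t. \<bar>G s\<bar> \<le> B" using flat_0[OF assms(2)] by (auto simp: flat_def)
  from C B have "\<forall>\<^sub>F s in nhds t. \<bar>F s * G s\<bar> \<le> (C * B) * \<bar>s - t\<bar> ^ k"
  proof eventually_elim
    case (elim s)
    have "\<bar>F s * G s\<bar> \<le> (C * \<bar>s - t\<bar> ^ k) * B"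
      unfolding abs_mult using elim by (intro mult_mono) auto
    then show ?case by (simp add: ac_simps)
  qed
  then show ?thesis by (auto simp: flat_def)
qed

text \<open>The mean value inequality on the segment from \<open>t\<close> to \<open>s\<close> gains
  one power of \<open>|s - t|\<close>.\<close>

lemma flat_primitive:
  assumes der: "\<forall>\<^sub>F s in nhds t. (F has_real_derivative F' s) (at s)" and F: "F t = 0"
    and flat: "flat k F' t"
  shows "flat (Suc k) F t"
proof -
  obtain C where C: "\<forall>\<^sub>F s in nhds t. \<bar>F' s\<bar> \<le> C * \<bar>s - t\<bar> ^ k" using flat by (auto simp: flat_def)
  obtain d where d: "0 < d" "\<And>s. dist s t < d \<Longrightarrow> (F has_real_derivative F' s) (at s)"
    "\<And>s. dist s t < d \<Longrightarrow> \<bar>F' s\<bar> \<le> C * \<bar>s - t\<bar> ^ k"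
    using eventually_conj[OF der C] unfolding eventually_nhds_metric by auto
  have "\<bar>F s\<bar> \<le> C * \<bar>s - t\<bar> ^ Suc k" if "dist s t < d" for s
  proof -
    have C0: "0 \<le> C * \<bar>s - t\<bar> ^ k" using d(3)[OF that] abs_ge_zero order_trans by blast
    have "norm (F s - F t) \<le> (C * \<bar>s - t\<bar> ^ k) * norm (s - t)"
    proof (rule field_differentiable_bound[of "closed_segment t s" F F'])
      fix z assume z: "z \<in> closed_segment t s"
      then have zt: "\<bar>z - t\<bar> \<le> \<bar>s - t\<bar>"
        using segment_bound1[OF z] by simp
      then have zd: "dist z t < d" using that by (simp add: dist_real_def)
      show "(F has_field_derivative F' z) (at z within closed_segment t s)"
        using d(2)[OF zd] by (rule has_field_derivative_at_within)
      show "norm (F' z) \<le> C * \<bar>s - t\<bar> ^ k"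
      proof (cases "s = t")
        case True
        then show ?thesis using d(3)[OF zd] z by simp
      next
        case False
        then have "0 < \<bar>s - t\<bar> ^ k" by simp
        then have "0 \<le> C" using C0 by (meson mult_neg_pos not_le)
        then have "C * \<bar>z - t\<bar> ^ k \<le> C * \<bar>s - t\<bar> ^ k"
          using zt by (intro mult_left_mono power_mono) auto
        then show ?thesis using d(3)[OF zd] by simp
      qed
    qed (auto simp: convex_closed_segment)
    then show ?thesis using F by (simp add: ac_simps)
  qed
  then show ?thesis unfolding flat_def eventually_nhds_metric using d(1) by blast
qed

text \<open>At the first nonzero derivative, of order \<open>i\<close>, Taylor's formula makes
  \<open>D 0 (t + h)\<close> comparable to \<open>h ^ i\<close>, which exceeds every multiple of
  \<open>h ^ k\<close> for small \<open>h\<close> when \<open>i < k\<close>.\<close>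

lemma flat_imp_derivs_zero:
  assumes D: "deriv_tower S D" and S: "open S" "t \<in> S" and flat: "flat k (D 0) t" and "i < k"
  shows "D i t = 0"
  using \<open>i < k\<close>
proof (induction i rule: less_induct)
  case (less i)
  obtain C where C: "\<forall>\<^sub>F s in nhds t. \<bar>D 0 s\<bar> \<le> C * \<bar>s - t\<bar> ^ k" using flat by (auto simp: flat_def)
  have "\<forall>\<^sub>F s in nhds t. s \<in> S" using S by (auto intro: eventually_nhds_in_open)
  from eventually_conj[OF this C] obtain d where d: "0 < d" "\<And>s. dist s t < d \<Longrightarrow> s \<in> S"
    "\<And>s. dist s t < d \<Longrightarrow> \<bar>D 0 s\<bar> \<le> C * \<bar>s - t\<bar> ^ k"
    unfolding eventually_nhds_metric by auto
  have cont: "isCont (D j) t" for j using deriv_towerD[OF D S(2)] DERIV_isCont by blast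
  show ?case
  proof (rule ccontr)
    assume nz: "D i t \<noteq> 0"
    define e where "e = \<bar>D i t\<bar> / 2"
    have e: "0 < e" using nz by (simp add: e_def)
    obtain d' where d': "0 < d'" "\<And>z. dist z t < d' \<Longrightarrow> \<bar>D i z - D i t\<bar> < e"
      using cont[of i] e unfolding continuous_at_eps_delta dist_real_def by blast
    have lim: "((\<lambda>h. C * fact i * h ^ (k - i)) \<longlongrightarrow> C * fact i * 0 ^ (k - i)) (at_right 0)"
      by (intro tendsto_intros)
    moreover have "C * fact i * 0 ^ (k - i) = 0" using less.prems by simp
    ultimately have "((\<lambda>h. C * fact i * h ^ (k - i)) \<longlongrightarrow> 0) (at_right 0)" by metis
    then have "\<forall>\<^sub>F h in at_right 0. C * fact i * h ^ (k - i) < e" using e by (rule order_tendstoD)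
    then obtain b where b: "0 < b" "\<And>h. 0 < h \<Longrightarrow> h < b \<Longrightarrow> C * fact i * h ^ (k - i) < e"
      unfolding eventually_at_right_field by auto
    define h where "h = min (min d d') b / 2"
    have h: "0 < h" "h < d" "h < d'" "h < b" using d d' b by (auto simp: h_def)
    obtain z where z: "t \<le> z" "z \<le> t + h" "D 0 (t + h) = D i z / fact i * h ^ i"
    proof (cases "i = 0")
      case True
      then show ?thesis using that[of "t + h"] h by simp
    next
      case False
      have "\<exists>z>t. z < t + h \<and> D 0 (t + h) =
          (\<Sum>m<i. D m t / fact m * (t + h - t) ^ m) + D i z / fact i * (t + h - t) ^ i"
        by (rule Taylor_up[where a = t])
          (use False h d(2) deriv_towerD[OF D] in \<open>auto simp: dist_real_def\<close>)
      then obtain z where z: "t < z" "z < t + h" "D 0 (t + h) =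
          (\<Sum>m<i. D m t / fact m * (t + h - t) ^ m) + D i z / fact i * (t + h - t) ^ i" by blast
      have "(\<Sum>m<i. D m t / fact m * (t + h - t) ^ m) = 0"
        using less.IH less.prems by (intro sum.neutral) auto
      then show ?thesis using that[of z] z by simp
    qed
    have "\<bar>D i z - D i t\<bar> < e" using z h by (intro d') (auto simp: dist_real_def)
    then have low: "e < \<bar>D i z\<bar>" unfolding e_def by argo
    have "\<bar>D i z\<bar> / fact i * h ^ i \<le> C * h ^ k"
      using d(3)[of "t + h"] z(3) h by (simp add: dist_real_def abs_mult)
    also have "h ^ k = h ^ (k - i) * h ^ i"
      using less.prems by (simp flip: power_add)
    finally have "(\<bar>D i z\<bar> / fact i) * h ^ i \<le> (C * h ^ (k - i)) * h ^ i" by (simp add: ac_simps)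
    then have "\<bar>D i z\<bar> / fact i \<le> C * h ^ (k - i)"
      by (rule mult_right_le_imp_le) (use h(1) in simp)
    then have "\<bar>D i z\<bar> \<le> C * fact i * h ^ (k - i)" by (simp add: field_simps)
    then show False using b(2)[of h] h low by simp
  qed
qed

section \<open>Rolle's theorem and Chebyshev systems\<close>

lemma rolle_finite:
  fixes F F' :: "real \<Rightarrow> real"
  assumes "is_interval S" "\<And>x. x \<in> S \<Longrightarrow> (F has_real_derivative F' x) (at x)"
    and "X \<subseteq> S" "finite X" "card X = Suc m" "\<And>x. x \<in> X \<Longrightarrow> F x = 0"
  shows "\<exists>Y \<subseteq> S. finite Y \<and> card Y = m \<and> (\<forall>y\<in>Y. F' y = 0) \<and> (\<forall>y\<in>Y. y < Max X)"
  using assms(3-)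
proof (induction m arbitrary: X)
  case 0
  then show ?case by (intro exI[of _ "{}"]) auto
next
  case (Suc m)
  have ne: "X \<noteq> {}" using Suc.prems by auto
  define x where "x = Max X"
  have x: "x \<in> X" using ne Suc.prems by (simp add: x_def)
  define X' where "X' = X - {x}"
  have X': "X' \<subseteq> S" "finite X'" "card X' = Suc m" "\<And>x. x \<in> X' \<Longrightarrow> F x = 0"
    using Suc.prems x by (auto simp: X'_def)
  define y where "y = Max X'"
  have y: "y \<in> X'" using X' by (simp add: y_def) (metis Max_in card.empty nat.distinct(1))
  have yx: "y < x"
    using y Max_ge[of X y] Suc.prems(2) by (auto simp: X'_def x_def less_le)
  obtain Y where Y: "Y \<subseteq> S" "finite Y" "card Y = m" "\<forall>y\<in>Y. F' y = 0" "\<forall>z\<in>Y. z < y"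
    using Suc.IH[OF X'] unfolding y_def by blast
  have seg: "z \<in> S" if "y \<le> z" "z \<le> x" for z
    using assms(1) x y X'(1) Suc.prems(1) that by (meson mem_is_interval_1_I subsetD)
  obtain z where z: "y < z" "z < x" "F' z = 0"
  proof -
    have "\<exists>z>y. z < x \<and> (\<lambda>v. F' z * v) = (\<lambda>v. 0)"
    proof (rule Rolle_deriv[OF yx])
      show "F y = F x" using x y X' Suc.prems by auto
      show "continuous_on {y..x} F"
        by (rule DERIV_continuous_on) (use seg assms(2) in \<open>auto intro: has_field_derivative_at_within\<close>)
      show "(F has_derivative (*) (F' z)) (at z)" if "y < z" "z < x" for z
        using assms(2)[of z] seg[of z] that by (simp add: has_field_derivative_def)
    qed
    then obtain z where z: "y < z" "z < x" "(\<lambda>v. F' z * v) = (\<lambda>v. 0)" by auto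
    have "F' z * 1 = 0" using z(3) by (rule fun_cong)
    then show thesis using that[of z] z(1,2) by simp
  qed
  \<comment> \<open>The bound by the maximum is carried through the induction so that the new zero,
    which lies to the right of the second largest point, is distinct from the old ones.\<close>
  have "z \<notin> Y" using Y(5) z by auto
  then show ?case
    using Y z seg[of z] yx by (intro exI[of _ "insert z Y"]) (auto simp: x_def[symmetric])
qed

text \<open>Nonvanishing Wronskians make \<open>u\<^sub>0, \<dots>, u\<^bsub>m-1\<^esub>\<close> a Chebyshev system: dividing by \<open>u\<^sub>0\<close> and
  differentiating removes one function and, by Rolle's theorem, at most one zero.\<close>

lemma chebyshev_system:
  assumes S: "open S" "is_interval S"
    and "\<And>j. j < m \<Longrightarrow> smooth_on S (u j)"
    and "\<And>k t c. k \<le> m \<Longrightarrow> t \<in> S \<Longrightarrow> flat k (\<lambda>s. \<Sum>j<k. c j * u j s) t \<Longrightarrow> \<forall>j<k. c j = 0"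
    and "X \<subseteq> S" "finite X" "card X = m" "\<And>x. x \<in> X \<Longrightarrow> (\<Sum>j<m. c j * u j x) = 0"
  shows "\<forall>j<m. c j = 0"
  using assms(3-)
proof (induction m arbitrary: u c X)
  case 0
  then show ?case by simp
next
  case (Suc m)
  define v where "v = u 0"
  note DER = smooth_on_DERIV[OF S(1)]
  have near: "\<forall>\<^sub>F s in nhds t. s \<in> S" if "t \<in> S" for t
    using S(1) that by (rule eventually_nhds_in_open)
  have smooth_v: "smooth_on S v" using Suc.prems(1)[of 0] by (simp add: v_def)
  have smooth_u: "smooth_on S (u (Suc j))" if "j < m" for j using Suc.prems(1) that by simp
  have isCont_deriv: "isCont (deriv f) t" if "smooth_on S f" "t \<in> S" for f t
    using DER[OF smooth_on_deriv[OF S(1) that(1)] that(2)] by (rule DERIV_isCont)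
  \<comment> \<open>A zero of \<open>u 0\<close> would make it flat of order 1, against the
    nondegeneracy hypothesis for \<open>k = 1\<close>.\<close>
  have v0: "v t \<noteq> 0" if t: "t \<in> S" for t
  proof
    assume 0: "v t = 0"
    have "flat (Suc 0) v t"
    proof (rule flat_primitive[where F = v and F' = "deriv v"])
      show "\<forall>\<^sub>F s in nhds t. (v has_real_derivative deriv v s) (at s)"
        using near[OF t] by eventually_elim (rule DER[OF smooth_v])
      show "flat 0 (deriv v) t" by (rule flat_0[OF isCont_deriv[OF smooth_v t]])
      show "v t = 0" by (rule 0)
    qed
    then have "flat 1 (\<lambda>s. \<Sum>j<1. 1 * u j s) t" by (simp add: v_def)
    then show False using Suc.prems(2)[of 1 t "\<lambda>_. 1"] t by auto
  qed
  define w where "w j s = (deriv (u (Suc j)) s * v s - u (Suc j) s * deriv v s) / (v s * v s)" for j s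
  have w_DER: "((\<lambda>s. u (Suc j) s / v s) has_real_derivative w j s) (at s)" if "j < m" "s \<in> S" for j s
    using DER[OF smooth_u[OF that(1)] that(2)] DER[OF smooth_v that(2)] v0[OF that(2)]
    unfolding w_def by (rule DERIV_divide)
  have sum_DER: "((\<lambda>s. \<Sum>j<k. a j * (u (Suc j) s / v s)) has_real_derivative (\<Sum>j<k. a j * w j s)) (at s)"
    if "k \<le> m" "s \<in> S" for k s a
    by (intro DERIV_sum DERIV_cmult w_DER) (use that in auto)
  have smooth_w: "smooth_on S (w j)" if "j < m" for j
  proof -
    note * = smooth_u[OF that] smooth_v
    note ** = *[THEN smooth_on_deriv[OF S(1)]]
    have "w j = (\<lambda>s. (deriv (u (Suc j)) s * v s + (- 1) * (u (Suc j) s * deriv v s)) * inverse (v s * v s))"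
      by (intro ext) (simp add: w_def divide_inverse)
    then show ?thesis
      using * ** v0 unfolding smooth_on_def
      by (simp only:) (intro allI Ck_mult Ck_add Ck_inverse Ck_const; simp)
  qed
  \<comment> \<open>Nondegeneracy passes to the derivatives \<open>w j\<close> of the quotients: a
    combination flat of order \<open>k\<close> has the primitive \<open>Q s - Q t\<close>, flat of
    order \<open>Suc k\<close>, and multiplying by \<open>v\<close> gives a combination of the
    original functions whose coefficient at \<open>u 0\<close> is \<open>- Q t\<close>.\<close>
  have nondeg: "\<forall>j<k. a j = 0"
    if k: "k \<le> m" and t: "t \<in> S" and flat: "flat k (\<lambda>s. \<Sum>j<k. a j * w j s) t" for k t a
  proof -
    define Q where "Q s = (\<Sum>j<k. a j * (u (Suc j) s / v s))" for s
    define b where "b j = (case j of 0 \<Rightarrow> - Q t | Suc i \<Rightarrow> a i)" for j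
    have "flat (Suc k) (\<lambda>s. Q s - Q t) t"
    proof (rule flat_primitive[where F = "\<lambda>s. Q s - Q t", OF _ _ flat])
      show "\<forall>\<^sub>F s in nhds t. ((\<lambda>s. Q s - Q t) has_real_derivative (\<Sum>j<k. a j * w j s)) (at s)"
        using near[OF t]
      proof eventually_elim
        case (elim s)
        show ?case using DERIV_diff[OF sum_DER[OF k elim] DERIV_const[of "Q t"]] by (simp add: Q_def)
      qed
    qed simp
    then have "flat (Suc k) (\<lambda>s. (Q s - Q t) * v s) t"
      by (rule flat_mult) (rule DERIV_isCont[OF DER[OF smooth_v t]])
    moreover have "\<forall>\<^sub>F s in nhds t. (Q s - Q t) * v s = (\<Sum>j<Suc k. b j * u j s)"
      using near[OF t]
    proof eventually_elim
      case (elim s)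
      have "(\<Sum>j<k. a j * (u (Suc j) s / v s)) * v s = (\<Sum>j<k. a j * u (Suc j) s)"
        using v0[OF elim] by (simp add: sum_distrib_right)
      then show ?case
        unfolding sum.lessThan_Suc_shift b_def
        by (simp add: Q_def[of s] left_diff_distrib v_def[symmetric])
    qed
    ultimately have "flat (Suc k) (\<lambda>s. \<Sum>j<Suc k. b j * u j s) t"
      by (rule flat_cong[rotated])
    from Suc.prems(2)[OF _ t this] k have "\<forall>j<Suc k. b j = 0" by blast
    then show ?thesis by (auto simp: b_def split: nat.splits)
  qed
  define F where "F s = c 0 + (\<Sum>j<m. c (Suc j) * (u (Suc j) s / v s))" for s
  have F_DER: "(F has_real_derivative (\<Sum>j<m. c (Suc j) * w j s)) (at s)" if "s \<in> S" for s
    using DERIV_add[OF DERIV_const[of "c 0"] sum_DER[OF order_refl that]] by (simp add: F_def[abs_def])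
  have F0: "F x = 0" if "x \<in> X" for x
  proof -
    have x: "v x \<noteq> 0" using v0 Suc.prems(3) that by auto
    have "v x * F x = (\<Sum>j<Suc m. c j * u j x)"
      unfolding sum.lessThan_Suc_shift F_def
      using x by (simp add: distrib_left sum_distrib_left v_def[symmetric] mult.left_commute)
    then show ?thesis using Suc.prems(6)[OF that] x by simp
  qed
  obtain Y where Y: "Y \<subseteq> S" "finite Y" "card Y = m" "\<And>y. y \<in> Y \<Longrightarrow> (\<Sum>j<m. c (Suc j) * w j y) = 0"
    using rolle_finite[OF S(2) F_DER Suc.prems(3,4,5) F0] by blast
  have c: "\<forall>j<m. c (Suc j) = 0"
  proof (rule Suc.IH[where u = w and X = Y])
    show "smooth_on S (w j)" if "j < m" for j by (rule smooth_w[OF that])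
    show "\<forall>j<k. a j = 0"
      if "k \<le> m" "t \<in> S" "flat k (\<lambda>s. \<Sum>j<k. a j * w j s) t" for k t a
      by (rule nondeg[OF that])
  qed (use Y in auto)
  obtain x where x: "x \<in> X" using Suc.prems(5) by fastforce
  have "c 0 = 0" using F0[OF x] c by (simp add: F_def)
  with c show ?case by (auto simp: less_Suc_eq_0_disj)
qed

section \<open>Moment functionals and Hankel kernels\<close>

text \<open>The linear functional that sends the monomial of degree \<open>i\<close> to
  \<open>m i\<close>; the sequence need not come from a measure.\<close>

definition mom :: "(nat \<Rightarrow> real) \<Rightarrow> real poly \<Rightarrow> real" where
  "mom m p = (\<Sum>i\<le>degree p. coeff p i * m i)"

definition hankel_psd :: "nat \<Rightarrow> (nat \<Rightarrow> real) \<Rightarrow> bool" where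
  "hankel_psd n m \<longleftrightarrow> (\<forall>p. degree p < n \<longrightarrow> 0 \<le> mom m (p * p))"

definition hankel_pd :: "nat \<Rightarrow> (nat \<Rightarrow> real) \<Rightarrow> bool" where
  "hankel_pd n m \<longleftrightarrow> (\<forall>p. degree p < n \<longrightarrow> p \<noteq> 0 \<longrightarrow> 0 < mom m (p * p))"

definition poly_of :: "nat \<Rightarrow> (nat \<Rightarrow> real) \<Rightarrow> real poly" where
  "poly_of n c = (\<Sum>i<n. monom (c i) i)"

lemma mom_le: "degree p \<le> N \<Longrightarrow> mom m p = (\<Sum>i\<le>N. coeff p i * m i)"
  unfolding mom_def by (rule sum.mono_neutral_left) (auto simp: coeff_eq_0)

lemma mom_0 [simp]: "mom m 0 = 0"
  by (simp add: mom_def)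

lemma mom_add: "mom m (p + q) = mom m p + mom m q"
proof -
  define N where "N = max (degree p) (degree q)"
  have "degree (p + q) \<le> N" unfolding N_def by (rule degree_add_le_max)
  then show ?thesis
    using mom_le[of p N m] mom_le[of q N m] mom_le[of "p + q" N m]
    by (simp add: N_def distrib_right sum.distrib)
qed

lemma mom_smult: "mom m (Polynomial.smult a p) = a * mom m p"
  using mom_le[of "Polynomial.smult a p" "degree p" m] degree_smult_le[of a p]
  by (simp add: mom_def sum_distrib_left mult.assoc)

lemma mom_minus: "mom m (- p) = - mom m p"
  using mom_smult[of m "-1" p] by simp

lemma mom_diff: "mom m (p - q) = mom m p - mom m q"
  using mom_add[of m p "- q"] by (simp add: mom_minus)

lemma mom_sum: "mom m (\<Sum>i\<in>A. p i) = (\<Sum>i\<in>A. mom m (p i))"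
  by (induction A rule: infinite_finite_induct) (auto simp: mom_add)

lemma mom_monom: "mom m (monom a k) = a * m k"
proof -
  have "mom m (monom a k) = (\<Sum>i\<le>k. if i = k then a * m i else 0)"
    unfolding mom_le[OF degree_monom_le] by (rule sum.cong) auto
  then show ?thesis by simp
qed

lemma mom_1: "mom m 1 = m 0"
  using mom_monom[of m 1 0] by simp

lemma mom_pCons: "mom m (pCons 0 p) = mom (\<lambda>i. m (Suc i)) p"
proof -
  have "mom m (pCons 0 p) = (\<Sum>i\<le>Suc (degree p). coeff (pCons 0 p) i * m i)"
    by (rule mom_le) (simp add: degree_pCons_le)
  then show ?thesis by (simp add: mom_def sum.atMost_Suc_shift del: sum.atMost_Suc)
qed

lemma mom_linear: "mom (\<lambda>i. a i + c * b i) p = mom a p + c * mom b p"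
  by (simp add: mom_def distrib_left sum.distrib sum_distrib_left mult.left_commute)

lemma mom_scale: "mom (\<lambda>i. c * b i) p = c * mom b p"
  by (simp add: mom_def sum_distrib_left mult.left_commute)

lemma mom_DERIV:
  assumes "deriv_tower S G" "t \<in> S"
  shows "((\<lambda>t. mom (\<lambda>i. G i t) p) has_real_derivative mom (\<lambda>i. G (Suc i) t) p) (at t)"
  unfolding mom_def by (intro DERIV_sum DERIV_cmult deriv_towerD[OF assms])

lemma coeff_poly_of: "coeff (poly_of n c) i = (if i < n then c i else 0)"
  by (simp add: poly_of_def coeff_sum)

lemma degree_poly_of: "0 < n \<Longrightarrow> degree (poly_of n c) < n"
  by (rule le_less_trans[OF degree_le[of "n - 1"]]) (auto simp: coeff_poly_of)

lemma poly_of_coeff: "degree p < n \<Longrightarrow> poly_of n (coeff p) = p"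
  by (rule poly_eqI) (auto simp: coeff_poly_of coeff_eq_0)

lemma mom_poly_of_mult:
  "mom m (poly_of n c * poly_of k d) = (\<Sum>i<n. \<Sum>j<k. c i * d j * m (i + j))"
  by (simp add: poly_of_def sum_product mult_monom mom_sum mom_monom)

text \<open>The coefficients of a polynomial of degree below \<open>n\<close> are an arbitrary
  vector of length \<open>n\<close>. The case \<open>n = 0\<close> is separate because no polynomial
  has degree below 0.\<close>

lemma hankel_psd_iff: "hankel_psd n m \<longleftrightarrow> psd_kernel n (\<lambda>i j. m (i + j))"
proof -
  have eq: "quad_form n (\<lambda>i j. m (i + j)) c = mom m (poly_of n c * poly_of n c)" for c
    by (simp add: quad_form_def mom_poly_of_mult)
  show ?thesis
  proof (cases "n = 0")
    case True
    then show ?thesis by (simp add: hankel_psd_def psd_kernel_def quad_form_def)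
  next
    case False
    then show ?thesis
      unfolding hankel_psd_def psd_kernel_def eq
      by (metis degree_poly_of poly_of_coeff gr0I)
  qed
qed

lemma hankel_pd_nonsing:
  assumes "hankel_pd n m" "k \<le> n" "\<And>i. i < k \<Longrightarrow> (\<Sum>j<k. c j * m (i + j)) = 0"
  shows "\<forall>j<k. c j = 0"
proof (intro allI impI)
  fix j assume j: "j < k"
  have "mom m (poly_of k c * poly_of k c) = (\<Sum>i<k. c i * (\<Sum>j<k. c j * m (i + j)))"
    by (simp add: mom_poly_of_mult sum_distrib_left mult.assoc)
  also have "\<dots> = 0" using assms(3) by simp
  finally have "poly_of k c = 0"
    using assms(1,2) degree_poly_of[of k c] j unfolding hankel_pd_def
    by (metis less_le_trans less_nat_zero_code less_numeral_extra(3) not_gr_zero)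
  then show "c j = 0" using coeff_poly_of[of k c j] j by simp
qed

text \<open>\<open>chebyshev_system\<close> is used twice. First the derivatives \<open>G j\<close>
  form such a system, since a flat combination of them would give a null vector of a Hankel matrix;
  this makes the matrices \<open>G j (x i + r)\<close> nonsingular. Their transposes are the
  Wronskian matrices of the translates of \<open>G 0\<close>, which therefore form a system too, and
  its nonsingularity at the points \<open>x i\<close> is the claim.\<close>

lemma kernel_nonsing:
  assumes J: "open J" "is_interval J" and G: "deriv_tower J G"
    and pd: "\<And>t. t \<in> J \<Longrightarrow> hankel_pd n (\<lambda>i. G i t)"
    and "m \<le> n" and inj: "inj_on x {..<m}" and x: "\<And>i j. i < m \<Longrightarrow> j < m \<Longrightarrow> x i + x j \<in> J"
  shows "trivial_kernel m (\<lambda>i j. G 0 (x i + x j))"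
proof -
  have derivs: "trivial_kernel m' (\<lambda>i j. G j (x i + r))"
    if m': "m' \<le> m" and r: "\<And>i. i < m' \<Longrightarrow> x i + r \<in> J" for m' r
    unfolding trivial_kernel_def
  proof (intro allI impI)
    fix c assume c: "\<forall>i<m'. (\<Sum>j<m'. G j (x i + r) * c j) = 0"
    have "\<forall>j<m'. c j = 0"
    proof (rule chebyshev_system[OF J])
      show "smooth_on J (G j)" for j by (rule deriv_tower_smooth[OF G])
      show "\<forall>j<k. a j = 0" if k: "k \<le> m'" and t: "t \<in> J" and flat: "flat k (\<lambda>s. \<Sum>j<k. a j * G j s) t"
        for k t a
      proof (rule hankel_pd_nonsing[OF pd[OF t]])
        define D where "D i s = (\<Sum>j<k. a j * G (i + j) s)" for i s
        have "deriv_tower J D"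
          unfolding deriv_tower_def D_def
          by (intro allI ballI DERIV_sum DERIV_cmult) (use deriv_towerD[OF G] in simp)
        moreover have "flat k (D 0) t" using flat by (simp add: D_def[abs_def])
        ultimately show "(\<Sum>j<k. a j * G (i + j) t) = 0" if "i < k" for i
          using flat_imp_derivs_zero[OF _ J(1) t _ that, of D] by (simp add: D_def)
        show "k \<le> n" using k m' \<open>m \<le> n\<close> by simp
      qed
      have inj': "inj_on (\<lambda>i. x i + r) {..<m'}" using inj m' by (auto simp: inj_on_def)
      show "(\<lambda>i. x i + r) ` {..<m'} \<subseteq> J" using r by auto
      show "card ((\<lambda>i. x i + r) ` {..<m'}) = m'" using card_image[OF inj'] by simp
      show "(\<Sum>j<m'. c j * G j y) = 0" if "y \<in> (\<lambda>i. x i + r) ` {..<m'}" for y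
        using c that by (auto simp: mult.commute)
    qed simp
    then show "\<And>j. j < m' \<Longrightarrow> c j = 0" by blast
  qed
  define J' where "J' = (\<Inter>i<m. (\<lambda>s. x i + s) -` J)"
  show ?thesis
    unfolding trivial_kernel_def
  proof (intro allI impI)
    fix c assume c: "\<forall>i<m. (\<Sum>j<m. G 0 (x i + x j) * c j) = 0"
    have DD: "deriv_tower J' (\<lambda>i s. G i (x j + s))" if "j < m" for j
      unfolding deriv_tower_def
    proof (intro allI ballI)
      fix i s assume "s \<in> J'"
      then have "x j + s \<in> J" using that by (auto simp: J'_def)
      from deriv_towerD[OF G this, of i]
      have "((\<lambda>s. G i (x j + s)) has_real_derivative G (Suc i) (x j + s) * 1) (at s)"
        by (rule DERIV_chain2) (auto intro!: derivative_eq_intros)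
      then show "((\<lambda>s. G i (x j + s)) has_real_derivative G (Suc i) (x j + s)) (at s)" by simp
    qed
    have J': "open J'"
      unfolding J'_def by (intro open_INT ballI open_vimage J continuous_intros) auto
    have "\<forall>j<m. c j = 0"
    proof (rule chebyshev_system[OF J'])
      show "is_interval J'"
        unfolding is_interval_1
      proof (intro ballI allI impI)
        fix a b s assume ab: "a \<in> J'" "b \<in> J'" "a \<le> s \<and> s \<le> b"
        have "x i + s \<in> J" if "i < m" for i
          by (rule mem_is_interval_1_I[OF J(2), of "x i + a" "x i + b"])
            (use ab that in \<open>auto simp: J'_def\<close>)
        then show "s \<in> J'" by (auto simp: J'_def)
      qed
      show "smooth_on J' (\<lambda>s. G 0 (x j + s))" if "j < m" for j
        using deriv_tower_smooth[OF DD[OF that], of 0] .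
      show "\<forall>j<k. a j = 0" if k: "k \<le> m" and t: "t \<in> J'"
        and flat: "flat k (\<lambda>s. \<Sum>j<k. a j * G 0 (x j + s)) t" for k t a
      proof -
        define D where "D i s = (\<Sum>j<k. a j * G i (x j + s))" for i s
        have D: "deriv_tower J' D"
          unfolding deriv_tower_def D_def
          by (intro allI ballI DERIV_sum DERIV_cmult) (use deriv_towerD[OF DD] k in simp)
        have "flat k (D 0) t" using flat by (simp add: D_def[abs_def])
        then have zero: "D i t = 0" if "i < k" for i
          using flat_imp_derivs_zero[OF D J' t _ that] by simp
        have t': "x i + t \<in> J" if "i < m" for i using t that by (auto simp: J'_def)
        show ?thesis
          using trivial_kernel_transpose[OF derivs[of k t]] k t' zero
          unfolding trivial_kernel_def by (simp add: D_def mult.commute)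
      qed
      show "x ` {..<m} \<subseteq> J'" using x by (auto simp: J'_def)
      show "card (x ` {..<m}) = m" using card_image[OF inj] by simp
      show "(\<Sum>j<m. c j * G 0 (x j + y)) = 0" if "y \<in> x ` {..<m}" for y
        using c that by (auto simp: mult.commute add.commute)
    qed simp
    then show "\<And>j. j < m \<Longrightarrow> c j = 0" by blast
  qed
qed

section \<open>Exponential sums and positivity of the kernel g(s + t)\<close>

lemma psd_kernel_of_gram:
  fixes w :: "'k \<Rightarrow> nat \<Rightarrow> real"
  shows "psd_kernel n (\<lambda>i j. \<Sum>k\<in>A. w k i * w k j)"
  unfolding psd_kernel_def
proof
  fix c
  have "quad_form n (\<lambda>i j. \<Sum>k\<in>A. w k i * w k j) c =
      (\<Sum>i<n. \<Sum>j<n. \<Sum>k\<in>A. (c i * w k i) * (c j * w k j))"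
    unfolding quad_form_def by (intro sum.cong refl) (simp add: sum_distrib_left ac_simps)
  also have "\<dots> = (\<Sum>k\<in>A. (\<Sum>i<n. c i * w k i)\<^sup>2)"
    unfolding power2_eq_square sum_product
    by (subst (2) sum.swap, subst sum.swap) (rule refl)
  also have "\<dots> \<ge> 0" by (intro sum_nonneg) simp
  finally show "0 \<le> quad_form n (\<lambda>i j. \<Sum>k\<in>A. w k i * w k j) c" .
qed

text \<open>These derivatives belong to the choice \<open>f(x) = 1 + x + \<dots> + x\<^bsup>n-1\<^esup>\<close>; note that \<open>0\<^sup>0 = 1\<close>.\<close>

definition exp_tower :: "nat \<Rightarrow> nat \<Rightarrow> real \<Rightarrow> real" where
  "exp_tower n i t = (\<Sum>k<n. real k ^ i * exp (real k * t))"

lemma deriv_tower_exp_tower: "deriv_tower S (exp_tower n)"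
  unfolding deriv_tower_def exp_tower_def
  by (intro allI ballI DERIV_sum) (auto intro!: derivative_eq_intros)

lemma mom_exp_tower: "mom (\<lambda>i. exp_tower n i t) p = (\<Sum>k<n. exp (real k * t) * poly p (real k))"
  unfolding mom_def exp_tower_def poly_altdef sum_distrib_left
  by (subst sum.swap) (simp add: ac_simps)

text \<open>These are the moments of point masses \<open>exp (k t)\<close> at
  \<open>0, ..., n - 1\<close>; a nonzero polynomial of degree below \<open>n\<close> cannot vanish
  at all \<open>n\<close> of these points.\<close>

lemma hankel_pd_exp_tower: "hankel_pd n (\<lambda>i. exp_tower n i t)"
  unfolding hankel_pd_def
proof (intro allI impI)
  fix p :: "real poly" assume p: "degree p < n" "p \<noteq> 0"
  have "\<exists>k<n. poly p (real k) \<noteq> 0"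
  proof (rule ccontr)
    assume "\<not> ?thesis"
    then have "real ` {..<n} \<subseteq> {x. poly p x = 0}" by auto
    then have "card (real ` {..<n}) \<le> degree p"
      using card_mono[OF poly_roots_finite[OF p(2)]] card_poly_roots_bound[OF p(2)] by (meson order_trans)
    then show False using p(1) by (simp add: card_image)
  qed
  then obtain k where k: "k < n" "poly p (real k) \<noteq> 0" by auto
  show "0 < mom (\<lambda>i. exp_tower n i t) (p * p)"
    unfolding mom_exp_tower
    by (rule sum_pos2[of _ k]) (use k in \<open>auto simp: zero_less_mult_iff linorder_neq_iff\<close>)
qed

lemma hankel_pd_perturb:
  assumes "hankel_psd n a" "hankel_pd n b" "0 \<le> r" "0 < s"
  shows "hankel_pd n (\<lambda>i. r * a i + s * b i)"
  unfolding hankel_pd_def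
proof (intro allI impI)
  fix p :: "real poly" assume p: "degree p < n" "p \<noteq> 0"
  have "0 \<le> mom a (p * p)" "0 < mom b (p * p)"
    using assms(1,2) p by (auto simp: hankel_psd_def hankel_pd_def)
  then have "0 < r * mom a (p * p) + s * mom b (p * p)"
    using assms(3,4) by (simp add: add_nonneg_pos)
  then show "0 < mom (\<lambda>i. r * a i + s * b i) (p * p)"
    by (simp add: mom_linear mom_scale)
qed

lemma deriv_tower_linear:
  assumes "deriv_tower S F" "deriv_tower S G"
  shows "deriv_tower S (\<lambda>i t. r * F i t + s * G i t)"
  unfolding deriv_tower_def
  by (intro allI ballI DERIV_add DERIV_cmult) (use assms in \<open>auto simp: deriv_tower_def\<close>)

text \<open>For \<open>0 < \<theta>\<close> the admixture of \<open>exp_tower\<close> makes the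
  Hankel matrices positive definite, so \<open>kernel_nonsing\<close> keeps every leading block
  nonsingular on the way to a sum of rank-one kernels.\<close>

lemma psd_kernel_hankel_inj:
  assumes J: "open J" "is_interval J" and G: "deriv_tower J G"
    and psd: "\<And>t. t \<in> J \<Longrightarrow> hankel_psd n (\<lambda>i. G i t)"
    and "m \<le> n" and inj: "inj_on x {..<m}" and x: "\<And>i j. i < m \<Longrightarrow> j < m \<Longrightarrow> x i + x j \<in> J"
  shows "psd_kernel m (\<lambda>i j. G 0 (x i + x j))"
proof (rule psd_kernel_homotopy[where B = "\<lambda>i j. exp_tower n 0 (x i + x j)"])
  have "(\<lambda>i j. exp_tower n 0 (x i + x j)) =
      (\<lambda>i j. \<Sum>k<n. exp (real k * x i) * exp (real k * x j))"
    by (intro ext) (simp add: exp_tower_def distrib_left exp_add)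
  then show "psd_kernel m (\<lambda>i j. exp_tower n 0 (x i + x j))"
    by (simp add: psd_kernel_of_gram)
  fix \<theta> :: real and k :: nat
  assume \<theta>: "0 < \<theta>" "\<theta> \<le> 1" and k: "k \<le> m"
  show "trivial_kernel k (\<lambda>i j. (1 - \<theta>) * G 0 (x i + x j) + \<theta> * exp_tower n 0 (x i + x j))"
  proof (rule kernel_nonsing[OF J, where n = n and G = "\<lambda>i t. (1 - \<theta>) * G i t + \<theta> * exp_tower n i t"])
    show "deriv_tower J (\<lambda>i t. (1 - \<theta>) * G i t + \<theta> * exp_tower n i t)"
      by (rule deriv_tower_linear[OF G deriv_tower_exp_tower])
    show "hankel_pd n (\<lambda>i. (1 - \<theta>) * G i t + \<theta> * exp_tower n i t)" if "t \<in> J" for t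
      by (rule hankel_pd_perturb[OF psd[OF that] hankel_pd_exp_tower]) (use \<theta> in auto)
  qed (use k \<open>m \<le> n\<close> inj x in \<open>auto simp: inj_on_def\<close>)
qed (auto simp: add.commute)

text \<open>Points may coincide: the injective case is applied to an enumeration of the distinct
  values, and reindexing restores the repetitions.\<close>

lemma psd_kernel_hankel:
  assumes J: "open J" "is_interval J" and G: "deriv_tower J G"
    and psd: "\<And>t. t \<in> J \<Longrightarrow> hankel_psd n (\<lambda>i. G i t)"
    and x: "\<And>i j. i < n \<Longrightarrow> j < n \<Longrightarrow> x i + x j \<in> J"
  shows "psd_kernel n (\<lambda>i j. G 0 (x i + x j))"
proof -
  define V where "V = x ` {..<n}"
  obtain y where y: "bij_betw y {0..<card V} V"
    using ex_bij_betw_nat_finite[of V] by (auto simp: V_def)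
  then have y': "inj_on y {..<card V}" "y ` {..<card V} = V"
    by (auto simp: bij_betw_def lessThan_atLeast0)
  have yx: "\<exists>i<n. y a = x i" if "a < card V" for a
    using y'(2) that by (fastforce simp: V_def)
  have V: "psd_kernel (card V) (\<lambda>a b. G 0 (y a + y b))"
  proof (rule psd_kernel_hankel_inj[OF J G psd _ y'(1)])
    show "card V \<le> n" using card_image_le[of "{..<n}" x] by (simp add: V_def)
    show "y a + y b \<in> J" if "a < card V" "b < card V" for a b
      using yx[OF that(1)] yx[OF that(2)] x by auto
  qed
  obtain \<pi> where \<pi>: "\<And>i. i < n \<Longrightarrow> \<pi> i < card V" "\<And>i. i < n \<Longrightarrow> y (\<pi> i) = x i"
  proof -
    have "\<forall>i. \<exists>a. i < n \<longrightarrow> a < card V \<and> y a = x i"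
      using y'(2) unfolding V_def by (metis imageE imageI lessThan_iff)
    then show thesis using that by metis
  qed
  have "psd_kernel n (\<lambda>i j. G 0 (y (\<pi> i) + y (\<pi> j)))"
    by (rule psd_kernel_reindex[OF V]) (rule \<pi>(1))
  then show ?thesis
    by (rule iffD1[OF psd_kernel_cong, rotated]) (simp add: \<pi>)
qed

section \<open>Orthogonal polynomials and the Toda equation\<close>

text \<open>Gram-Schmidt applied to the monomials. Degree and leading coefficient hold for every
  sequence, even where a division by 0 occurs; orthogonality needs \<open>hankel_pd\<close>.\<close>

fun orth_poly :: "(nat \<Rightarrow> real) \<Rightarrow> nat \<Rightarrow> real poly" where
  "orth_poly m k = monom 1 k - (\<Sum>j<k. Polynomial.smult
     (mom m (monom 1 k * orth_poly m j) / mom m (orth_poly m j * orth_poly m j)) (orth_poly m j))"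

declare orth_poly.simps [simp del]

lemma degree_orth_poly_le: "degree (orth_poly m k) \<le> k"
proof (induction k rule: less_induct)
  case (less k)
  show ?case
    by (subst orth_poly.simps, intro degree_le allI impI)
      (auto simp: coeff_sum intro!: sum.neutral coeff_eq_0 less.IH[THEN le_less_trans])
qed

lemma coeff_orth_poly_above: "k < i \<Longrightarrow> coeff (orth_poly m k) i = 0"
  using degree_orth_poly_le[of m k] by (intro coeff_eq_0) simp

lemma coeff_orth_poly_lead: "coeff (orth_poly m k) k = 1"
  by (subst orth_poly.simps) (simp add: coeff_sum coeff_orth_poly_above)

lemma orth_poly_0: "orth_poly m 0 = 1"
  by (subst orth_poly.simps) (simp add: monom_0 one_pCons)

lemma degree_orth_poly: "degree (orth_poly m k) = k"
  using degree_orth_poly_le[of m k] le_degree[of "orth_poly m k" k] coeff_orth_poly_lead[of m k] by simp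

lemma mom_orth_poly_pos:
  assumes "hankel_pd (Suc n) m" "k \<le> n"
  shows "0 < mom m (orth_poly m k * orth_poly m k)"
  using assms coeff_orth_poly_lead[of m k] unfolding hankel_pd_def
  by (metis coeff_0 degree_orth_poly le_imp_less_Suc zero_neq_one)

text \<open>Induction on \<open>k\<close> makes the earlier polynomials mutually orthogonal, hence
  the subtracted projections exact; then \<open>q\<close> is expanded in them from the top
  coefficient down. Stating the degree bound through coefficients includes \<open>k = 0\<close>,
  where \<open>q = 0\<close>.\<close>

lemma mom_orth_poly:
  assumes pd: "hankel_pd (Suc n) m" and "k \<le> n" "\<And>i. k \<le> i \<Longrightarrow> coeff q i = 0"
  shows "mom m (orth_poly m k * q) = 0"
  using assms(2,3)
proof (induction k arbitrary: q rule: less_induct)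
  case (less k)
  have orth: "mom m (orth_poly m k * orth_poly m i) = 0" if i: "i < k" for i
  proof -
    define h where "h j = mom m (orth_poly m j * orth_poly m j)" for j
    have hi: "h i \<noteq> 0" using mom_orth_poly_pos[OF pd, of i] i less.prems by (simp add: h_def)
    have ij: "mom m (orth_poly m j * orth_poly m i) = (if j = i then h i else 0)" if "j < k" for j
    proof (cases j i rule: linorder_cases)
      case less
      then show ?thesis
        using less.IH[of i "orth_poly m j"] i less.prems coeff_orth_poly_above by (simp add: mult.commute)
    next
      case greater
      then show ?thesis
        using less.IH[of j "orth_poly m i"] that less.prems coeff_orth_poly_above by simp
    qed (simp add: h_def)
    have "mom m (orth_poly m k * orth_poly m i) = mom m (monom 1 k * orth_poly m i) -
        (\<Sum>j<k. mom m (monom 1 k * orth_poly m j) / h j * mom m (orth_poly m j * orth_poly m i))"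
      by (subst orth_poly.simps)
        (simp add: left_diff_distrib mom_diff sum_distrib_right mom_sum mom_smult h_def)
    also have "(\<Sum>j<k. mom m (monom 1 k * orth_poly m j) / h j * mom m (orth_poly m j * orth_poly m i)) =
        (\<Sum>j<k. if j = i then mom m (monom 1 k * orth_poly m i) else 0)"
      using hi by (intro sum.cong refl) (auto simp: ij)
    also have "\<dots> = mom m (monom 1 k * orth_poly m i)" using i by simp
    finally show ?thesis by simp
  qed
  have "mom m (orth_poly m k * q) = 0" if "d \<le> k" "\<And>i. d \<le> i \<Longrightarrow> coeff q i = 0" for d q
    using that
  proof (induction d arbitrary: q)
    case 0
    then have "q = 0" by (intro poly_eqI) simp
    then show ?case by simp
  next
    case (Suc d)
    define q' where "q' = q - Polynomial.smult (coeff q d) (orth_poly m d)"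
    have "coeff q' i = 0" if "d \<le> i" for i
      using that Suc.prems(2)[of i] by (cases "i = d")
        (auto simp: q'_def coeff_orth_poly_lead coeff_orth_poly_above)
    then have "mom m (orth_poly m k * q') = 0" using Suc by simp
    moreover have "q = q' + Polynomial.smult (coeff q d) (orth_poly m d)" by (simp add: q'_def)
    moreover have "mom m (orth_poly m k * orth_poly m d) = 0" using orth Suc.prems by simp
    ultimately show ?case
      by (metis (no_types, lifting) add.right_neutral distrib_left mom_add mom_smult mult_smult_right mult_zero_right)
  qed
  then show ?case using less.prems by blast
qed

lemma mom_orth_poly_lead:
  assumes pd: "hankel_pd (Suc n) m" and "k \<le> n" "\<And>i. k < i \<Longrightarrow> coeff q i = 0"
  shows "mom m (orth_poly m k * q) = coeff q k * mom m (orth_poly m k * orth_poly m k)"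
proof -
  define q' where "q' = q - Polynomial.smult (coeff q k) (orth_poly m k)"
  have "coeff q' i = 0" if "k \<le> i" for i
    using that assms(3)[of i] by (cases "i = k")
      (auto simp: q'_def coeff_orth_poly_lead coeff_orth_poly_above)
  then have "mom m (orth_poly m k * q') = 0" using mom_orth_poly[OF pd assms(2)] by blast
  then show ?thesis
    by (simp add: q'_def right_diff_distrib mom_diff mom_smult)
qed

lemma mom_poly_DERIV:
  assumes P: "\<And>i. ((\<lambda>t. coeff (P t) i) has_real_derivative coeff P' i) (at t0)"
    and deg: "\<And>t. degree (P t) \<le> N" "degree P' \<le> N"
    and G: "deriv_tower J G" "t0 \<in> J"
  shows "((\<lambda>t. mom (\<lambda>i. G i t) (P t * q)) has_real_derivative
    mom (\<lambda>i. G i t0) (P' * q) + mom (\<lambda>i. G (Suc i) t0) (P t0 * q)) (at t0)"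
proof -
  define M where "M = N + degree q"
  have deg_q: "degree (R * q) \<le> M" if "degree R \<le> N" for R
    using degree_mult_le[of R q] that by (simp add: M_def)
  have "((\<lambda>t. \<Sum>i\<le>M. coeff (P t * q) i * G i t) has_real_derivative
      (\<Sum>i\<le>M. coeff (P' * q) i * G i t0 + G (Suc i) t0 * coeff (P t0 * q) i)) (at t0)"
    unfolding coeff_mult
    by (intro DERIV_sum DERIV_mult DERIV_cmult_right P deriv_towerD[OF G])
  then show ?thesis
    by (simp add: mom_le[OF deg_q[OF deg(1)]] mom_le[OF deg_q[OF deg(2)]] sum.distrib
        mult.commute[of "G _ _"])
qed

lemma mom_const_DERIV:
  assumes P: "\<And>i. ((\<lambda>t. coeff (P t) i) has_real_derivative coeff P' i) (at t0)"
    and deg: "\<And>t. degree (P t) \<le> N" "degree P' \<le> N"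
  shows "((\<lambda>t. mom m (P t)) has_real_derivative mom m P') (at t0)"
proof -
  have "((\<lambda>t. \<Sum>i\<le>N. coeff (P t) i * m i) has_real_derivative (\<Sum>i\<le>N. coeff P' i * m i)) (at t0)"
    by (intro DERIV_sum DERIV_cmult_right P)
  then show ?thesis by (simp add: mom_le[OF deg(1)] mom_le[OF deg(2)])
qed

lemma mom_poly_differentiable:
  assumes P: "\<And>i. (\<lambda>t. coeff (P t) i) differentiable (at t0)"
    and deg: "\<And>t. degree (P t) \<le> N"
    and G: "deriv_tower J G" "t0 \<in> J"
  shows "(\<lambda>t. mom (\<lambda>i. G i t) (P t)) differentiable (at t0)"
proof -
  have "G i differentiable (at t0)" for i
    using deriv_towerD[OF G] by (auto simp: real_differentiable_def)
  then have "(\<lambda>t. \<Sum>i\<le>N. coeff (P t) i * G i t) differentiable (at t0)"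
    by (intro differentiable_sum ballI differentiable_mult P) auto
  then show ?thesis by (simp add: mom_le[OF deg])
qed

lemma orth_poly_differentiable:
  assumes G: "deriv_tower J G" "t0 \<in> J" and pd: "hankel_pd (Suc n) (\<lambda>i. G i t0)" and "k \<le> n"
  shows "(\<lambda>t. coeff (orth_poly (\<lambda>i. G i t) k) i) differentiable (at t0)"
  using \<open>k \<le> n\<close>
proof (induction k arbitrary: i rule: less_induct)
  case (less k)
  define P where "P j t = orth_poly (\<lambda>i. G i t) j" for j t
  have IH: "(\<lambda>t. coeff (P j t) i) differentiable (at t0)" if "j < k" for i j
    using less.IH[OF that] that less.prems by (simp add: P_def)
  have deg: "degree (P j t) \<le> j" for j t by (simp add: P_def degree_orth_poly_le)
  have prod: "(\<lambda>t. coeff (R t * P j t) i) differentiable (at t0)"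
    if "j < k" "\<And>i. (\<lambda>t. coeff (R t) i) differentiable (at t0)" for R j i
    unfolding coeff_mult by (intro differentiable_sum ballI differentiable_mult IH that) auto
  have num: "(\<lambda>t. mom (\<lambda>i. G i t) (monom 1 k * P j t)) differentiable (at t0)" if "j < k" for j
  proof (rule mom_poly_differentiable[OF prod[OF that] _ G])
    show "degree (monom 1 k * P j t) \<le> k + j" for t
      by (rule order_trans[OF degree_mult_le]) (simp add: degree_monom_eq deg)
  qed simp
  have den: "(\<lambda>t. mom (\<lambda>i. G i t) (P j t * P j t)) differentiable (at t0)" if "j < k" for j
  proof (rule mom_poly_differentiable[OF prod[OF that IH[OF that]] _ G])
    show "degree (P j t * P j t) \<le> j + j" for t
      by (rule order_trans[OF degree_mult_le]) (simp add: deg add_mono)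
  qed
  have nz: "mom (\<lambda>i. G i t0) (P j t0 * P j t0) \<noteq> 0" if "j < k" for j
    using mom_orth_poly_pos[OF pd, of j] that less.prems by (simp add: P_def)
  have "(\<lambda>t. coeff (monom 1 k) i - (\<Sum>j<k. mom (\<lambda>i. G i t) (monom 1 k * P j t) /
      mom (\<lambda>i. G i t) (P j t * P j t) * coeff (P j t) i)) differentiable (at t0)"
    by (intro differentiable_diff differentiable_sum ballI differentiable_mult differentiable_divide num den IH nz)
      auto
  then show ?case
    unfolding P_def by (subst orth_poly.simps) (simp add: coeff_sum)
qed

text \<open>The Toda equation: differentiating the orthogonality relations in \<open>t\<close>, where \<open>d/dt\<close> acts on the
  moments as multiplication by \<open>x\<close>, shows that the derivative of the \<open>k\<close>-th monic orthogonal polynomial is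
  orthogonal to all polynomials of degree below \<open>k - 1\<close>.\<close>

lemma orth_poly_toda:
  assumes J: "open J" "t0 \<in> J" and G: "deriv_tower J G"
    and pd: "\<And>t. t \<in> J \<Longrightarrow> hankel_pd (Suc n) (\<lambda>i. G i t)" and "Suc l \<le> n"
  defines "P \<equiv> \<lambda>k t. orth_poly (\<lambda>i. G i t) k"
  defines "h \<equiv> \<lambda>k. mom (\<lambda>i. G i t0) (P k t0 * P k t0)"
  shows "((\<lambda>t. coeff (P (Suc l) t) i) has_real_derivative
    coeff (Polynomial.smult (- (h (Suc l) / h l)) (P l t0)) i) (at t0)"
proof -
  let ?k = "Suc l" and ?m = "\<lambda>i. G i t0"
  \<comment> \<open>The leading coefficient is constantly 1, so only the lower coefficients have a
    derivative to record.\<close>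
  define D where "D = poly_of ?k (\<lambda>i. deriv (\<lambda>t. coeff (P ?k t) i) t0)"
  have D: "((\<lambda>t. coeff (P ?k t) i) has_real_derivative coeff D i) (at t0)" for i
  proof (cases "i < ?k")
    case True
    then show ?thesis
      using orth_poly_differentiable[OF G J(2) pd[OF J(2)] \<open>Suc l \<le> n\<close>, of i]
      by (simp add: D_def coeff_poly_of P_def DERIV_deriv_iff_real_differentiable)
  next
    case False
    then have "(\<lambda>t. coeff (P ?k t) i) = (\<lambda>t. if i = ?k then 1 else 0)"
      by (intro ext) (auto simp: P_def coeff_orth_poly_lead coeff_orth_poly_above)
    then show ?thesis using False by (simp add: D_def coeff_poly_of)
  qed
  have degD: "degree D \<le> ?k" using degree_poly_of[of ?k] by (simp add: D_def less_imp_le)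
  have degP: "degree (P k t) \<le> k" for k t by (simp add: P_def degree_orth_poly_le)
  have hpos: "0 < h ?k" "0 < h l"
    using mom_orth_poly_pos[OF pd[OF J(2)]] \<open>Suc l \<le> n\<close> by (auto simp: h_def P_def)
  define b where "b = h ?k / h l"
  \<comment> \<open>The claim is \<open>Q = 0\<close>; by positive definiteness it suffices that the
    functional vanishes on \<open>Q * Q\<close>.\<close>
  define Q where "Q = D + Polynomial.smult b (P l t0)"
  have coeffQ: "coeff Q i = 0" if "?k \<le> i" for i
    using that by (simp add: Q_def D_def coeff_poly_of P_def coeff_orth_poly_above)
  \<comment> \<open>For this fixed \<open>Q\<close>, of degree at most \<open>l\<close>,
    orthogonality to \<open>P (Suc l) t\<close> holds for all \<open>t\<close> in \<open>J\<close>
    and can be differentiated.\<close>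
  have zero: "mom ?m (D * Q) + mom (\<lambda>i. G (Suc i) t0) (P ?k t0 * Q) = 0"
  proof (rule DERIV_unique)
    show "((\<lambda>t. mom (\<lambda>i. G i t) (P ?k t * Q)) has_real_derivative
        mom ?m (D * Q) + mom (\<lambda>i. G (Suc i) t0) (P ?k t0 * Q)) (at t0)"
      by (rule mom_poly_DERIV[OF D degP degD G J(2)])
    have "((\<lambda>t. 0) has_real_derivative 0) (at t0)" by simp
    then show "((\<lambda>t. mom (\<lambda>i. G i t) (P ?k t * Q)) has_real_derivative 0) (at t0)"
      by (rule has_field_derivative_transform_within_open[OF _ J])
        (simp add: P_def mom_orth_poly[OF pd \<open>Suc l \<le> n\<close> coeffQ])
  qed
  have "mom (\<lambda>i. G (Suc i) t0) (P ?k t0 * Q) = mom ?m (P ?k t0 * pCons 0 Q)"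
    by (simp add: mom_pCons mult_pCons_right)
  also have "\<dots> = coeff Q l * h ?k"
    using mom_orth_poly_lead[OF pd[OF J(2)] \<open>Suc l \<le> n\<close>, of "pCons 0 Q"] coeffQ
    by (simp add: P_def h_def coeff_pCons split: nat.splits)
  finally have shifted: "mom (\<lambda>i. G (Suc i) t0) (P ?k t0 * Q) = coeff Q l * h ?k" .
  have "mom ?m (P l t0 * Q) = coeff Q l * h l"
    unfolding P_def h_def using \<open>Suc l \<le> n\<close> coeffQ by (intro mom_orth_poly_lead[OF pd[OF J(2)]]) auto
  \<comment> \<open>The constant \<open>b\<close> is chosen so that the two terms cancel.\<close>
  moreover have "mom ?m (Q * Q) = mom ?m (D * Q) + b * mom ?m (P l t0 * Q)"
    by (subst (1) Q_def) (simp only: distrib_right mom_add mult_smult_left mom_smult)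
  ultimately have "mom ?m (Q * Q) = 0"
    using zero shifted hpos by (simp add: b_def mult.commute[of "coeff Q l"])
  moreover have "degree Q < Suc n"
    using degree_le[of l Q] coeffQ \<open>Suc l \<le> n\<close> by (simp add: Suc_le_eq)
  ultimately have "Q = 0" using pd[OF J(2)] unfolding hankel_pd_def by (metis less_irrefl)
  then have "D = Polynomial.smult (- b) (P l t0)"
    unfolding Q_def by (simp add: eq_neg_iff_add_eq_0)
  then show ?thesis using D[of i] by (simp add: b_def)
qed

text \<open>As a function of \<open>t\<close>, with \<open>s\<close> fixed and \<open>k\<close>
  positive, the quantity is 0 at \<open>t = s\<close> by orthogonality to constants, and by the Toda
  equation its derivative is a positive multiple of the same quantity for
  \<open>k - 1\<close>.\<close>

lemma mom_orth_poly_sign: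
  assumes J: "open J" "is_interval J" and G: "deriv_tower J G"
    and pd: "\<And>t. t \<in> J \<Longrightarrow> hankel_pd (Suc n) (\<lambda>i. G i t)"
    and "k \<le> n" "s \<in> J" "t \<in> J" "s < t"
  shows "0 < (- 1) ^ k * mom (\<lambda>i. G i s) (orth_poly (\<lambda>i. G i t) k)"
  using \<open>k \<le> n\<close> \<open>t \<in> J\<close> \<open>s < t\<close>
proof (induction k arbitrary: t)
  case 0
  have "0 < mom (\<lambda>i. G i s) (1 * 1)"
    using pd[OF \<open>s \<in> J\<close>, unfolded hankel_pd_def, rule_format, of 1] by simp
  then show ?case by (simp add: orth_poly_0)
next
  case (Suc k)
  define P where "P k t = orth_poly (\<lambda>i. G i t) k" for k t
  define h where "h k t = mom (\<lambda>i. G i t) (P k t * P k t)" for k t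
  define \<phi> where "\<phi> t = (- 1) ^ Suc k * mom (\<lambda>i. G i s) (P (Suc k) t)" for t
  have DER: "(\<phi> has_real_derivative h (Suc k) r / h k r * ((- 1) ^ k * mom (\<lambda>i. G i s) (P k r))) (at r)"
    if "r \<in> J" for r
  proof -
    have "((\<lambda>t. mom (\<lambda>i. G i s) (P (Suc k) t)) has_real_derivative
        mom (\<lambda>i. G i s) (Polynomial.smult (- (h (Suc k) r / h k r)) (P k r))) (at r)"
    proof (rule mom_const_DERIV)
      show "((\<lambda>t. coeff (P (Suc k) t) i) has_real_derivative
          coeff (Polynomial.smult (- (h (Suc k) r / h k r)) (P k r)) i) (at r)" for i
        using orth_poly_toda[OF J(1) that G pd Suc.prems(1)] by (simp add: P_def h_def)
      show "degree (P (Suc k) t) \<le> Suc k" for t by (simp add: P_def degree_orth_poly_le)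
      show "degree (Polynomial.smult (- (h (Suc k) r / h k r)) (P k r)) \<le> Suc k"
        by (rule order_trans[OF degree_smult_le]) (simp add: P_def degree_orth_poly)
    qed
    from DERIV_cmult[OF this, of "(- 1) ^ Suc k"] show ?thesis
      by (simp add: \<phi>_def[abs_def] mom_smult mom_minus ac_simps)
  qed
  have sub: "r \<in> J" if "s \<le> r" "r \<le> t" for r
    using mem_is_interval_1_I[OF J(2) \<open>s \<in> J\<close> Suc.prems(2)] that by blast
  have "\<phi> s < \<phi> t"
  proof (rule DERIV_pos_imp_increasing_open[OF Suc.prems(3)])
    fix r assume r: "s < r" "r < t"
    have hpos: "0 < h (Suc k) r" "0 < h k r"
      using mom_orth_poly_pos[OF pd[OF sub]] Suc.prems(1) r by (auto simp: h_def P_def)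
    have "0 < (- 1) ^ k * mom (\<lambda>i. G i s) (P k r)"
      using Suc.IH[of r] Suc.prems sub[of r] r by (simp add: P_def)
    then show "\<exists>y. DERIV \<phi> r :> y \<and> 0 < y"
      using DER[OF sub, of r] r hpos
      by (intro exI[of _ "h (Suc k) r / h k r * ((- 1) ^ k * mom (\<lambda>i. G i s) (P k r))"] conjI) auto
  next
    show "continuous_on {s..t} \<phi>"
      by (rule DERIV_continuous_on) (use DER sub in \<open>auto intro: has_field_derivative_at_within\<close>)
  qed
  moreover have "\<phi> s = 0"
    using mom_orth_poly[OF pd[OF \<open>s \<in> J\<close>] Suc.prems(1), of 1]
    by (simp add: \<phi>_def P_def)
  ultimately show ?case by (simp add: \<phi>_def P_def)
qed

text \<open>In the strict inequality of \<open>mom_orth_poly_sign\<close> at \<open>s = y q\<close>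
  the terms of positive order tend to 0, while \<open>G 0\<close> stays above \<epsilon>; a wrong
  sign of the constant coefficient would therefore prevail.\<close>

lemma orth_poly_at_0_nonneg:
  assumes J: "open J" "is_interval J" and G: "deriv_tower J G"
    and pd: "\<And>t. t \<in> J \<Longrightarrow> hankel_pd (Suc n) (\<lambda>i. G i t)"
    and y: "\<And>q::nat. y q \<in> J" "filterlim y at_bot sequentially"
    and lim: "\<And>i. 1 \<le> i \<Longrightarrow> i \<le> n \<Longrightarrow> (\<lambda>q. G i (y q)) \<longlonglongrightarrow> 0"
    and low: "0 < \<epsilon>" "\<And>q. \<epsilon> \<le> G 0 (y q)"
    and "k \<le> n" "t \<in> J"
  shows "0 \<le> (- 1) ^ k * coeff (orth_poly (\<lambda>i. G i t) k) 0"
proof (rule ccontr)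
  define P where "P = orth_poly (\<lambda>i. G i t) k"
  define a where "a = (- 1) ^ k * coeff P 0"
  assume "\<not> ?thesis"
  then have a: "a < 0" by (simp add: a_def P_def)
  define e where "e q = (\<Sum>i=1..k. (- 1) ^ k * coeff P i * G i (y q))" for q
  have "(\<lambda>q. e q) \<longlonglongrightarrow> (\<Sum>i=1..k. (- 1) ^ k * coeff P i * 0)"
    unfolding e_def by (intro tendsto_sum tendsto_mult tendsto_const lim) (use \<open>k \<le> n\<close> in auto)
  then have "e \<longlonglongrightarrow> 0" by simp
  then have "\<forall>\<^sub>F q in sequentially. e q < - a * \<epsilon>"
    using a low by (intro order_tendstoD) (auto simp: mult_neg_pos)
  moreover have "\<forall>\<^sub>F q in sequentially. y q < t"
    using y(2) by (simp add: filterlim_at_bot_dense)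
  ultimately have "\<forall>\<^sub>F q in sequentially. False"
  proof eventually_elim
    case (elim q)
    have "0 < (- 1) ^ k * mom (\<lambda>i. G i (y q)) P"
      unfolding P_def by (rule mom_orth_poly_sign[OF J G pd \<open>k \<le> n\<close> y(1) \<open>t \<in> J\<close> elim(2)])
    also have "mom (\<lambda>i. G i (y q)) P = (\<Sum>i\<le>k. coeff P i * G i (y q))"
      by (rule mom_le) (simp add: P_def degree_orth_poly_le)
    also have "{..k} = insert 0 {1..k}" by auto
    also have "(- 1) ^ k * (\<Sum>i\<in>insert 0 {1..k}. coeff P i * G i (y q)) = a * G 0 (y q) + e q"
      by (simp add: a_def e_def distrib_left sum_distrib_left mult.assoc)
    also have "a * G 0 (y q) \<le> a * \<epsilon>" using a low by (intro mult_left_mono_neg) auto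
    finally show False using elim(1) by simp
  qed
  then show False by simp
qed

text \<open>By induction on \<open>k\<close>: the constant coefficient obeys the Toda equation too,
  so with the sign attached it increases strictly in \<open>t\<close>, and a nonnegative value at
  \<open>t - 1\<close> gives a positive one at \<open>t\<close>.\<close>

lemma orth_poly_at_0_pos:
  assumes J: "open J" "is_interval J" and down: "\<And>s t. t \<in> J \<Longrightarrow> s \<le> t \<Longrightarrow> s \<in> J"
    and G: "deriv_tower J G" and pd: "\<And>t. t \<in> J \<Longrightarrow> hankel_pd (Suc n) (\<lambda>i. G i t)"
    and nonneg: "\<And>k t. k \<le> n \<Longrightarrow> t \<in> J \<Longrightarrow> 0 \<le> (- 1) ^ k * coeff (orth_poly (\<lambda>i. G i t) k) 0"
    and "k \<le> n" "t \<in> J"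
  shows "0 < (- 1) ^ k * coeff (orth_poly (\<lambda>i. G i t) k) 0"
  using \<open>k \<le> n\<close> \<open>t \<in> J\<close>
proof (induction k arbitrary: t)
  case 0
  then show ?case by (simp add: orth_poly_0)
next
  case (Suc k)
  define P where "P k t = orth_poly (\<lambda>i. G i t) k" for k t
  define h where "h k t = mom (\<lambda>i. G i t) (P k t * P k t)" for k t
  have "(- 1) ^ Suc k * coeff (P (Suc k) (t - 1)) 0 < (- 1) ^ Suc k * coeff (P (Suc k) t) 0"
  proof (rule DERIV_pos_imp_increasing[of "t - 1" t])
    fix r assume r: "t - 1 \<le> r" "r \<le> t"
    then have rJ: "r \<in> J" using down Suc.prems by blast
    have hpos: "0 < h (Suc k) r" "0 < h k r"
      using mom_orth_poly_pos[OF pd[OF rJ]] Suc.prems(1) by (auto simp: h_def P_def)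
    have "((\<lambda>t. (- 1) ^ Suc k * coeff (P (Suc k) t) 0) has_real_derivative
        (- 1) ^ Suc k * coeff (Polynomial.smult (- (h (Suc k) r / h k r)) (P k r)) 0) (at r)"
      unfolding P_def h_def
      by (rule DERIV_cmult, rule orth_poly_toda[OF J(1) rJ G pd Suc.prems(1)])
    moreover have "0 < h (Suc k) r / h k r * ((- 1) ^ k * coeff (P k r) 0)"
      using hpos Suc.IH[OF _ rJ] Suc.prems(1) by (simp add: P_def)
    ultimately show "\<exists>y. ((\<lambda>t. (- 1) ^ Suc k * coeff (P (Suc k) t) 0) has_real_derivative y) (at r) \<and> 0 < y"
      by (intro exI conjI) (auto simp: ac_simps)
  qed simp
  moreover have "0 \<le> (- 1) ^ Suc k * coeff (P (Suc k) (t - 1)) 0"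
    unfolding P_def by (rule nonneg[OF Suc.prems(1)]) (use down Suc.prems(2) in auto)
  ultimately show ?case by (simp add: P_def)
qed

text \<open>The polynomials \<open>R\<close> with \<open>x R = P\<^bsub>d+1\<^esub> - r P\<^sub>d\<close>, where \<open>r = P\<^bsub>d+1\<^esub>(0) / P\<^sub>d(0)\<close>, are orthogonal for
  the shifted moments (Christoffel's formula), with squared norms of the sign of \<open>- r\<close>.\<close>

lemma hankel_psd_shift:
  assumes pd: "hankel_pd (Suc n) m"
    and pos: "\<And>k. k \<le> n \<Longrightarrow> 0 < (- 1) ^ k * coeff (orth_poly m k) 0"
  shows "hankel_psd n (\<lambda>i. m (Suc i))"
proof -
  have "0 \<le> mom m (pCons 0 (p * p))" if "d \<le> n" "\<And>i. d \<le> i \<Longrightarrow> coeff p i = 0" for d p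
    using that
  proof (induction d arbitrary: p)
    case 0
    then have "p = 0" by (intro poly_eqI) simp
    then show ?case by simp
  next
    case (Suc d)
    define r where "r = coeff (orth_poly m (Suc d)) 0 / coeff (orth_poly m d) 0"
    have P: "0 < (- 1) ^ d * coeff (orth_poly m d) 0" "0 < (- 1) ^ Suc d * coeff (orth_poly m (Suc d)) 0"
      using pos Suc.prems(1) by (auto simp del: power_Suc)
    then have nz: "coeff (orth_poly m d) 0 \<noteq> 0" by auto
    have "r = - ((- 1) ^ Suc d * coeff (orth_poly m (Suc d)) 0) / ((- 1) ^ d * coeff (orth_poly m d) 0)"
      by (simp add: r_def)
    also have "\<dots> < 0" using P by (intro divide_neg_pos) auto
    finally have r: "r < 0" .
    define N where "N = orth_poly m (Suc d) - Polynomial.smult r (orth_poly m d)"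
    obtain a R where aR: "N = pCons a R" by (rule pCons_cases)
    have "a = coeff N 0" by (simp add: aR)
    also have "\<dots> = 0" using nz by (simp add: N_def r_def)
    finally have N: "N = pCons 0 R" using aR by simp
    have coeffR: "coeff R i = coeff N (Suc i)" for i by (simp add: N)
    have R: "coeff R d = 1" "\<And>i. d < i \<Longrightarrow> coeff R i = 0"
      by (auto simp: coeffR N_def coeff_orth_poly_lead coeff_orth_poly_above)
    define c where "c = coeff p d"
    define q where "q = p - Polynomial.smult c R"
    have q: "coeff q i = 0" if "d \<le> i" for i
      using that Suc.prems(2)[of i] R by (cases "i = d") (auto simp: q_def c_def)
    have Nq: "mom m (pCons 0 (R * S)) = mom m (orth_poly m (Suc d) * S) - r * mom m (orth_poly m d * S)" for S
    proof -
      have "pCons 0 (R * S) = N * S" by (simp add: N)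
      then show ?thesis by (simp add: N_def left_diff_distrib mom_diff mom_smult)
    qed
    have "mom m (orth_poly m (Suc d) * q) = 0" "mom m (orth_poly m d * q) = 0"
      using q Suc.prems(1) by (auto intro!: mom_orth_poly[OF pd])
    then have Rq: "mom m (pCons 0 (R * q)) = 0" by (simp add: Nq)
    have "mom m (orth_poly m (Suc d) * R) = 0"
      using R Suc.prems(1) by (intro mom_orth_poly[OF pd]) auto
    moreover have "mom m (orth_poly m d * R) = mom m (orth_poly m d * orth_poly m d)"
      using mom_orth_poly_lead[OF pd, of d R] R Suc.prems(1) by simp
    ultimately have RR: "mom m (pCons 0 (R * R)) = - r * mom m (orth_poly m d * orth_poly m d)"
      by (simp add: Nq)
    have "p = Polynomial.smult c R + q" by (simp add: q_def)
    \<comment> \<open>The cross term vanishes by orthogonality, which leaves the square of the top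
      part and a remainder of lower degree.\<close>
    then have "mom m (pCons 0 (p * p)) = c * (c * mom m (pCons 0 (R * R)))
        + 2 * (c * mom m (pCons 0 (R * q))) + mom m (pCons 0 (q * q))"
      by (simp add: mom_pCons distrib_left distrib_right mom_add mom_smult mult.commute[of q R])
    then have "mom m (pCons 0 (p * p)) =
        c * c * (- r * mom m (orth_poly m d * orth_poly m d)) + mom m (pCons 0 (q * q))"
      by (simp add: Rq RR)
    moreover have "0 \<le> mom m (pCons 0 (q * q))" using Suc.IH[of q] q Suc.prems(1) by simp
    moreover have "0 \<le> c * c * (- r * mom m (orth_poly m d * orth_poly m d))"
      using r mom_orth_poly_pos[OF pd, of d] Suc.prems(1)
      by (intro mult_nonneg_nonneg[OF zero_le_square] mult_nonneg_nonneg) auto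
    ultimately show ?case by simp
  qed
  from this[of n] show ?thesis
    unfolding hankel_psd_def by (auto simp: mom_pCons coeff_eq_0)
qed

text \<open>The exponential sum serves twice: it makes the Hankel matrices positive definite, and
  its constant summand bounds \<open>H 0\<close> below by \<epsilon> while disappearing from all
  derivatives. Its other summands decay at minus infinity, so the limits along \<open>y\<close>
  survive. Finally \<epsilon> tends to 0.\<close>

lemma hankel_psd_deriv:
  assumes J: "open J" "is_interval J" and down: "\<And>s t. t \<in> J \<Longrightarrow> s \<le> t \<Longrightarrow> s \<in> J"
    and G: "deriv_tower J G" and psd: "\<And>t. t \<in> J \<Longrightarrow> hankel_psd (Suc n) (\<lambda>i. G i t)"
    and y: "\<And>q::nat. y q \<in> J" "filterlim y at_bot sequentially"
    and lim: "\<And>i. 1 \<le> i \<Longrightarrow> i \<le> n \<Longrightarrow> (\<lambda>q. G i (y q)) \<longlonglongrightarrow> 0"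
    and "t \<in> J"
  shows "hankel_psd n (\<lambda>i. G (Suc i) t)"
  unfolding hankel_psd_def
proof (intro allI impI)
  fix p :: "real poly" assume p: "degree p < n"
  define E where "E = exp_tower (Suc n)"
  have strict: "hankel_psd n (\<lambda>i. 1 * G (Suc i) t + \<epsilon> * E (Suc i) t)" if \<epsilon>: "0 < \<epsilon>" for \<epsilon>
  proof -
    define H where "H i t = 1 * G i t + \<epsilon> * E i t" for i t
    have H: "deriv_tower J H"
      unfolding H_def E_def by (rule deriv_tower_linear[OF G deriv_tower_exp_tower])
    have pd: "hankel_pd (Suc n) (\<lambda>i. H i t)" if "t \<in> J" for t
      unfolding H_def E_def
      by (rule hankel_pd_perturb[OF psd[OF that] hankel_pd_exp_tower]) (use \<epsilon> in auto)
    have "(\<lambda>q. H i (y q)) \<longlonglongrightarrow> 0" if i: "1 \<le> i" "i \<le> n" for i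
    proof -
      have "(\<lambda>q. real k ^ i * exp (real k * y q)) \<longlonglongrightarrow> 0" for k :: nat
      proof (cases "k = 0")
        case False
        have "filterlim (\<lambda>q. real k * y q) at_bot sequentially"
          using y(2) False by (intro filterlim_tendsto_pos_mult_at_bot[OF tendsto_const]) auto
        then have "(\<lambda>q. exp (real k * y q)) \<longlonglongrightarrow> 0"
          by (rule filterlim_compose[OF exp_at_bot])
        then show ?thesis by (rule tendsto_mult_right_zero)
      qed (use i in simp)
      then have "(\<lambda>q. E i (y q)) \<longlonglongrightarrow> (\<Sum>k<Suc n. 0)"
        unfolding E_def exp_tower_def by (intro tendsto_sum)
      then have "(\<lambda>q. 1 * G i (y q) + \<epsilon> * E i (y q)) \<longlonglongrightarrow> 1 * 0 + \<epsilon> * 0"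
        by (intro tendsto_add tendsto_mult tendsto_const lim[OF i]) simp
      then show ?thesis by (simp add: H_def)
    qed
    moreover have "\<epsilon> \<le> H 0 (y q)" for q
    proof -
      have "0 \<le> mom (\<lambda>i. G i (y q)) (1 * 1)"
        using psd[OF y(1)[of q], unfolded hankel_psd_def, rule_format, of 1] by simp
      then have "0 \<le> G 0 (y q)" by (simp add: mom_1)
      moreover have "exp (real 0 * y q) \<le> E 0 (y q)"
        unfolding E_def exp_tower_def using member_le_sum[of 0 "{..<Suc n}" "\<lambda>k. real k ^ 0 * exp (real k * y q)"]
        by simp
      ultimately have "\<epsilon> \<le> \<epsilon> * E 0 (y q)" "0 \<le> G 0 (y q)" using \<epsilon> by simp_all
      then show ?thesis unfolding H_def by linarith
    qed
    ultimately have nonneg: "0 \<le> (- 1) ^ k * coeff (orth_poly (\<lambda>i. H i t) k) 0" if "k \<le> n" "t \<in> J" for k t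
      using orth_poly_at_0_nonneg[OF J H pd y _ \<epsilon> _ that] by blast
    show ?thesis
      using hankel_psd_shift[OF pd[OF \<open>t \<in> J\<close>] orth_poly_at_0_pos[OF J down H pd nonneg _ \<open>t \<in> J\<close>]]
      by (simp add: H_def)
  qed
  define a b where "a = mom (\<lambda>i. G (Suc i) t) (p * p)" and "b = mom (\<lambda>i. E (Suc i) t) (p * p)"
  have "0 \<le> a + \<epsilon> * b" if "0 < \<epsilon>" for \<epsilon>
    using strict[OF that] p unfolding hankel_psd_def a_def b_def by (auto simp: mom_linear mom_scale)
  then have "\<forall>\<^sub>F \<epsilon> in at_right 0. 0 \<le> a + \<epsilon> * b"
    by (intro eventually_mono[OF eventually_at_right_less])
  moreover have "((\<lambda>\<epsilon>. a + \<epsilon> * b) \<longlongrightarrow> a + 0 * b) (at_right 0)"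
    by (intro tendsto_intros)
  ultimately have "0 \<le> a + 0 * b"
    by (intro tendsto_lowerbound[where F = "at_right (0::real)"]) auto
  then show "0 \<le> mom (\<lambda>i. G (Suc i) t) (p * p)" by (simp add: a_def)
qed

section \<open>The smooth case\<close>

lemma psd_kernel_linear:
  assumes "psd_kernel n K" "psd_kernel n L" "0 \<le> a" "0 \<le> b"
  shows "psd_kernel n (\<lambda>i j. a * K i j + b * L i j)"
  unfolding psd_kernel_def
proof
  fix c
  have "quad_form n (\<lambda>i j. a * K i j + b * L i j) c = a * quad_form n K c + b * quad_form n L c"
    by (simp add: quad_form_def distrib_left sum.distrib sum_distrib_left mult.left_commute)
  then show "0 \<le> quad_form n (\<lambda>i j. a * K i j + b * L i j) c"
    using assms by (simp add: psd_kernel_def)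
qed

lemma exp_image_iff: "x \<in> exp ` J \<longleftrightarrow> 0 < x \<and> ln x \<in> (J :: real set)"
  by (auto intro: image_eqI[of x exp "ln x"])

lemma exp_image_down:
  assumes "\<And>s t. t \<in> J \<Longrightarrow> s \<le> t \<Longrightarrow> s \<in> J" "x \<in> exp ` J" "0 < z" "z \<le> x"
  shows "z \<in> exp ` (J :: real set)"
  using assms(2-4) assms(1)[of "ln x" "ln z"] by (simp add: exp_image_iff)

text \<open>With \<open>x = exp t\<close> the derivation \<open>d/dt\<close> is
  \<open>x d/dx\<close>, and the Stirling numbers of the second kind express its powers through
  \<open>x^k d^k/dx^k\<close>.\<close>

lemma stirling_expansion:
  assumes J: "open J" and F: "deriv_tower (exp ` J) F" and G: "deriv_tower J G"
    and FG: "\<And>t. t \<in> J \<Longrightarrow> G 0 t = F 0 (exp t)" and "t \<in> J"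
  shows "G i t = (\<Sum>k\<le>i. real (Stirling i k) * (exp t ^ k * F k (exp t)))"
  using \<open>t \<in> J\<close>
proof (induction i arbitrary: t)
  case 0
  then show ?case by (simp add: FG)
next
  case (Suc i)
  define e where "e k t = exp t ^ k * F k (exp t)" for k t
  have e: "(e k has_real_derivative real k * e k t + e (Suc k) t) (at t)" for k
  proof -
    have F': "((\<lambda>t. F k (exp t)) has_real_derivative F (Suc k) (exp t) * exp t) (at t)"
      by (rule DERIV_chain2[OF deriv_towerD[OF F] DERIV_exp]) (use Suc.prems in auto)
    have "((\<lambda>t. exp (real k * t)) has_real_derivative real k * exp (real k * t)) (at t)"
      by (auto intro!: derivative_eq_intros)
    then have "((\<lambda>t. exp t ^ k) has_real_derivative real k * exp t ^ k) (at t)"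
      by (simp add: exp_of_nat_mult)
    from DERIV_mult[OF this F'] show ?thesis
      unfolding e_def[abs_def] by (simp add: algebra_simps)
  qed
  have "G (Suc i) t = (\<Sum>k\<le>i. real (Stirling i k) * (real k * e k t + e (Suc k) t))"
  proof (rule DERIV_unique)
    show "(G i has_real_derivative G (Suc i) t) (at t)" by (rule deriv_towerD[OF G Suc.prems])
    have "((\<lambda>t. \<Sum>k\<le>i. real (Stirling i k) * e k t) has_real_derivative
        (\<Sum>k\<le>i. real (Stirling i k) * (real k * e k t + e (Suc k) t))) (at t)"
      by (intro DERIV_sum DERIV_cmult e)
    then show "(G i has_real_derivative (\<Sum>k\<le>i. real (Stirling i k) * (real k * e k t + e (Suc k) t))) (at t)"
      by (rule has_field_derivative_transform_within_open[OF _ J Suc.prems])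
        (simp add: Suc.IH e_def)
  qed
  also have "\<dots> = (\<Sum>k\<le>Suc i. real (Stirling (Suc i) k) * e k t)"
  proof -
    define a where "a k = real (Stirling i k) * (real k * e k t)" for k
    have "(\<Sum>k\<le>i. a (Suc k)) = (\<Sum>k\<le>Suc i. a k)"
      by (simp add: sum.atMost_Suc_shift a_def del: sum.atMost_Suc)
    also have "\<dots> = (\<Sum>k\<le>i. a k)" by (simp add: a_def)
    finally have shift: "(\<Sum>k\<le>i. a k) = (\<Sum>k\<le>i. a (Suc k))" ..
    have "(\<Sum>k\<le>Suc i. real (Stirling (Suc i) k) * e k t) =
        (\<Sum>k\<le>i. real (Stirling (Suc i) (Suc k)) * e (Suc k) t)"
      by (simp add: sum.atMost_Suc_shift del: sum.atMost_Suc)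
    also have "\<dots> = (\<Sum>k\<le>i. a (Suc k) + real (Stirling i k) * e (Suc k) t)"
      by (intro sum.cong refl) (simp add: a_def algebra_simps)
    also have "\<dots> = (\<Sum>k\<le>i. a k + real (Stirling i k) * e (Suc k) t)"
      by (simp only: sum.distrib shift)
    finally show ?thesis by (simp only: a_def distrib_left)
  qed
  finally show ?case by (simp only: e_def)
qed

text \<open>For \<open>k <= n\<close> nonnegativity of the next derivative makes \<open>F k\<close>
  nondecreasing, hence bounded near 0, and the factor \<open>x^k\<close> tends to 0. For the top
  order the mean value theorem on dyadic intervals is applied to \<open>F n\<close>, whose values
  converge as the end points tend to 0; this yields a limit along a sequence only.\<close>

lemma vanishing_sequence:
  assumes down: "\<And>s t. t \<in> J \<Longrightarrow> s \<le> t \<Longrightarrow> s \<in> J" and t0: "t0 \<in> J"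
    and F: "deriv_tower (exp ` J) F" and nonneg: "\<And>k x. k \<le> Suc n \<Longrightarrow> x \<in> exp ` J \<Longrightarrow> 0 \<le> F k x"
  obtains \<xi> :: "nat \<Rightarrow> real" where "\<And>q. \<xi> q \<in> exp ` J" "\<xi> \<longlonglongrightarrow> 0"
    "\<And>k. 1 \<le> k \<Longrightarrow> k \<le> Suc n \<Longrightarrow> (\<lambda>q. \<xi> q ^ k * F k (\<xi> q)) \<longlonglongrightarrow> 0"
proof -
  define x :: "nat \<Rightarrow> real" where "x q = exp t0 * (1 / 2) ^ q" for q
  have x_pos: "0 < x q" and x_Suc: "2 * x (Suc q) = x q" for q by (auto simp: x_def)
  have x_le: "x q \<le> x 0" for q by (simp add: x_def power_le_one)
  have x0: "x 0 \<in> exp ` J" using t0 by (simp add: x_def)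
  have mem: "z \<in> exp ` J" if "0 < z" "z \<le> x 0" for z
    by (rule exp_image_down[OF down x0 that])
  have x_lim: "x \<longlonglongrightarrow> 0"
    unfolding x_def by (intro tendsto_mult_right_zero LIMSEQ_realpow_zero) auto
  have mono: "F k z \<le> F k w" if "k \<le> n" "0 < z" "z \<le> w" "w \<le> x 0" for k z w
  proof (rule DERIV_nonneg_imp_nondecreasing[OF that(3)])
    fix v assume "z \<le> v" "v \<le> w"
    then have v: "v \<in> exp ` J" using that by (intro mem) auto
    then show "\<exists>y. (F k has_real_derivative y) (at v) \<and> 0 \<le> y"
      using deriv_towerD[OF F v, of k] nonneg[OF _ v, of "Suc k"] that(1) by blast
  qed
  define a where "a q = F n (x q)" for q
  have "decseq a"
    unfolding a_def decseq_Suc_iff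
  proof (intro allI mono)
    show "x (Suc q) \<le> x q" for q using x_Suc[of q] x_pos[of "Suc q"] by linarith
  qed (use x_pos x_le in auto)
  moreover have "0 \<le> a q" for q unfolding a_def by (rule nonneg[OF _ mem]) (use x_pos x_le in auto)
  ultimately obtain L where L: "a \<longlonglongrightarrow> L" using decseq_convergent[of a 0] by blast
  have diff_lim: "(\<lambda>q. a q - a (Suc q)) \<longlonglongrightarrow> 0"
    using tendsto_diff[OF L LIMSEQ_Suc[OF L]] by simp
  have "\<exists>z. x (Suc q) < z \<and> z < x q \<and> a q - a (Suc q) = (x q - x (Suc q)) * F (Suc n) z" for q
    unfolding a_def
  proof (rule MVT2)
    show "x (Suc q) < x q" using x_Suc[of q] x_pos[of "Suc q"] by linarith
    show "(F n has_real_derivative F (Suc n) z) (at z)" if "x (Suc q) \<le> z" "z \<le> x q" for z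
      using deriv_towerD[OF F mem] that x_pos[of "Suc q"] x_le[of q] by simp
  qed
  then obtain \<xi> where \<xi>: "\<And>q. x (Suc q) < \<xi> q" "\<And>q. \<xi> q < x q"
    "\<And>q. a q - a (Suc q) = (x q - x (Suc q)) * F (Suc n) (\<xi> q)" by metis
  have \<xi>_pos: "0 < \<xi> q" for q using \<xi>(1)[of q] x_pos[of "Suc q"] by linarith
  have \<xi>_le: "\<xi> q \<le> x 0" for q using \<xi>(2)[of q] x_le[of q] by linarith
  have \<xi>_mem: "\<xi> q \<in> exp ` J" for q using mem \<xi>_pos \<xi>_le by blast
  have \<xi>_lim: "\<xi> \<longlonglongrightarrow> 0"
    by (rule tendsto_sandwich[OF _ _ tendsto_const x_lim])
      (use \<xi>(2) \<xi>_pos in \<open>auto intro!: always_eventually less_imp_le\<close>)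
  have "(\<lambda>q. \<xi> q ^ k * F k (\<xi> q)) \<longlonglongrightarrow> 0" if k: "1 \<le> k" "k \<le> Suc n" for k
  proof (cases "k = Suc n")
    case False
    then have kn: "k \<le> n" using k by simp
    have up: "(\<lambda>q. \<xi> q ^ k * F k (x 0)) \<longlonglongrightarrow> 0"
      by (intro tendsto_mult_left_zero tendsto_null_power \<xi>_lim) (use k in simp)
    show ?thesis
    proof (rule tendsto_sandwich[OF _ _ tendsto_const up]; intro always_eventually allI)
      fix q
      show "0 \<le> \<xi> q ^ k * F k (\<xi> q)"
        using nonneg[OF k(2) \<xi>_mem] \<xi>_pos[of q] by simp
      show "\<xi> q ^ k * F k (\<xi> q) \<le> \<xi> q ^ k * F k (x 0)"
        using mono[OF kn \<xi>_pos \<xi>_le order_refl, of q] \<xi>_pos[of q] by (intro mult_left_mono) auto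
    qed
  next
    case True
    have "(\<lambda>q. x 0 ^ n * (2 * (a q - a (Suc q)))) \<longlonglongrightarrow> x 0 ^ n * (2 * 0)"
      by (intro tendsto_mult tendsto_const diff_lim)
    then have up: "(\<lambda>q. x 0 ^ n * (2 * (a q - a (Suc q)))) \<longlonglongrightarrow> 0" by simp
    show ?thesis
      unfolding True
    proof (rule tendsto_sandwich[OF _ _ tendsto_const up]; intro always_eventually allI)
      fix q
      have nn: "0 \<le> F (Suc n) (\<xi> q)" by (rule nonneg[OF _ \<xi>_mem]) simp
      then show "0 \<le> \<xi> q ^ Suc n * F (Suc n) (\<xi> q)" using \<xi>_pos[of q] by simp
      \<comment> \<open>The factor 2 comes from halving: \<open>x q = 2 * (x q - x (Suc q))\<close>,
        and \<open>\<xi> q < x q\<close>.\<close>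
      have "\<xi> q * F (Suc n) (\<xi> q) \<le> 2 * (a q - a (Suc q))"
        using \<xi>(3)[of q] mult_right_mono[OF less_imp_le[OF \<xi>(2)[of q]] nn]
        by (simp add: x_Suc[of q, symmetric])
      then have "\<xi> q ^ n * (\<xi> q * F (Suc n) (\<xi> q)) \<le> x 0 ^ n * (2 * (a q - a (Suc q)))"
        using \<xi>_pos[of q] \<xi>_le[of q] x_pos[of 0] nn by (intro mult_mono[OF power_mono]) auto
      then show "\<xi> q ^ Suc n * F (Suc n) (\<xi> q) \<le> x 0 ^ n * (2 * (a q - a (Suc q)))"
        by (simp add: ac_simps)
    qed
  qed
  then show thesis using that \<xi>_mem \<xi>_lim by blast
qed

lemma hankel_psd_log_deriv:
  assumes J: "open J" "is_interval J" and down: "\<And>s t. t \<in> J \<Longrightarrow> s \<le> t \<Longrightarrow> s \<in> J"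
    and F: "deriv_tower (exp ` J) F" and G: "deriv_tower J G"
    and FG: "\<And>t. t \<in> J \<Longrightarrow> G 0 t = F 0 (exp t)"
    and nonneg: "\<And>k x. k \<le> n \<Longrightarrow> x \<in> exp ` J \<Longrightarrow> 0 \<le> F k x"
    and psd: "\<And>t. t \<in> J \<Longrightarrow> hankel_psd (Suc n) (\<lambda>i. G i t)" and "t \<in> J"
  shows "hankel_psd n (\<lambda>i. G (Suc i) t)"
proof (cases n)
  case 0
  then show ?thesis by (simp add: hankel_psd_def)
next
  case (Suc n')
  have nonneg': "0 \<le> F k x" if "k \<le> Suc n'" "x \<in> exp ` J" for k x
    using nonneg that by (simp add: Suc)
  obtain \<xi> where \<xi>: "\<And>q. \<xi> q \<in> exp ` J" "\<xi> \<longlonglongrightarrow> 0"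
    "\<And>k. 1 \<le> k \<Longrightarrow> k \<le> n \<Longrightarrow> (\<lambda>q. \<xi> q ^ k * F k (\<xi> q)) \<longlonglongrightarrow> 0"
  proof (rule vanishing_sequence[OF _ \<open>t \<in> J\<close> F])
    show "\<And>s t. t \<in> J \<Longrightarrow> s \<le> t \<Longrightarrow> s \<in> J" by (rule down)
    show "\<And>k x. k \<le> Suc n' \<Longrightarrow> x \<in> exp ` J \<Longrightarrow> 0 \<le> F k x" by (rule nonneg')
    fix \<xi> :: "nat \<Rightarrow> real"
    assume "\<And>q. \<xi> q \<in> exp ` J" "\<xi> \<longlonglongrightarrow> 0"
      "\<And>k. 1 \<le> k \<Longrightarrow> k \<le> Suc n' \<Longrightarrow> (\<lambda>q. \<xi> q ^ k * F k (\<xi> q)) \<longlonglongrightarrow> 0"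
    then show thesis by (intro that[of \<xi>]) (simp_all add: Suc)
  qed
  define y where "y q = ln (\<xi> q)" for q
  have pos: "0 < \<xi> q" and y: "y q \<in> J" and exp_y: "exp (y q) = \<xi> q" for q
    using \<xi>(1)[of q] by (auto simp: exp_image_iff y_def)
  show ?thesis
  proof (rule hankel_psd_deriv[OF J down G psd y _ _ \<open>t \<in> J\<close>])
    have "filterlim \<xi> (at_right 0) sequentially"
      using \<xi>(2) pos less_imp_neq[OF pos] by (auto simp: filterlim_at intro!: always_eventually)
    then show "filterlim y at_bot sequentially"
      unfolding y_def[abs_def] by (rule filterlim_compose[OF ln_at_0])
    fix i assume i: "1 \<le> i" "i \<le> n"
    have "(\<lambda>q. \<Sum>k\<le>i. real (Stirling i k) * (\<xi> q ^ k * F k (\<xi> q))) \<longlonglongrightarrow> (\<Sum>k\<le>i. real (Stirling i k) * 0)"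
    proof (rule tendsto_sum)
      fix k assume k: "k \<in> {..i}"
      show "(\<lambda>q. real (Stirling i k) * (\<xi> q ^ k * F k (\<xi> q))) \<longlonglongrightarrow> real (Stirling i k) * 0"
      \<comment> \<open>\<open>Stirling i 0 = 0\<close> for \<open>i >= 1\<close>, so
        \<open>F 0\<close>, whose limit at 0 may be positive, does not contribute.\<close>
      proof (cases "k = 0")
        case True
        then show ?thesis using i by (cases i) auto
      next
        case False
        then show ?thesis using k i by (intro tendsto_mult tendsto_const \<xi>(3)) auto
      qed
    qed
    then show "(\<lambda>q. G i (y q)) \<longlonglongrightarrow> 0"
      using stirling_expansion[OF J(1) F G FG y, of i] by (simp add: exp_y)
  qed
qed

text \<open>Change of variable in a moment functional, by Horner's scheme; the factor
  \<open>S\<close> accumulates the powers of \<open>R\<close> during the induction.\<close>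

lemma mom_pcompose: "mom (\<lambda>k. mom M (S * R ^ k)) q = mom M (S * pcompose q R)"
proof (induction q arbitrary: S)
  case 0
  then show ?case by simp
next
  case (pCons a q)
  have "mom (\<lambda>k. mom M (S * R ^ k)) (pCons a q) =
      mom (\<lambda>k. mom M (S * R ^ k)) (monom a 0 + pCons 0 q)"
    by (simp add: monom_0)
  also have "\<dots> = a * mom M S + mom (\<lambda>k. mom M ((S * R) * R ^ k)) q"
    by (simp add: mom_add mom_monom mom_pCons mult.assoc)
  also have "\<dots> = mom M (Polynomial.smult a S + (S * R) * pcompose q R)"
    by (simp add: pCons.IH mom_add mom_smult)
  also have "Polynomial.smult a S + (S * R) * pcompose q R = S * pcompose (pCons a q) R"
    by (simp add: pcompose_pCons distrib_left mult.assoc)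
  finally show ?case .
qed

text \<open>If \<open>g(t) = f(exp t)\<close> then \<open>f'(exp t) = exp (- t) g'(t)\<close>, whose derivatives are
  \<open>exp (- t) (D - 1)\<^sup>i D g\<close>.\<close>

definition log_deriv_tower :: "(nat \<Rightarrow> real \<Rightarrow> real) \<Rightarrow> nat \<Rightarrow> real \<Rightarrow> real" where
  "log_deriv_tower G i t = exp (- t) * mom (\<lambda>j. G (Suc j) t) ([:-1, 1:] ^ i)"

lemma deriv_tower_log_deriv:
  assumes "deriv_tower J G"
  shows "deriv_tower J (log_deriv_tower G)"
  unfolding deriv_tower_def
proof (intro allI ballI)
  fix i t assume t: "t \<in> J"
  have G': "deriv_tower J (\<lambda>i. G (Suc i))" using assms by (simp add: deriv_tower_def)
  have e: "((\<lambda>t. exp (- t)) has_real_derivative - exp (- t)) (at t)"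
    by (auto intro!: derivative_eq_intros)
  have "([:-1, 1:] :: real poly) ^ Suc i = pCons 0 ([:-1, 1:] ^ i) - [:-1, 1:] ^ i" for i
  proof -
    have "Polynomial.smult (- 1) p = - p" for p :: "real poly" by (rule poly_eqI) simp
    then show ?thesis by simp
  qed
  then have eq: "mom (\<lambda>j. G (Suc j) t) ([:-1, 1:] ^ Suc i) =
      mom (\<lambda>j. G (Suc (Suc j)) t) ([:-1, 1:] ^ i) - mom (\<lambda>j. G (Suc j) t) ([:-1, 1:] ^ i)"
    by (simp only: mom_diff mom_pCons)
  show "(log_deriv_tower G i has_real_derivative log_deriv_tower G (Suc i) t) (at t)"
    unfolding log_deriv_tower_def[abs_def] eq
    by (rule DERIV_cong[OF DERIV_mult[OF e mom_DERIV[OF G' t, of "[:-1, 1:] ^ i"]]])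
      (simp add: algebra_simps)
qed

text \<open>Substituting \<open>x - 1\<close> for the variable preserves degrees and squares, and
  \<open>exp (- t)\<close> is positive.\<close>

lemma hankel_psd_log_deriv_tower:
  assumes "hankel_psd n (\<lambda>i. G (Suc i) t)"
  shows "hankel_psd n (\<lambda>i. log_deriv_tower G i t)"
  unfolding hankel_psd_def
proof (intro allI impI)
  fix p :: "real poly" assume p: "degree p < n"
  let ?p = "pcompose p [:-1, 1:]"
  have "mom (\<lambda>i. log_deriv_tower G i t) (p * p) = exp (- t) * mom (\<lambda>j. G (Suc j) t) (?p * ?p)"
    using mom_pcompose[of "\<lambda>j. G (Suc j) t" 1 "[:-1, 1:]" "p * p"]
    by (simp add: log_deriv_tower_def mom_scale pcompose_mult)
  moreover have "degree ?p < n" using p by (simp add: degree_pcompose)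
  ultimately show "0 \<le> mom (\<lambda>i. log_deriv_tower G i t) (p * p)"
    using assms by (simp add: hankel_psd_def)
qed

lemma smooth_preserver_step:
  assumes J: "open J" "is_interval J" and down: "\<And>s t. t \<in> J \<Longrightarrow> s \<le> t \<Longrightarrow> s \<in> J"
    and G: "deriv_tower J G" and FG: "\<And>t. t \<in> J \<Longrightarrow> G 0 t = f (exp t)"
    and psd: "\<And>t. t \<in> J \<Longrightarrow> hankel_psd (Suc n) (\<lambda>i. G i t)"
    and f': "\<And>x. x \<in> exp ` J \<Longrightarrow> (f has_real_derivative f' x) (at x)"
    and pres: "\<And>K. psd_kernel n K \<Longrightarrow> (\<And>i j. K i j = K j i) \<Longrightarrow>
      (\<And>i j. i < n \<Longrightarrow> j < n \<Longrightarrow> K i j \<in> exp ` J) \<Longrightarrow> psd_kernel n (\<lambda>i j. f' (K i j))"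
    and A: "psd_kernel (Suc n) A" "\<And>i j. A i j = A j i"
      "\<And>i j. i < Suc n \<Longrightarrow> j < Suc n \<Longrightarrow> A i j \<in> exp ` J"
  shows "psd_kernel (Suc n) (\<lambda>i j. f (A i j))"
  unfolding psd_kernel_def
proof
  fix c
  have Apos: "0 < A i j" if "i < Suc n" "j < Suc n" for i j
    using A(3)[OF that] by (simp add: exp_image_iff)
  define B where "B i j = A i n * A n j / A n n" for i j
  define C where "C i j = A i j - B i j" for i j
  \<comment> \<open>Half of the logarithm of the corner entry goes to each exponent, which gives
    \<open>B i j = exp (x i + x j)\<close>, the form that \<open>psd_kernel_hankel\<close>
    treats.\<close>
  define x where "x i = ln (A i n) - ln (A n n) / 2" for i
  have Bx: "B i j = exp (x i + x j)" if "i < Suc n" "j < Suc n" for i j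
  proof -
    have "exp (x i + x j) = exp (ln (A i n)) * exp (ln (A j n)) / exp (ln (A n n))"
      by (simp add: x_def flip: exp_add exp_diff)
    then show ?thesis using Apos that A(2)[of j n] by (simp add: B_def)
  qed
  have C: "psd_kernel (Suc n) C"
    unfolding C_def B_def by (rule psd_kernel_last_elim[OF A(1,2)])
  have symB: "B i j = B j i" for i j using A(2)[of i n] A(2)[of n j] by (simp add: B_def)
  have symC: "C i j = C j i" for i j using A(2)[of i j] symB[of i j] by (simp add: C_def)
  \<comment> \<open>\<open>C\<close> has nonnegative diagonal, so \<open>B i i\<close> is at most
    \<open>A i i\<close>. A mixed sum \<open>x i + x j\<close> is then at most one of the diagonal
    ones, and \<open>J\<close> is closed downwards.\<close>
  have diag: "2 * x i \<in> J" if "i < Suc n" for i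
  proof -
    have "exp (2 * x i) \<le> A i i"
      using psd_kernel_diag_nonneg[OF C that] Bx[OF that that] unfolding C_def mult_2 by linarith
    then have "2 * x i \<le> ln (A i i)" using Apos[OF that that] by (simp add: ln_ge_iff)
    then show ?thesis using down A(3)[OF that that] by (auto simp: exp_image_iff)
  qed
  have xJ: "x i + x j \<in> J" if "i < Suc n" "j < Suc n" for i j
    using down[OF diag[OF that(1)], of "x i + x j"] down[OF diag[OF that(2)], of "x i + x j"]
    by linarith
  have BI: "B i j \<in> exp ` J" if "i < Suc n" "j < Suc n" for i j
    using Bx[OF that] xJ[OF that] by simp
  have fB: "psd_kernel (Suc n) (\<lambda>i j. f (B i j))"
    using psd_kernel_hankel[OF J G psd xJ] psd_kernel_cong[of "Suc n" "\<lambda>i j. G 0 (x i + x j)" "\<lambda>i j. f (B i j)"]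
    by (simp add: Bx FG xJ)
  have psdB: "psd_kernel (Suc n) B"
  proof -
    have "B i j = (\<Sum>k<(1::nat). exp (x i) * exp (x j))" if "i < Suc n" "j < Suc n" for i j
      using Bx[OF that] by (simp add: exp_add)
    then show ?thesis
      using psd_kernel_of_gram[where n = "Suc n" and A = "{..<(1::nat)}" and w = "\<lambda>k i. exp (x i)"]
        psd_kernel_cong[of "Suc n" B "\<lambda>i j. \<Sum>k<(1::nat). exp (x i) * exp (x j)"] by simp
  qed
  define K where "K r i j = B i j + r * C i j" for r i j
  have KI: "K r i j \<in> exp ` J" if r: "0 \<le> r" "r \<le> 1" and ij: "i < Suc n" "j < Suc n" for r i j
  proof -
    have "K r i j = (1 - r) * B i j + r * A i j" by (simp add: K_def C_def algebra_simps)
    moreover have "convex (exp ` J)"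
    proof -
      have "is_interval (exp ` J)"
        by (intro is_interval_connected_1[THEN iffD2] connected_continuous_image continuous_intros)
          (use J(2) in \<open>simp add: is_interval_connected_1\<close>)
      then show ?thesis by (simp add: is_interval_convex_1)
    qed
    ultimately show ?thesis
      using convexD[of "exp ` J" "B i j" "A i j" "1 - r" r] BI[OF ij] A(3)[OF ij] r by simp
  qed
  have zero: "C i n = 0" "C n i = 0" if "i < Suc n" for i
    using Apos[of n n] by (auto simp: C_def B_def)
  define \<phi> where "\<phi> r = quad_form (Suc n) (\<lambda>i j. f (K r i j)) c" for r
  have "\<phi> 0 \<le> \<phi> 1"
  proof (rule DERIV_nonneg_imp_nondecreasing[where f = \<phi> and a = 0 and b = 1])
    fix r :: real assume r: "0 \<le> r" "r \<le> 1"
    have Kr: "psd_kernel n (K r)"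
      using psd_kernel_mono[OF psd_kernel_linear[OF psdB C, of 1 r], of n] r by (simp add: K_def[abs_def])
    \<comment> \<open>The derivative of \<phi> is the form of the Schur product of \<open>C\<close>
      with \<open>f'\<close> applied to \<open>K r\<close>. The last row and column of
      \<open>C\<close> vanish, so size \<open>n\<close> suffices.\<close>
    have "psd_kernel n (\<lambda>i j. C i j * f' (K r i j))"
    proof (rule psd_kernel_schur_product[OF psd_kernel_mono[OF C] symC])
      show "psd_kernel n (\<lambda>i j. f' (K r i j))"
        by (rule pres[OF Kr]) (use KI[OF r] symB symC in \<open>auto simp: K_def\<close>)
    qed simp
    then have "0 \<le> quad_form n (\<lambda>i j. C i j * f' (K r i j)) c" by (simp add: psd_kernel_def)
    also have "\<dots> = quad_form (Suc n) (\<lambda>i j. C i j * f' (K r i j)) c"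
      by (simp add: quad_form_def zero)
    finally have nonneg: "0 \<le> quad_form (Suc n) (\<lambda>i j. C i j * f' (K r i j)) c" .
    have "(\<phi> has_real_derivative quad_form (Suc n) (\<lambda>i j. C i j * f' (K r i j)) c) (at r)"
      unfolding \<phi>_def[abs_def] quad_form_def
    proof (intro DERIV_sum DERIV_cmult)
      fix i j assume ij: "i \<in> {..<Suc n}" "j \<in> {..<Suc n}"
      have "((\<lambda>r. K r i j) has_real_derivative C i j) (at r)"
        unfolding K_def by (auto intro!: derivative_eq_intros)
      from DERIV_chain2[OF f'[OF KI[OF r]] this] ij
      show "((\<lambda>r. f (K r i j)) has_real_derivative C i j * f' (K r i j)) (at r)"
        by (simp add: mult.commute)
    qed
    then show "\<exists>y. (\<phi> has_real_derivative y) (at r) \<and> 0 \<le> y" using nonneg by blast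
  qed simp
  moreover have "0 \<le> \<phi> 0" using fB by (simp add: \<phi>_def K_def psd_kernel_def)
  ultimately have "0 \<le> \<phi> 1" by linarith
  then show "0 \<le> quad_form (Suc n) (\<lambda>i j. f (A i j)) c" by (simp add: \<phi>_def K_def C_def)
qed

lemma smooth_preserver:
  assumes J: "open J" "is_interval J" and down: "\<And>s t. t \<in> J \<Longrightarrow> s \<le> t \<Longrightarrow> s \<in> J"
    and "deriv_tower (exp ` J) F" "deriv_tower J G"
    and "\<And>t. t \<in> J \<Longrightarrow> G 0 t = F 0 (exp t)"
    and "\<And>k x. k < n \<Longrightarrow> x \<in> exp ` J \<Longrightarrow> 0 \<le> F k x"
    and "\<And>t. t \<in> J \<Longrightarrow> hankel_psd n (\<lambda>i. G i t)"
    and "psd_kernel n A" "\<And>i j. A i j = A j i"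
      "\<And>i j. i < n \<Longrightarrow> j < n \<Longrightarrow> A i j \<in> exp ` J"
  shows "psd_kernel n (\<lambda>i j. F 0 (A i j))"
  using assms(4-)
proof (induction n arbitrary: F G A)
  case 0
  then show ?case by (simp add: psd_kernel_def quad_form_def)
next
  case (Suc n)
  note F = Suc.prems(1) and G = Suc.prems(2) and FG = Suc.prems(3)
  show ?case
  proof (rule smooth_preserver_step[OF J down G FG Suc.prems(5) deriv_towerD[OF F] _ Suc.prems(6,7,8)])
    fix K assume K: "psd_kernel n K" "\<And>i j. K i j = K j i" "\<And>i j. i < n \<Longrightarrow> j < n \<Longrightarrow> K i j \<in> exp ` J"
    show "psd_kernel n (\<lambda>i j. F (Suc 0) (K i j))"
    proof (rule Suc.IH[where F = "\<lambda>i. F (Suc i)" and G = "log_deriv_tower G", OF _ _ _ _ _ K])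
      show "deriv_tower (exp ` J) (\<lambda>i. F (Suc i))" using F by (simp add: deriv_tower_def)
      show "deriv_tower J (log_deriv_tower G)" by (rule deriv_tower_log_deriv[OF G])
      show "log_deriv_tower G 0 t = F (Suc 0) (exp t)" if "t \<in> J" for t
        using stirling_expansion[OF J(1) F G FG that, of "Suc 0"]
        by (simp add: log_deriv_tower_def mom_1 exp_minus field_simps)
      show "0 \<le> F (Suc k) x" if "k < n" "x \<in> exp ` J" for k x using Suc.prems(4) that by simp
      show "hankel_psd n (\<lambda>i. log_deriv_tower G i t)" if "t \<in> J" for t
        by (rule hankel_psd_log_deriv_tower, rule hankel_psd_log_deriv[OF J down F G FG _ _ that])
          (use Suc.prems(4,5) in auto)
    qed
  qed auto
qed

section \<open>Test functions and mollification\<close>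

text \<open>The functions \<open>x \<mapsto> p(1/x) exp (- 1/x)\<close>, extended by \<open>0\<close> to \<open>x \<le> 0\<close>, are closed under
  differentiation.\<close>

definition exp_recip :: "real poly \<Rightarrow> real \<Rightarrow> real" where
  "exp_recip p x = (if x \<le> 0 then 0 else poly p (1 / x) * exp (- (1 / x)))"

lemma poly_div_exp_tendsto_0: "((\<lambda>y. poly p y * exp (- y)) \<longlongrightarrow> 0) at_top" for p :: "real poly"
proof -
  have "((\<lambda>y. \<Sum>i\<le>degree p. coeff p i * (y ^ i / exp y)) \<longlongrightarrow> (\<Sum>i\<le>degree p. coeff p i * 0)) at_top"
    by (intro tendsto_sum tendsto_mult tendsto_const tendsto_power_div_exp_0)
  then show ?thesis
    by (simp add: poly_altdef sum_distrib_right exp_minus divide_inverse mult.assoc)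
qed

text \<open>With \<open>y = 1 / x\<close> the derivative of \<open>p(y) exp (- y)\<close> in
  \<open>x\<close> is \<open>y^2 (p(y) - p'(y)) exp (- y)\<close>. At 0 the right difference
  quotient is \<open>y p(y) exp (- y)\<close>, which tends to 0 as \<open>y\<close> grows.\<close>

lemma exp_recip_DERIV:
  "(exp_recip p has_real_derivative exp_recip ([:0, 0, 1:] * (p - pderiv p)) x) (at x)"
proof (cases x "0 :: real" rule: linorder_cases)
  case less
  have "((\<lambda>x. 0) has_real_derivative 0) (at x)" by simp
  then have "(exp_recip p has_real_derivative 0) (at x)"
    by (rule has_field_derivative_transform_within_open[of _ _ _ "{..<0}"])
      (use less in \<open>auto simp: exp_recip_def\<close>)
  then show ?thesis using less by (simp add: exp_recip_def)
next
  case greater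
  have "((\<lambda>x. 1 / x) has_real_derivative - (1 / x)\<^sup>2) (at x)"
    using greater by (auto intro!: derivative_eq_intros simp: power2_eq_square)
  note inv = this
  have "((\<lambda>x. poly p (1 / x) * exp (- (1 / x))) has_real_derivative
      poly (pderiv p) (1 / x) * - (1 / x)\<^sup>2 * exp (- (1 / x)) + exp (- (1 / x)) * - (- (1 / x)\<^sup>2) * poly p (1 / x)) (at x)"
    by (intro DERIV_mult DERIV_chain2[OF poly_DERIV inv] DERIV_chain2[OF DERIV_exp] DERIV_minus inv)
  then have "((\<lambda>x. poly p (1 / x) * exp (- (1 / x))) has_real_derivative
      exp_recip ([:0, 0, 1:] * (p - pderiv p)) x) (at x)"
    by (rule DERIV_cong) (use greater in \<open>simp add: exp_recip_def power2_eq_square algebra_simps\<close>)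
  then show ?thesis
    by (rule has_field_derivative_transform_within_open[of _ _ _ "{0<..}"])
      (use greater in \<open>auto simp: exp_recip_def\<close>)
next
  case equal
  have "((\<lambda>h. exp_recip p h / h) \<longlongrightarrow> 0) (at 0)"
  proof (rule filterlim_split_at)
    show "((\<lambda>h. exp_recip p h / h) \<longlongrightarrow> 0) (at_left 0)"
      by (rule tendsto_eventually)
        (auto simp: exp_recip_def eventually_at_left_field intro: exI[of _ "-1"])
    have "((\<lambda>h. poly (pCons 0 p) (1 / h) * exp (- (1 / h))) \<longlongrightarrow> 0) (at_right 0)"
      by (rule filterlim_compose[OF poly_div_exp_tendsto_0])
        (simp add: filterlim_inverse_at_top_right flip: inverse_eq_divide)
    then show "((\<lambda>h. exp_recip p h / h) \<longlongrightarrow> 0) (at_right 0)"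
      by (rule Lim_transform_eventually)
        (auto simp: exp_recip_def eventually_at_right_field intro: exI[of _ 1])
  qed
  then show ?thesis unfolding equal DERIV_def by (simp add: exp_recip_def)
qed

lemma smooth_exp_recip: "smooth_on S (exp_recip 1)"
proof -
  define D where "D i = exp_recip (((\<lambda>p. [:0, 0, 1:] * (p - pderiv p)) ^^ i) 1)" for i
  have "deriv_tower S D" unfolding deriv_tower_def D_def using exp_recip_DERIV by simp
  from deriv_tower_smooth[OF this, of 0] show ?thesis by (simp add: D_def)
qed

lemma smooth_on_compose:
  "smooth_on T f \<Longrightarrow> smooth_on S g \<Longrightarrow> (\<And>x. x \<in> S \<Longrightarrow> g x \<in> T) \<Longrightarrow> smooth_on S (\<lambda>x. f (g x))"
  unfolding smooth_on_def by (blast intro: Ck_compose)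

lemma smooth_on_mult: "smooth_on S f \<Longrightarrow> smooth_on S g \<Longrightarrow> smooth_on S (\<lambda>x. f x * g x)"
  by (simp add: smooth_on_def Ck_mult)

lemma smooth_on_affine: "smooth_on S (\<lambda>x. a + b * x)"
  by (simp add: smooth_on_def Ck_add Ck_mult Ck_const Ck_ident)

lemma smooth_on_const: "smooth_on S (\<lambda>x. a)"
  by (simp add: smooth_on_def Ck_const)

lemma exists_mollifier:
  fixes \<alpha> \<beta> :: real
  assumes "\<alpha> < \<beta>"
  obtains w where "smooth_on UNIV w" "\<And>x. 0 \<le> w x" "\<And>x. x \<notin> {\<alpha>..\<beta>} \<Longrightarrow> w x = 0"
    "integral {\<alpha>..\<beta>} w = 1"
proof -
  \<comment> \<open>A product of two one-sided bumps, one vanishing to the left of \<alpha> and one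
    to the right of \<beta>.\<close>
  define v where "v x = exp_recip 1 (- \<alpha> + 1 * x) * exp_recip 1 (\<beta> + (- 1) * x)" for x
  have smooth: "smooth_on UNIV v"
    unfolding v_def by (intro smooth_on_mult smooth_on_compose[OF smooth_exp_recip] smooth_on_affine) auto
  have nonneg: "0 \<le> v x" for x by (simp add: v_def exp_recip_def)
  have supp: "v x = 0" if "x \<notin> {\<alpha>..\<beta>}" for x using that by (auto simp: v_def exp_recip_def)
  have cont: "continuous_on {\<alpha>..\<beta>} v"
    by (rule DERIV_continuous_on[OF has_field_derivative_at_within[OF smooth_on_DERIV[OF open_UNIV smooth]]]) simp
  have "0 < v ((\<alpha> + \<beta>) / 2)"
  proof -
    have "0 < - \<alpha> + 1 * ((\<alpha> + \<beta>) / 2)" "0 < \<beta> + (- 1) * ((\<alpha> + \<beta>) / 2)"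
      using assms by argo+
    moreover have "0 < exp_recip 1 x" if "0 < x" for x using that by (simp add: exp_recip_def)
    ultimately show ?thesis unfolding v_def by (intro mult_pos_pos)
  qed
  moreover have "(\<alpha> + \<beta>) / 2 \<in> {\<alpha>..\<beta>}" using assms by simp
  ultimately have "integral {\<alpha>..\<beta>} v \<noteq> 0"
    using integral_eq_0_iff[OF cont assms nonneg] by (metis less_irrefl)
  moreover have "0 \<le> integral {\<alpha>..\<beta>} v"
    by (rule integral_nonneg[OF integrable_continuous_real[OF cont]]) (rule nonneg)
  ultimately have c: "0 < integral {\<alpha>..\<beta>} v" by simp
  show thesis
  proof (rule that[of "\<lambda>x. inverse (integral {\<alpha>..\<beta>} v) * v x"])
    show "smooth_on UNIV (\<lambda>x. inverse (integral {\<alpha>..\<beta>} v) * v x)"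
      by (intro smooth_on_mult smooth_on_const smooth)
    show "integral {\<alpha>..\<beta>} (\<lambda>x. inverse (integral {\<alpha>..\<beta>} v) * v x) = 1"
      using c by simp
  qed (use c nonneg supp in \<open>auto simp: less_imp_le\<close>)
qed

section \<open>Test functions on intervals\<close>

lemma test_functionsI:
  assumes "smooth_on UNIV \<phi>" "{a..b} \<subseteq> U" "\<And>x. x \<notin> {a..b} \<Longrightarrow> \<phi> x = 0"
  shows "\<phi> \<in> test_functions U"
proof -
  have "closure {x. \<phi> x \<noteq> 0} \<subseteq> {a..b}"
    by (rule closure_minimal) (use assms(3) in blast, simp)
  moreover from this have "compact (closure {x. \<phi> x \<noteq> 0})"
    using compact_Int_closed[OF compact_Icc closed_closure] by (metis inf.absorb2)
  ultimately show ?thesis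
    using assms(1,2) by (auto simp: test_functions_def smooth_on_iff)
qed

text \<open>The compact support has a least and a greatest element, and the interval
  \<open>U\<close> contains everything between them; an empty support is covered by the empty
  interval from 1 to 0.\<close>

lemma test_functionsE:
  assumes "\<phi> \<in> test_functions U" "is_interval U"
  obtains a b where "{a..b} \<subseteq> U" "\<And>x. x \<notin> {a..b} \<Longrightarrow> \<phi> x = 0" "smooth_on UNIV \<phi>"
proof -
  define K where "K = closure {x. \<phi> x \<noteq> 0}"
  have K: "compact K" "K \<subseteq> U" and smooth: "smooth_on UNIV \<phi>"
    using assms(1) by (auto simp: test_functions_def K_def smooth_on_iff)
  have sub: "\<phi> x = 0" if "x \<notin> K" for x
    using that closure_subset[of "{x. \<phi> x \<noteq> 0}"] by (auto simp: K_def)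
  show thesis
  proof (cases "K = {}")
    case True
    then show thesis using that[of 1 0] sub smooth by auto
  next
    case False
    obtain a where a: "a \<in> K" "\<And>x. x \<in> K \<Longrightarrow> a \<le> x" using compact_attains_inf[OF K(1) False] by blast
    obtain b where b: "b \<in> K" "\<And>x. x \<in> K \<Longrightarrow> x \<le> b" using compact_attains_sup[OF K(1) False] by blast
    show thesis
    proof (rule that[of a b])
      show "{a..b} \<subseteq> U"
      proof
        fix x assume "x \<in> {a..b}"
        then show "x \<in> U"
          using a(1) b(1) K(2) by (intro mem_is_interval_1_I[OF assms(2), of a b x]) auto
      qed
    qed (use a b sub smooth in auto)
  qed
qed

lemma deriv_pow_eq_0:
  assumes "\<And>x. x \<notin> {a..b} \<Longrightarrow> \<phi> x = 0" "x \<notin> {a..b :: real}"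
  shows "(deriv ^^ k) \<phi> x = 0"
  using assms(2)
proof (induction k arbitrary: x)
  case 0
  then show ?case using assms(1) by simp
next
  case (Suc k)
  have "((\<lambda>x. 0) has_real_derivative 0) (at x)" by simp
  then have "((deriv ^^ k) \<phi> has_real_derivative 0) (at x)"
    by (rule has_field_derivative_transform_within_open[of _ _ _ "- {a..b}"])
      (use Suc in auto)
  then show ?case by (simp add: DERIV_imp_deriv)
qed

text \<open>Turns the integral in \<open>dist_deriv\<close> into one of a continuous function over a
  compact interval, where the default value of a nonintegrable function cannot occur.\<close>

lemma set_lebesgue_integral_compact_support:
  assumes "{a..b} \<subseteq> U" "continuous_on {a..b} w" "\<And>x. x \<in> U \<Longrightarrow> x \<notin> {a..b} \<Longrightarrow> w x = 0"
  shows "(LINT x:U|lebesgue. w x) = integral {a..b :: real} (w :: real \<Rightarrow> real)"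
proof -
  have "(LINT x:U|lebesgue. w x) = (LINT x:{a..b}|lebesgue. w x)"
    unfolding set_lebesgue_integral_def
    by (rule Bochner_Integration.integral_cong) (use assms(1,3) in \<open>auto simp: indicator_def\<close>)
  also have "\<dots> = integral {a..b} w"
    by (rule set_lebesgue_integral_eq_integral(2)[OF absolutely_integrable_continuous_real[OF assms(2)]])
  finally show ?thesis .
qed

lemma integral_compact_support:
  assumes "\<And>x. x \<in> S \<Longrightarrow> x \<notin> T \<Longrightarrow> f x = 0" "\<And>x. x \<in> T \<Longrightarrow> x \<notin> S \<Longrightarrow> f x = 0"
  shows "integral S f = integral T (f :: real \<Rightarrow> real)"
proof -
  have "(\<lambda>x. if x \<in> S then f x else 0) = (\<lambda>x. if x \<in> T then f x else 0)"
    using assms by auto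
  then show ?thesis by (metis integral_restrict_UNIV)
qed

lemma smooth_on_continuous_deriv:
  assumes "smooth_on UNIV \<phi>"
  shows "continuous_on A ((deriv ^^ k) \<phi>)"
proof (rule DERIV_continuous_on)
  show "((deriv ^^ k) \<phi> has_real_derivative (deriv ^^ Suc k) \<phi> x) (at x within A)" for x
    using deriv_towerD[OF smooth_on_deriv_tower[OF open_UNIV assms]]
    by (auto intro: has_field_derivative_at_within)
qed

lemma deriv_pow_affine:
  assumes "smooth_on UNIV \<phi>"
  shows "(deriv ^^ k) (\<lambda>x. \<phi> (a + b * x)) x = b ^ k * (deriv ^^ k) \<phi> (a + b * x)"
proof (induction k arbitrary: x)
  case (Suc k)
  have "(deriv ^^ k) (\<lambda>x. \<phi> (a + b * x)) = (\<lambda>x. b ^ k * (deriv ^^ k) \<phi> (a + b * x))"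
    using Suc by blast
  moreover have "((\<lambda>x. b ^ k * (deriv ^^ k) \<phi> (a + b * x)) has_real_derivative
      b ^ k * ((deriv ^^ Suc k) \<phi> (a + b * x) * b)) (at x)"
    by (intro DERIV_cmult DERIV_chain2[OF deriv_towerD[OF smooth_on_deriv_tower[OF open_UNIV assms]]])
      (auto intro!: derivative_eq_intros)
  ultimately show ?case by (simp add: DERIV_imp_deriv)
qed simp

lemma convolution_DERIV:
  assumes h: "continuous_on {a..b} h" and w: "smooth_on UNIV w"
  shows "((\<lambda>u. integral {a..b} (\<lambda>s. h s * (deriv ^^ k) w (u - s))) has_real_derivative
    integral {a..b} (\<lambda>s. h s * (deriv ^^ Suc k) w (u - s))) (at u)"
proof -
  have cont: "continuous_on A ((deriv ^^ i) w)" for i A by (rule smooth_on_continuous_deriv[OF w])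
  have "((\<lambda>u. integral (cbox a b) (\<lambda>s. h s * (deriv ^^ k) w (u - s))) has_field_derivative
      integral (cbox a b) (\<lambda>s. h s * (deriv ^^ Suc k) w (u - s))) (at u within UNIV)"
  proof (rule leibniz_rule_field_derivative)
    fix u s
    have "((\<lambda>u. (deriv ^^ k) w (u - s)) has_real_derivative (deriv ^^ Suc k) w (u - s) * 1) (at u)"
      by (rule DERIV_chain2[OF deriv_towerD[OF smooth_on_deriv_tower[OF open_UNIV w]]])
        (auto intro!: derivative_eq_intros)
    then show "((\<lambda>u. h s * (deriv ^^ k) w (u - s)) has_field_derivative h s * (deriv ^^ Suc k) w (u - s))
        (at u within UNIV)"
      using DERIV_cmult by fastforce
  next
    show "(\<lambda>s. h s * (deriv ^^ k) w (u - s)) integrable_on cbox a b" for u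
      unfolding box_real
      by (intro integrable_continuous_real continuous_intros h continuous_on_compose2[OF cont[of UNIV k]]) auto
    show "continuous_on (UNIV \<times> cbox a b) (\<lambda>(u, s). h s * (deriv ^^ Suc k) w (u - s))"
      unfolding box_real split_beta
      by (intro continuous_intros continuous_on_compose2[OF h] continuous_on_compose2[OF cont[of UNIV "Suc k"]]) auto
  qed auto
  then show ?thesis by simp
qed

lemma psd_mat_iff:
  "psd_mat (mat n n (\<lambda>(i, j). K i j)) \<longleftrightarrow> (\<forall>i<n. \<forall>j<n. K i j = K j i) \<and> psd_kernel n K"
proof -
  define A where "A = mat n n (\<lambda>(i, j). K i j)"
  have q: "v \<bullet> (A *\<^sub>v v) = quad_form n K (vec_index v)" if "v \<in> carrier_vec n" for v
    using that unfolding A_def quad_form_def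
    by (auto simp: scalar_prod_def lessThan_atLeast0 sum_distrib_left algebra_simps intro!: sum.cong)
  have sym: "transpose_mat A = A \<longleftrightarrow> (\<forall>i<n. \<forall>j<n. K i j = K j i)"
    unfolding A_def by (auto simp: mat_eq_iff)
  have "(\<forall>v\<in>carrier_vec n. 0 \<le> v \<bullet> (A *\<^sub>v v)) \<longleftrightarrow> psd_kernel n K"
  proof
    assume *: "\<forall>v\<in>carrier_vec n. 0 \<le> v \<bullet> (A *\<^sub>v v)"
    show "psd_kernel n K"
      unfolding psd_kernel_def
    proof
      fix c
      have "0 \<le> quad_form n K (vec_index (vec n c))"
        using *[rule_format, of "vec n c"] q[of "vec n c"] by simp
      also have "\<dots> = quad_form n K c" by (simp add: quad_form_def)
      finally show "0 \<le> quad_form n K c" .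
    qed
  next
    assume "psd_kernel n K"
    then show "\<forall>v\<in>carrier_vec n. 0 \<le> v \<bullet> (A *\<^sub>v v)" by (simp add: q psd_kernel_def)
  qed
  moreover have "dim_row A = n" "dim_col A = n" by (auto simp: A_def)
  ultimately show ?thesis
    unfolding psd_mat_def A_def[symmetric] by (auto simp: sym)
qed

section \<open>Mollification in the logarithmic variable\<close>

lemma minus_one_power_cancel: "(- 1) ^ k * ((- 1) ^ k * x) = (x :: real)"
  by (cases "even k") auto

text \<open>The falling factorial. In the variable \<open>x = exp t\<close>, with
  \<open>D = d/dt\<close>, it is the symbol of \<open>x^k d^k/dx^k\<close>.\<close>

definition falling_poly :: "nat \<Rightarrow> real poly" where
  "falling_poly k = (\<Prod>a<k. [:- real a, 1:])"

lemma deriv_pow_tower: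
  assumes "deriv_tower UNIV D"
  shows "(deriv ^^ i) (D 0) = D i"
proof (induction i)
  case (Suc i)
  then show ?case
    using deriv_towerD[OF assms, of _ i] by (auto intro!: ext DERIV_imp_deriv)
qed simp

text \<open>The left-hand product is what \<open>k\<close> differentiations of
  \<open>log_test\<close> accumulate from the exponent \<open>a = k - 1\<close>; reversing the order
  of the factors and extracting their signs gives the falling factorial.\<close>

lemma falling_poly_reverse:
  "(\<Prod>j<k. [:real k - 1 - real j, - 1:]) = Polynomial.smult ((- 1) ^ k) (falling_poly k)"
proof -
  have "(\<Prod>j<k. [:real k - 1 - real j, - 1:]) = (\<Prod>j<k. [:- 1:] * [:- real (k - Suc j), 1:])"
    by (intro prod.cong refl) (simp add: of_nat_diff)
  also have "\<dots> = [:- 1:] ^ k * falling_poly k"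
    unfolding prod.distrib falling_poly_def
    by (subst prod.nat_diff_reindex) simp
  also have "[:- 1 :: real:] ^ k = [:(- 1) ^ k:]" by (induction k) auto
  finally show ?thesis by simp
qed

text \<open>With \<open>\<chi> = p(D) w\<close> this is \<open>y\<^sup>a \<chi>(t - ln y)\<close>, whose derivative \<open>y\<^bsup>a-1\<^esup> (a \<chi> - \<chi>')(t - ln y)\<close> has
  the same form. Hence \<open>(- d/dy)\<^sup>k\<close> turns \<open>y\<^bsup>k-1\<^esup> w(t - ln y)\<close> into \<open>y\<^bsup>-1\<^esup> (D (D - 1) \<dots> (D - k + 1) w)(t - ln y)\<close>, which
  relates \<open>D\<^sup>k f\<close> to derivatives of the convolution of \<open>g\<close> with \<open>w\<close>.\<close>

definition log_test :: "(real \<Rightarrow> real) \<Rightarrow> real \<Rightarrow> real \<Rightarrow> real poly \<Rightarrow> real \<Rightarrow> real" where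
  "log_test w t a p y =
    (if y \<le> 0 then 0 else exp (a * ln y) * mom (\<lambda>i. (deriv ^^ i) w (t - ln y)) p)"

context
  fixes w :: "real \<Rightarrow> real" and \<delta> :: real
  assumes \<delta>: "0 < \<delta>" and w: "smooth_on UNIV w" and supp: "\<And>x. x \<notin> {\<delta>..2 * \<delta>} \<Longrightarrow> w x = 0"
begin

lemma mollifier_tower: "deriv_tower UNIV (\<lambda>i. (deriv ^^ i) w)"
  by (rule smooth_on_deriv_tower[OF open_UNIV w])

lemma mollifier_deriv_eq_0: "x \<notin> {\<delta>..2 * \<delta>} \<Longrightarrow> (deriv ^^ i) w x = 0"
  by (rule deriv_pow_eq_0[OF supp])

lemma log_test_supp:
  assumes "y \<notin> {exp (t - 2 * \<delta>)..exp (t - \<delta>)}"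
  shows "log_test w t a p y = 0"
proof (cases "y \<le> 0")
  case False
  have "t - ln y \<notin> {\<delta>..2 * \<delta>}"
  proof
    assume "t - ln y \<in> {\<delta>..2 * \<delta>}"
    then have "t - 2 * \<delta> \<le> ln y" "ln y \<le> t - \<delta>" by auto
    then have "exp (t - 2 * \<delta>) \<le> exp (ln y)" "exp (ln y) \<le> exp (t - \<delta>)" by (simp_all only: exp_le_cancel_iff)
    then show False using assms False by simp
  qed
  then show ?thesis using mollifier_deriv_eq_0 by (simp add: log_test_def mom_def)
qed (simp add: log_test_def)

lemma log_test_DERIV:
  "(log_test w t a p has_real_derivative log_test w t (a - 1) ([:a, - 1:] * p) y) (at y)"
proof (cases "y \<le> 0")
  \<comment> \<open>The support lies above \<open>exp (t - 2 * \<delta>)\<close>, so the function is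
    0 in a neighbourhood of \<open>y\<close>.\<close>
  case True
  have "((\<lambda>y. 0) has_real_derivative 0) (at y)" by simp
  then have "(log_test w t a p has_real_derivative 0) (at y)"
  proof (rule has_field_derivative_transform_within_open[of _ _ _ "{..<exp (t - 2 * \<delta>)}"])
    show "y \<in> {..<exp (t - 2 * \<delta>)}" using True by (simp add: le_less_trans[OF _ exp_gt_zero])
    show "0 = log_test w t a p x" if "x \<in> {..<exp (t - 2 * \<delta>)}" for x
      using log_test_supp[of x t] that by simp
  qed simp
  then show ?thesis using True by (simp add: log_test_def)
next
  case False
  then have y: "0 < y" by simp
  define M where "M p x = mom (\<lambda>i. (deriv ^^ i) w x) p" for p x
  have ln': "(ln has_real_derivative inverse y) (at y)" using y by (rule DERIV_ln)
  have e: "((\<lambda>y. exp (a * ln y)) has_real_derivative exp (a * ln y) * (a * inverse y)) (at y)"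
    by (rule DERIV_chain2[OF DERIV_exp DERIV_cmult[OF ln']])
  have "(M p has_real_derivative M (pCons 0 p) x) (at x)" for x
    using mom_DERIV[OF mollifier_tower, of x p] unfolding M_def mom_pCons by simp
  from DERIV_chain2[OF this DERIV_diff[OF DERIV_const ln']]
  have "((\<lambda>y. M p (t - ln y)) has_real_derivative M (pCons 0 p) (t - ln y) * (0 - inverse y)) (at y)" .
  note m = DERIV_mult[OF e this]
  have "((\<lambda>y. exp (a * ln y) * M p (t - ln y)) has_real_derivative
      log_test w t (a - 1) ([:a, - 1:] * p) y) (at y)"
  proof (rule DERIV_cong[OF m])
    have L: "log_test w t b q y = exp (b * ln y) * M q (t - ln y)" for b q
      using y by (simp add: log_test_def M_def)
    have E: "exp ((a - 1) * ln y) = exp (a * ln y) * inverse y"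
      using y by (simp add: left_diff_distrib exp_diff divide_inverse)
    have MM: "M ([:a, - 1:] * p) x = a * M p x - M (pCons 0 p) x" for x
    proof -
      have "[:a, - 1:] * p = Polynomial.smult a p - pCons 0 p"
        by (rule poly_eqI) (simp add: coeff_pCons split: nat.splits)
      then show ?thesis by (simp only: M_def mom_diff mom_smult)
    qed
    show "exp (a * ln y) * (a * inverse y) * M p (t - ln y) +
        M (pCons 0 p) (t - ln y) * (0 - inverse y) * exp (a * ln y) =
        log_test w t (a - 1) ([:a, - 1:] * p) y"
      unfolding L E MM by (simp add: algebra_simps)
  qed
  then show ?thesis
    by (rule has_field_derivative_transform_within_open[of _ _ _ "{0<..}"])
      (use y in \<open>auto simp: log_test_def M_def\<close>)
qed

lemma log_test_tower:
  "deriv_tower UNIV (\<lambda>i. log_test w t (a - real i) (\<Prod>j<i. [:a - real j, - 1:]))"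
  unfolding deriv_tower_def
proof (intro allI ballI)
  fix i y
  show "(log_test w t (a - real i) (\<Prod>j<i. [:a - real j, - 1:]) has_real_derivative
      log_test w t (a - real (Suc i)) (\<Prod>j<Suc i. [:a - real j, - 1:]) y) (at y)"
    using log_test_DERIV[of t "a - real i" "\<Prod>j<i. [:a - real j, - 1:]" y]
    by (simp add: mult.commute algebra_simps del: mult_pCons_left mult_pCons_right)
qed

context
  fixes J :: "real set" and f g :: "real \<Rightarrow> real"
  assumes J: "open J" "is_interval J" and down: "\<And>s t. t \<in> J \<Longrightarrow> s \<le> t \<Longrightarrow> s \<in> J"
    and f: "continuous_on (exp ` J) f" and fg: "\<And>t. t \<in> J \<Longrightarrow> g t = f (exp t)"
begin

text \<open>The convolution of \<open>g\<close> with the \<open>m\<close>-th derivative of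
  \<open>w\<close>. As \<open>w\<close> lives on \<open>[\<delta>, 2 \<delta>]\<close>, only values
  of \<open>g\<close> to the left of \<open>t\<close> enter, so every \<open>t\<close> in
  \<open>J\<close> is admissible.\<close>

definition moll :: "nat \<Rightarrow> real \<Rightarrow> real" where
  "moll m t = integral {t - 2 * \<delta>..t - \<delta>} (\<lambda>s. g s * (deriv ^^ m) w (t - s))"

lemma continuous_on_exp_pullback: "continuous_on J g"
proof -
  have "continuous_on J (\<lambda>t. f (exp t))"
    by (rule continuous_on_compose2[OF f]) (auto intro: continuous_intros)
  then show ?thesis by (rule continuous_on_eq) (simp add: fg)
qed

lemma moll_sub: "t \<in> J \<Longrightarrow> {t - 2 * \<delta>..t - \<delta>} \<subseteq> J"
  using \<delta> down[of t] by auto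

lemma continuous_on_mollifier_deriv: "continuous_on A (\<lambda>s. (deriv ^^ m) w (t - s))"
  by (rule continuous_on_compose2[OF smooth_on_continuous_deriv[OF w, of UNIV]]) (auto intro: continuous_intros)

lemma moll_tower: "deriv_tower J moll"
  unfolding deriv_tower_def
proof (intro allI ballI)
  fix m t0 assume t0: "t0 \<in> J"
  \<comment> \<open>A fixed interval that contains the moving range of integration for all
    \<open>t\<close> near \<open>t0\<close>, so that differentiation under the integral
    applies.\<close>
  define C where "C = {t0 - 1 - 2 * \<delta>..t0}"
  have C: "C \<subseteq> J" using down[OF t0] by (auto simp: C_def)
  have eq: "moll m t = integral C (\<lambda>s. g s * (deriv ^^ m) w (t - s))" if "t \<in> {t0 - 1<..<t0 + \<delta>}" for m t
    unfolding moll_def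
    by (rule integral_compact_support) (use that mollifier_deriv_eq_0 in \<open>auto simp: C_def\<close>)
  have "((\<lambda>t. integral C (\<lambda>s. g s * (deriv ^^ m) w (t - s))) has_real_derivative moll (Suc m) t0) (at t0)"
    using convolution_DERIV[OF _ w, of "t0 - 1 - 2 * \<delta>" t0 g m t0] continuous_on_subset[OF continuous_on_exp_pullback C] \<delta>
      eq[of t0 "Suc m"] by (simp add: C_def)
  then show "(moll m has_real_derivative moll (Suc m) t0) (at t0)"
    by (rule has_field_derivative_transform_within_open[of _ _ _ "{t0 - 1<..<t0 + \<delta>}"])
      (use eq \<delta> in auto)
qed

text \<open>The Hankel condition is tested on the reflected function \<open>s -> w (t - s)\<close>;
  the sign from reflecting cancels the sign in \<open>dist_deriv\<close>.\<close>

lemma moll_hankel: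
  assumes psd: "hankel_dist_psd n J g" and nonneg: "\<And>x. 0 \<le> w x" and t: "t \<in> J"
  shows "hankel_psd n (\<lambda>i. moll i t)"
proof -
  define \<psi> where "\<psi> s = w (t + (- 1) * s)" for s
  have smooth: "smooth_on UNIV \<psi>"
    unfolding \<psi>_def by (rule smooth_on_compose[OF w smooth_on_affine]) simp
  have supp': "\<psi> s = 0" if "s \<notin> {t - 2 * \<delta>..t - \<delta>}" for s
    unfolding \<psi>_def using that by (intro supp) auto
  have dsupp: "(deriv ^^ m) \<psi> s = 0" if "s \<notin> {t - 2 * \<delta>..t - \<delta>}" for m s
    by (rule deriv_pow_eq_0[OF supp' that])
  have test: "\<psi> \<in> test_functions J"
    by (rule test_functionsI[OF smooth moll_sub[OF t] supp'])
  have "dist_deriv J m g \<psi> = moll m t" for m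
  proof -
    have "(LINT s:J|lebesgue. g s * (deriv ^^ m) \<psi> s) = integral {t - 2 * \<delta>..t - \<delta>} (\<lambda>s. g s * (deriv ^^ m) \<psi> s)"
    proof (rule set_lebesgue_integral_compact_support[OF moll_sub[OF t]])
      show "continuous_on {t - 2 * \<delta>..t - \<delta>} (\<lambda>s. g s * (deriv ^^ m) \<psi> s)"
        by (intro continuous_on_mult continuous_on_subset[OF continuous_on_exp_pullback moll_sub[OF t]]
            smooth_on_continuous_deriv[OF smooth])
      show "g s * (deriv ^^ m) \<psi> s = 0" if "s \<notin> {t - 2 * \<delta>..t - \<delta>}" for s
        using dsupp[OF that] by simp
    qed
    also have "\<dots> = integral {t - 2 * \<delta>..t - \<delta>} (\<lambda>s. (- 1) ^ m * (g s * (deriv ^^ m) w (t - s)))"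
      using deriv_pow_affine[OF w, of m t "- 1"] by (simp add: \<psi>_def[abs_def] ac_simps)
    finally show ?thesis
      unfolding dist_deriv_def moll_def Henstock_Kurzweil_Integration.integral_mult_right
      by (simp only: minus_one_power_cancel)
  qed
  moreover have "psd_mat (hankel_dist n J g \<psi>)"
    using psd test nonneg unfolding hankel_dist_psd_def by (simp add: \<psi>_def)
  ultimately have "psd_kernel n (\<lambda>i j. moll (i + j) t)"
    unfolding hankel_dist_def psd_mat_iff by simp
  then show ?thesis by (simp add: hankel_psd_iff)
qed

lemma mom_moll:
  assumes t: "t \<in> J"
  shows "mom (\<lambda>m. moll m t) p =
    integral {t - 2 * \<delta>..t - \<delta>} (\<lambda>s. g s * mom (\<lambda>i. (deriv ^^ i) w (t - s)) p)"
proof -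
  have int: "(\<lambda>s. coeff p i * (g s * (deriv ^^ i) w (t - s))) integrable_on {t - 2 * \<delta>..t - \<delta>}" for i
    by (intro integrable_continuous_real continuous_on_mult continuous_on_const
        continuous_on_subset[OF continuous_on_exp_pullback moll_sub[OF t]] continuous_on_mollifier_deriv)
  have "mom (\<lambda>m. moll m t) p = (\<Sum>i\<le>degree p. integral {t - 2 * \<delta>..t - \<delta>} (\<lambda>s. coeff p i * (g s * (deriv ^^ i) w (t - s))))"
    by (simp add: mom_def moll_def)
  also have "\<dots> = integral {t - 2 * \<delta>..t - \<delta>} (\<lambda>s. \<Sum>i\<le>degree p. coeff p i * (g s * (deriv ^^ i) w (t - s)))"
    by (rule Henstock_Kurzweil_Integration.integral_sum[symmetric]) (use int in auto)
  finally show ?thesis by (simp add: mom_def sum_distrib_left mult.left_commute)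
qed

text \<open>The test function is \<open>y^(k-1) w (t - ln y)\<close>. Its \<open>k\<close>-th
  derivative carries the factor \<open>1 / y\<close>, which cancels the Jacobian of the substitution
  \<open>y = exp s\<close>.\<close>

lemma moll_falling_nonneg:
  assumes pos: "dist_nonneg (exp ` J) (dist_deriv (exp ` J) k f)" and nonneg: "\<And>x. 0 \<le> w x"
    and t: "t \<in> J"
  shows "0 \<le> mom (\<lambda>m. moll m t) (falling_poly k)"
proof -
  define A B where "A = t - 2 * \<delta>" and "B = t - \<delta>"
  have AB: "A \<le> B" "{A..B} \<subseteq> J" using \<delta> moll_sub[OF t] by (auto simp: A_def B_def)
  define \<phi> where "\<phi> = log_test w t (real k - 1) 1"
  note tower = log_test_tower[of t "real k - 1"]
  have smooth: "smooth_on UNIV \<phi>"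
    using deriv_tower_smooth[OF tower, of 0] by (simp add: \<phi>_def)
  have supp': "\<phi> y = 0" if "y \<notin> {exp A..exp B}" for y
    using log_test_supp[of y t] that by (simp add: \<phi>_def A_def B_def)
  have sub: "{exp A..exp B} \<subseteq> exp ` J"
  proof
    fix y assume y: "y \<in> {exp A..exp B}"
    then have "0 < y" using less_le_trans[OF exp_gt_zero[of A], of y] by simp
    moreover have "B \<in> J" using AB by auto
    ultimately show "y \<in> exp ` J" using exp_image_down[OF down, where x = "exp B"] y by auto
  qed
  have test: "\<phi> \<in> test_functions (exp ` J)" by (rule test_functionsI[OF smooth sub supp'])
  have "0 \<le> \<phi> y" for y by (simp add: \<phi>_def log_test_def mom_1 nonneg)
  then have "0 \<le> dist_deriv (exp ` J) k f \<phi>" using pos test by (auto simp: dist_nonneg_def)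
  also have "dist_deriv (exp ` J) k f \<phi> =
      (- 1) ^ k * integral {exp A..exp B} (\<lambda>y. f y * (deriv ^^ k) \<phi> y)"
    unfolding dist_deriv_def
  proof (subst set_lebesgue_integral_compact_support[OF sub])
    show "continuous_on {exp A..exp B} (\<lambda>y. f y * (deriv ^^ k) \<phi> y)"
      by (intro continuous_on_mult continuous_on_subset[OF f sub] smooth_on_continuous_deriv[OF smooth])
    show "f y * (deriv ^^ k) \<phi> y = 0" if "y \<notin> {exp A..exp B}" for y
      using deriv_pow_eq_0[OF supp' that, where k = k] by simp
  qed (rule refl)
  also have "integral {exp A..exp B} (\<lambda>y. f y * (deriv ^^ k) \<phi> y) =
      integral {A..B} (\<lambda>s. exp s *\<^sub>R (f (exp s) * (deriv ^^ k) \<phi> (exp s)))"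
    by (rule integral_unique[symmetric], rule has_integral_substitution)
      (use AB in \<open>auto intro!: continuous_on_mult continuous_on_subset[OF f sub]
        smooth_on_continuous_deriv[OF smooth] derivative_eq_intros\<close>)
  also have "\<dots> = integral {A..B} (\<lambda>s. (- 1) ^ k * (g s * mom (\<lambda>i. (deriv ^^ i) w (t - s)) (falling_poly k)))"
  proof (rule Henstock_Kurzweil_Integration.integral_cong)
    fix s assume s: "s \<in> {A..B}"
    have "(deriv ^^ k) \<phi> = log_test w t (- 1) (Polynomial.smult ((- 1) ^ k) (falling_poly k))"
      using deriv_pow_tower[OF tower, of k] by (simp add: \<phi>_def falling_poly_reverse)
    then show "exp s *\<^sub>R (f (exp s) * (deriv ^^ k) \<phi> (exp s)) =
        (- 1) ^ k * (g s * mom (\<lambda>i. (deriv ^^ i) w (t - s)) (falling_poly k))"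
      using fg[of s] s AB by (auto simp: log_test_def mom_smult exp_minus)
  qed
  also have "(- 1) ^ k * \<dots> = mom (\<lambda>m. moll m t) (falling_poly k)"
    unfolding mom_moll[OF t] A_def B_def Henstock_Kurzweil_Integration.integral_mult_right
    by (rule minus_one_power_cancel)
  finally show ?thesis .
qed

lemma moll_preserver:
  assumes hankel: "hankel_dist_psd n J g"
    and pos: "\<And>k. k < n \<Longrightarrow> dist_nonneg (exp ` J) (dist_deriv (exp ` J) k f)"
    and nonneg: "\<And>x. 0 \<le> w x"
    and A: "psd_kernel n A" "\<And>i j. A i j = A j i" "\<And>i j. i < n \<Longrightarrow> j < n \<Longrightarrow> A i j \<in> exp ` J"
  shows "psd_kernel n (\<lambda>i j. moll 0 (ln (A i j)))"
proof -
  \<comment> \<open>In the variable \<open>t = ln x\<close> this is the \<open>k\<close>-th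
    derivative of \<open>x -> moll 0 (ln x)\<close>.\<close>
  define H where "H k t = exp (- real k * t) * mom (\<lambda>m. moll m t) (falling_poly k)" for k t
  define F where "F k x = H k (ln x)" for k x
  have "deriv_tower (exp ` J) F"
    unfolding deriv_tower_def
  proof (intro allI ballI)
    fix k x assume "x \<in> exp ` J"
    then have x: "0 < x" "ln x \<in> J" by (auto simp: exp_image_iff)
    define t where "t = ln x"
    have "((\<lambda>t. exp (- real k * t)) has_real_derivative exp (- real k * t) * (- real k)) (at t)"
      by (auto intro!: derivative_eq_intros)
    from DERIV_mult[OF this mom_DERIV[OF moll_tower, of t "falling_poly k"]]
    have "(H k has_real_derivative exp (- real k * t) * (- real k) * mom (\<lambda>m. moll m t) (falling_poly k) +
        mom (\<lambda>m. moll (Suc m) t) (falling_poly k) * exp (- real k * t)) (at t)"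
      using x by (simp add: H_def[abs_def] t_def)
    then have H': "(H k has_real_derivative H (Suc k) t * exp t) (at t)"
    proof (rule DERIV_cong)
      have "falling_poly (Suc k) = pCons 0 (falling_poly k) - Polynomial.smult (real k) (falling_poly k)"
        by (rule poly_eqI) (simp add: falling_poly_def coeff_pCons mult.commute[of _ "[:_, _:]"] split: nat.splits)
      then have "mom (\<lambda>m. moll m t) (falling_poly (Suc k)) =
          mom (\<lambda>m. moll (Suc m) t) (falling_poly k) - real k * mom (\<lambda>m. moll m t) (falling_poly k)"
        by (simp only: mom_diff mom_smult mom_pCons)
      note M = this
      have E: "exp (- real k * t) = exp (- real (Suc k) * t) * exp t"
        by (simp add: algebra_simps flip: exp_add)
      show "exp (- real k * t) * (- real k) * mom (\<lambda>m. moll m t) (falling_poly k) +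
          mom (\<lambda>m. moll (Suc m) t) (falling_poly k) * exp (- real k * t) = H (Suc k) t * exp t"
        unfolding H_def E M by (simp add: algebra_simps)
    qed
    have "((\<lambda>x. H k (ln x)) has_real_derivative H (Suc k) t * exp t * inverse x) (at x)"
      by (rule DERIV_chain2[OF _ DERIV_ln[OF x(1)]]) (use H' in \<open>simp add: t_def\<close>)
    moreover have "H (Suc k) t * exp t * inverse x = F (Suc k) x"
      using x(1) by (simp add: F_def t_def mult.assoc)
    ultimately show "(F k has_real_derivative F (Suc k) x) (at x)"
      by (simp only: F_def[abs_def])
  qed
  note F = this
  have F0: "F 0 x = moll 0 (ln x)" for x by (simp add: F_def H_def falling_poly_def mom_1)
  have "psd_kernel n (\<lambda>i j. F 0 (A i j))"
  proof (rule smooth_preserver[OF J down F moll_tower _ _ _ A])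
    show "moll 0 t = F 0 (exp t)" for t by (simp add: F0)
    show "0 \<le> F k x" if "k < n" "x \<in> exp ` J" for k x
      using moll_falling_nonneg[OF pos[OF that(1)] nonneg] that(2) by (auto simp: F_def H_def exp_image_iff)
    show "hankel_psd n (\<lambda>i. moll i t)" if "t \<in> J" for t by (rule moll_hankel[OF hankel nonneg that])
  qed
  then show ?thesis by (simp add: F0)
qed

lemma moll_approx:
  assumes nonneg: "\<And>x. 0 \<le> w x" and one: "integral {\<delta>..2 * \<delta>} w = 1" and t: "t \<in> J"
    and close: "\<And>s. s \<in> {t - 2 * \<delta>..t - \<delta>} \<Longrightarrow> \<bar>g s - g t\<bar> \<le> e"
  shows "\<bar>moll 0 t - g t\<bar> \<le> e"
proof -
  define C where "C = {t - 2 * \<delta>..t - \<delta>}"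
  have cw: "continuous_on C (\<lambda>s. w (t - s))" using continuous_on_mollifier_deriv[of C 0 t] by simp
  have cg: "continuous_on C g" unfolding C_def by (rule continuous_on_subset[OF continuous_on_exp_pullback moll_sub[OF t]])
  have "integral C (\<lambda>s. w (t - s)) = integral {- 2 * \<delta>..- \<delta>} (\<lambda>s. w (- s))"
    using integral_shift_Icc_real[of "t - 2 * \<delta>" "t - \<delta>" "\<lambda>s. w (- s)" "- t"]
    by (simp add: C_def o_def)
  also have "\<dots> = integral {\<delta>..2 * \<delta>} w"
    using Henstock_Kurzweil_Integration.integral_reflect_real[of "2 * \<delta>" \<delta> w] by simp
  finally have int1: "integral C (\<lambda>s. w (t - s)) = 1" using one by simp
  have "moll 0 t - g t = integral C (\<lambda>s. g s * w (t - s)) - integral C (\<lambda>s. g t * w (t - s))"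
    using int1 by (simp add: moll_def C_def)
  also have "\<dots> = integral C (\<lambda>s. (g s - g t) * w (t - s))"
    unfolding left_diff_distrib C_def
    by (rule Henstock_Kurzweil_Integration.integral_diff[symmetric])
      (intro integrable_continuous_real continuous_on_mult continuous_on_const cw[unfolded C_def] cg[unfolded C_def])+
  finally have eq: "moll 0 t - g t = integral C (\<lambda>s. (g s - g t) * w (t - s))" .
  have "norm (integral C (\<lambda>s. (g s - g t) * w (t - s))) \<le> integral C (\<lambda>s. e * w (t - s))"
  proof (rule integral_norm_bound_integral)
    show "(\<lambda>s. (g s - g t) * w (t - s)) integrable_on C" "(\<lambda>s. e * w (t - s)) integrable_on C"
      unfolding C_def
      by (intro integrable_continuous_real continuous_on_mult continuous_on_diff continuous_on_const
          cw[unfolded C_def] cg[unfolded C_def])+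
    show "norm ((g s - g t) * w (t - s)) \<le> e * w (t - s)" if "s \<in> C" for s
      using close[of s] that nonneg[of "t - s"] by (simp add: C_def abs_mult mult_right_mono)
  qed
  then show ?thesis using eq int1 by simp
qed

end
end

lemma preserver_if_dist_conditions:
  assumes J: "open J" "is_interval J" and down: "\<And>s t. t \<in> J \<Longrightarrow> s \<le> t \<Longrightarrow> s \<in> J"
    and f: "continuous_on (exp ` J) f" and fg: "\<And>t. t \<in> J \<Longrightarrow> g t = f (exp t)"
    and hankel: "hankel_dist_psd n J g"
    and pos: "\<And>k. k < n \<Longrightarrow> dist_nonneg (exp ` J) (dist_deriv (exp ` J) k f)"
    and A: "psd_kernel n A" "\<And>i j. A i j = A j i" "\<And>i j. i < n \<Longrightarrow> j < n \<Longrightarrow> A i j \<in> exp ` J"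
  shows "psd_kernel n (\<lambda>i j. f (A i j))"
proof -
  define \<delta> :: "nat \<Rightarrow> real" where "\<delta> q = 1 / real (Suc q)" for q
  have \<delta>: "0 < \<delta> q" for q by (simp add: \<delta>_def)
  have "\<exists>w. smooth_on UNIV w \<and> (\<forall>x. 0 \<le> w x) \<and> (\<forall>x. x \<notin> {\<delta> q..2 * \<delta> q} \<longrightarrow> w x = 0) \<and>
      integral {\<delta> q..2 * \<delta> q} w = 1" for q
    using exists_mollifier[of "\<delta> q" "2 * \<delta> q"] \<delta>[of q] by (metis mult_2 less_add_same_cancel1)
  then obtain w where w: "\<And>q. smooth_on UNIV (w q)" "\<And>q x. 0 \<le> w q x"
    "\<And>q x. x \<notin> {\<delta> q..2 * \<delta> q} \<Longrightarrow> w q x = 0" "\<And>q. integral {\<delta> q..2 * \<delta> q} (w q) = 1"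
    by metis
  define M where "M q = moll (w q) (\<delta> q) g 0" for q
  have psd: "psd_kernel n (\<lambda>i j. M q (ln (A i j)))" for q
    unfolding M_def
    by (rule moll_preserver[OF \<delta> w(1) w(3) J down f fg hankel pos w(2) A])
  show ?thesis
  proof (rule psd_kernel_limit[where F = sequentially and K = "\<lambda>q i j. M q (ln (A i j))"])
    fix i j assume ij: "i < n" "j < n"
    define t where "t = ln (A i j)"
    have t: "t \<in> J" "exp t = A i j" using A(3)[OF ij] by (auto simp: exp_image_iff t_def)
    have "(\<lambda>q. M q t) \<longlonglongrightarrow> g t"
    proof (rule metric_LIMSEQ_I)
      fix e :: real assume e: "0 < e"
      have "continuous_on J g" by (rule continuous_on_exp_pullback[OF \<delta>[of 0] w(1)[of 0] w(3)[of _ 0] J down f fg])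
      then have "isCont g t" using J(1) t(1) by (simp add: continuous_on_eq_continuous_at)
      then obtain d where d: "0 < d" "\<And>s. dist s t < d \<Longrightarrow> dist (g s) (g t) < e / 2"
        using e unfolding continuous_at_eps_delta by (metis half_gt_zero dist_commute)
      obtain N where N: "inverse (real (Suc N)) < d / 2"
        using reals_Archimedean[OF half_gt_zero[OF d(1)]] by blast
      show "\<exists>N. \<forall>q\<ge>N. dist (M q t) (g t) < e"
      proof (intro exI allI impI)
        fix q assume q: "N \<le> q"
        then have "inverse (real (Suc q)) \<le> inverse (real (Suc N))" by (intro le_imp_inverse_le) auto
        then have dq: "2 * \<delta> q < d" using N unfolding \<delta>_def inverse_eq_divide by linarith
        have "\<bar>M q t - g t\<bar> \<le> e / 2"
          unfolding M_def
        proof (rule moll_approx[OF \<delta> w(1) w(3) J down f fg w(2) w(4) t(1)])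
          fix s assume "s \<in> {t - 2 * \<delta> q..t - \<delta> q}"
          then have "dist s t < d" using dq \<delta>[of q] by (auto simp: dist_real_def)
          then show "\<bar>g s - g t\<bar> \<le> e / 2" using d(2)[of s] by (simp add: dist_real_def)
        qed
        then show "dist (M q t) (g t) < e" using e by (simp add: dist_real_def)
      qed
    qed
    then show "(\<lambda>q. M q (ln (A i j))) \<longlonglongrightarrow> f (A i j)"
      using fg[OF t(1)] t(2) by (simp add: t_def)
  qed (use psd in auto)
qed

section \<open>Necessity\<close>

text \<open>\<open>D\<close> is the convolution of \<open>h\<close>, cut off to a compact interval,
  with the reflection of \<psi>, hence smooth on the whole line. Agreement with the integral of
  translates is claimed for \<open>|u| <= \<eta>\<close>, where the shifted supports stay inside the
  cut-off.\<close>

lemma test_functions_translate: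
  assumes U: "open U" "is_interval U" "U \<noteq> {}" and \<psi>: "\<psi> \<in> test_functions U"
    and h: "continuous_on U h"
  obtains a b \<eta> :: real and D where "0 < \<eta>" "{a - \<eta>..b + \<eta>} \<subseteq> U" "deriv_tower UNIV D"
    "\<And>k. D k 0 = dist_deriv U k h \<psi>"
    "\<And>u. \<bar>u\<bar> \<le> \<eta> \<Longrightarrow> D 0 u = integral {a..b} (\<lambda>x. h (x + u) * \<psi> x)"
proof -
  obtain a b where ab: "a \<le> b" "{a..b} \<subseteq> U" "\<And>x. x \<notin> {a..b} \<Longrightarrow> \<psi> x = 0" and smooth: "smooth_on UNIV \<psi>"
  proof (rule test_functionsE[OF \<psi> U(2)])
    fix a b assume ab: "{a..b} \<subseteq> U" "\<And>x. x \<notin> {a..b} \<Longrightarrow> \<psi> x = 0" "smooth_on UNIV \<psi>"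
    obtain p where p: "p \<in> U" using U(3) by auto
    show thesis
    proof (cases "a \<le> b")
      case True
      then show thesis using that ab by blast
    next
      case False
      then show thesis using that[of p p] ab p by auto
    qed
  qed
  obtain \<epsilon>1 where \<epsilon>1: "0 < \<epsilon>1" "cball a \<epsilon>1 \<subseteq> U"
    using U(1) ab open_contains_cball[of U] by (metis atLeastAtMost_iff order_refl subsetD)
  obtain \<epsilon>2 where \<epsilon>2: "0 < \<epsilon>2" "cball b \<epsilon>2 \<subseteq> U"
    using U(1) ab open_contains_cball[of U] by (metis atLeastAtMost_iff order_refl subsetD)
  define \<eta> where "\<eta> = min \<epsilon>1 \<epsilon>2"
  have \<eta>: "0 < \<eta>" "a - \<eta> \<in> U" "b + \<eta> \<in> U"
    using \<epsilon>1 \<epsilon>2 by (auto simp: \<eta>_def dist_real_def subset_iff)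
  have sub: "{a - \<eta>..b + \<eta>} \<subseteq> U"
  proof
    fix x assume "x \<in> {a - \<eta>..b + \<eta>}"
    then show "x \<in> U" by (intro mem_is_interval_1_I[OF U(2) \<eta>(2,3)]) auto
  qed
  define w where "w x = \<psi> (0 + (- 1) * x)" for x
  have w: "smooth_on UNIV w"
    unfolding w_def by (rule smooth_on_compose[OF smooth smooth_on_affine]) simp
  have dw: "(deriv ^^ k) w x = (- 1) ^ k * (deriv ^^ k) \<psi> (- x)" for k x
    using deriv_pow_affine[OF smooth, of k 0 "- 1" x] by (simp add: w_def[abs_def])
  have d\<psi>: "(deriv ^^ k) \<psi> x = 0" if "x \<notin> {a..b}" for k x
    by (rule deriv_pow_eq_0[OF ab(3) that])
  have hc: "continuous_on {a - \<eta>..b + \<eta>} h" by (rule continuous_on_subset[OF h sub])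
  define D where "D k u = integral {a - \<eta>..b + \<eta>} (\<lambda>s. h s * (deriv ^^ k) w (u - s))" for k u
  show thesis
  proof (rule that[of \<eta> a b D])
    show "deriv_tower UNIV D"
      unfolding deriv_tower_def D_def using convolution_DERIV[OF hc w] by blast
    show "D k 0 = dist_deriv U k h \<psi>" for k
    proof -
      have "(LINT x:U|lebesgue. h x * (deriv ^^ k) \<psi> x) =
          integral {a - \<eta>..b + \<eta>} (\<lambda>x. h x * (deriv ^^ k) \<psi> x)"
      proof (rule set_lebesgue_integral_compact_support[OF sub])
        show "continuous_on {a - \<eta>..b + \<eta>} (\<lambda>x. h x * (deriv ^^ k) \<psi> x)"
          by (intro continuous_on_mult hc smooth_on_continuous_deriv[OF smooth])
        show "h x * (deriv ^^ k) \<psi> x = 0" if "x \<notin> {a - \<eta>..b + \<eta>}" for x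
          using d\<psi>[of x k] that \<eta>(1) by auto
      qed
      moreover have "(\<lambda>s. h s * (deriv ^^ k) w (0 - s)) = (\<lambda>s. (- 1) ^ k * (h s * (deriv ^^ k) \<psi> s))"
        by (simp add: dw mult.left_commute[of "h _"])
      ultimately show ?thesis by (simp add: D_def dist_deriv_def)
    qed
    show "D 0 u = integral {a..b} (\<lambda>x. h (x + u) * \<psi> x)" if u: "\<bar>u\<bar> \<le> \<eta>" for u
    proof -
      have "D 0 u = integral {a - \<eta>..b + \<eta>} (\<lambda>s. h s * \<psi> (s - u))" by (simp add: D_def w_def)
      also have "\<dots> = integral {a + u..b + u} (\<lambda>s. h s * \<psi> (s - u))"
        by (rule integral_compact_support) (use u ab(3) in \<open>auto simp: abs_le_iff\<close>)
      also have "\<dots> = integral {a..b} (\<lambda>x. h (x + u) * \<psi> x)"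
        using integral_shift_Icc_real[of a b "\<lambda>s. h s * \<psi> (s - u)" u]
        by (simp add: o_def add.commute)
      finally show ?thesis .
    qed
  qed (use \<eta> sub in auto)
qed

lemma quad_form_translate_nonneg:
  assumes sub: "{a - \<eta>..b + \<eta>} \<subseteq> U" and h: "continuous_on U h"
    and \<psi>: "smooth_on UNIV \<psi>" "\<And>x. x \<in> {a..b} \<Longrightarrow> 0 \<le> \<psi> x"
    and D: "\<And>u. \<bar>u\<bar> \<le> \<eta> \<Longrightarrow> D u = integral {a..b} (\<lambda>x. h (x + u) * \<psi> x)"
    and u: "\<And>i j. i < n \<Longrightarrow> j < n \<Longrightarrow> \<bar>u i j\<bar> \<le> \<eta>"
    and psd: "\<And>x. x \<in> {a..b} \<Longrightarrow> psd_kernel n (\<lambda>i j. h (x + u i j))"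
  shows "psd_kernel n (\<lambda>i j. D (u i j))"
  unfolding psd_kernel_def
proof
  fix c
  have int: "(\<lambda>x. c i * c j * (h (x + u i j) * \<psi> x)) integrable_on {a..b}" if "i < n" "j < n" for i j
  proof -
    have "continuous_on {a..b} (\<lambda>x. h (x + u i j))"
      by (rule continuous_on_compose2[OF continuous_on_subset[OF h sub]])
        (use u[OF that] in \<open>auto intro!: continuous_intros simp: abs_le_iff\<close>)
    moreover have "continuous_on {a..b} \<psi>" using smooth_on_continuous_deriv[OF \<psi>(1), of _ 0] by simp
    ultimately show ?thesis
      by (intro integrable_continuous_real continuous_on_mult continuous_on_const)
  qed
  have "quad_form n (\<lambda>i j. D (u i j)) c =
      (\<Sum>i<n. \<Sum>j<n. integral {a..b} (\<lambda>x. c i * c j * (h (x + u i j) * \<psi> x)))"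
    by (simp add: quad_form_def D u)
  also have "\<dots> = (\<Sum>i<n. integral {a..b} (\<lambda>x. \<Sum>j<n. c i * c j * (h (x + u i j) * \<psi> x)))"
    by (intro sum.cong refl Henstock_Kurzweil_Integration.integral_sum[symmetric]) (use int in auto)
  also have "\<dots> = integral {a..b} (\<lambda>x. \<Sum>i<n. \<Sum>j<n. c i * c j * (h (x + u i j) * \<psi> x))"
    by (intro Henstock_Kurzweil_Integration.integral_sum[symmetric] integrable_sum) (use int in auto)
  also have "(\<lambda>x. \<Sum>i<n. \<Sum>j<n. c i * c j * (h (x + u i j) * \<psi> x)) =
      (\<lambda>x. quad_form n (\<lambda>i j. h (x + u i j)) c * \<psi> x)"
    by (simp add: quad_form_def sum_distrib_right mult.assoc)
  also have "0 \<le> integral {a..b} (\<lambda>x. quad_form n (\<lambda>i j. h (x + u i j)) c * \<psi> x)"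
  proof (rule integral_nonneg)
    show "(\<lambda>x. quad_form n (\<lambda>i j. h (x + u i j)) c * \<psi> x) integrable_on {a..b}"
      unfolding quad_form_def sum_distrib_right using int
      by (auto intro!: integrable_sum simp: mult.assoc)
    show "0 \<le> quad_form n (\<lambda>i j. h (x + u i j)) c * \<psi> x" if "x \<in> {a..b}" for x
      using psd[OF that] \<psi>(2)[OF that] by (simp add: psd_kernel_def)
  qed
  finally show "0 \<le> quad_form n (\<lambda>i j. D (u i j)) c" .
qed

section \<open>Iterated difference quotients\<close>

definition diff_quot :: "real \<Rightarrow> (real \<Rightarrow> real) \<Rightarrow> real \<Rightarrow> real" where
  "diff_quot h F x = (F (x + h) - F x) / h"

text \<open>Weights of the values at \<open>x + i h\<close> in the \<open>r\<close>-fold difference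
  quotient; they vanish for \<open>i > r\<close>, so \<open>n\<close> points allow every
  \<open>r < n\<close>.\<close>

primrec diff_coeff :: "real \<Rightarrow> nat \<Rightarrow> nat \<Rightarrow> real" where
  "diff_coeff h 0 i = (if i = 0 then 1 else 0)"
| "diff_coeff h (Suc r) i = ((case i of 0 \<Rightarrow> 0 | Suc i' \<Rightarrow> diff_coeff h r i') - diff_coeff h r i) / h"

lemma sum_diff_coeff:
  assumes "r < n"
  shows "(\<Sum>i<n. diff_coeff h r i * F (x + real i * h)) = (diff_quot h ^^ r) F x"
  using assms
proof (induction r arbitrary: n x)
  case 0
  then show ?case by (simp add: if_distrib[of "\<lambda>c. c * _"] cong: if_cong)
next
  case (Suc r)
  obtain n' where n: "n = Suc n'" using Suc.prems by (cases n) auto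
  have shift: "(\<Sum>i<n. (case i of 0 \<Rightarrow> 0 | Suc i' \<Rightarrow> diff_coeff h r i') * F (x + real i * h)) =
      (\<Sum>i<n'. diff_coeff h r i * F ((x + h) + real i * h))"
    unfolding n sum.lessThan_Suc_shift by (simp add: algebra_simps)
  have "(\<Sum>i<n. diff_coeff h (Suc r) i * F (x + real i * h)) =
      ((\<Sum>i<n. (case i of 0 \<Rightarrow> 0 | Suc i' \<Rightarrow> diff_coeff h r i') * F (x + real i * h)) -
       (\<Sum>i<n. diff_coeff h r i * F (x + real i * h))) / h"
    by (simp add: left_diff_distrib sum_subtractf flip: sum_divide_distrib)
  also have "\<dots> = ((diff_quot h ^^ r) F (x + h) - (diff_quot h ^^ r) F x) / h"
    unfolding shift using Suc.IH[of n' "x + h"] Suc.IH[of n x] Suc.prems n by simp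
  also have "\<dots> = (diff_quot h ^^ Suc r) F x"
    by (simp add: diff_quot_def[of h "(diff_quot h ^^ r) F"])
  finally show ?case .
qed

text \<open>The difference quotients of a tower form a tower again, so each induction step is one
  application of the mean value theorem.\<close>

lemma diff_quot_mean_value:
  assumes "deriv_tower UNIV D" "0 < h"
  shows "\<exists>\<xi>. x \<le> \<xi> \<and> \<xi> \<le> x + real r * h \<and> (diff_quot h ^^ r) (D 0) x = D r \<xi>"
  using assms(1)
proof (induction r arbitrary: D)
  case 0
  then show ?case by auto
next
  case (Suc r)
  have "deriv_tower UNIV (\<lambda>i. diff_quot h (D i))"
    unfolding deriv_tower_def
  proof (intro allI ballI)
    fix i s
    have "((\<lambda>s. D i (s + h)) has_real_derivative D (Suc i) (s + h) * 1) (at s)"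
      by (rule DERIV_chain2[OF deriv_towerD[OF Suc.prems]]) (auto intro!: derivative_eq_intros)
    from DERIV_cdivide[OF DERIV_diff[OF this deriv_towerD[OF Suc.prems]], where c = h]
    show "(diff_quot h (D i) has_real_derivative diff_quot h (D (Suc i)) s) (at s)"
      by (simp add: diff_quot_def[abs_def])
  qed
  from Suc.IH[OF this] obtain \<xi> where \<xi>: "x \<le> \<xi>" "\<xi> \<le> x + real r * h"
    "(diff_quot h ^^ r) (diff_quot h (D 0)) x = diff_quot h (D r) \<xi>" by blast
  have "\<exists>z. \<xi> < z \<and> z < \<xi> + h \<and> D r (\<xi> + h) - D r \<xi> = (\<xi> + h - \<xi>) * D (Suc r) z"
    by (rule MVT2) (use assms(2) deriv_towerD[OF Suc.prems] in auto)
  then obtain z where z: "\<xi> < z" "z < \<xi> + h" "D r (\<xi> + h) - D r \<xi> = h * D (Suc r) z" by auto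
  have "(diff_quot h ^^ Suc r) (D 0) x = D (Suc r) z"
    using \<xi>(3) z(3) assms(2) by (simp add: funpow_swap1 diff_quot_def)
  moreover have "x \<le> z" "z \<le> x + real (Suc r) * h" using \<xi> z by (auto simp: algebra_simps)
  ultimately show ?case by blast
qed

lemma diff_quot_tendsto:
  assumes D: "deriv_tower UNIV D"
  shows "((\<lambda>h. (diff_quot h ^^ r) (D 0) 0) \<longlongrightarrow> D r 0) (at_right 0)"
proof (rule tendstoI)
  fix e :: real assume "0 < e"
  have "isCont (D r) 0" using deriv_towerD[OF D] DERIV_isCont by blast
  then obtain d where d: "0 < d" "\<And>z. dist z 0 < d \<Longrightarrow> dist (D r z) (D r 0) < e"
    using \<open>0 < e\<close> unfolding continuous_at_eps_delta by blast
  show "\<forall>\<^sub>F h in at_right 0. dist ((diff_quot h ^^ r) (D 0) 0) (D r 0) < e"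
    unfolding eventually_at_right_field
  proof (intro exI conjI allI impI)
    show "0 < d / (real r + 1)" using d(1) by simp
    fix h :: real assume h: "0 < h" "h < d / (real r + 1)"
    obtain \<xi> where \<xi>: "0 \<le> \<xi>" "\<xi> \<le> 0 + real r * h" "(diff_quot h ^^ r) (D 0) 0 = D r \<xi>"
      using diff_quot_mean_value[OF D h(1)] by blast
    have "real r * h \<le> (real r + 1) * h" using h(1) by simp
    also have "\<dots> < d" using h(2) by (simp add: field_simps)
    finally have "dist \<xi> 0 < d" using \<xi> by simp
    then show "dist ((diff_quot h ^^ r) (D 0) 0) (D r 0) < e" using d(2) \<xi>(3) by simp
  qed
qed

lemma pderiv_pow_monom:
  "j \<le> k \<Longrightarrow> (pderiv ^^ j) (monom (1 :: real) k) = monom (fact k / fact (k - j)) (k - j)"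
proof (induction j)
  case (Suc j)
  then obtain m where m: "k - j = Suc m" by (metis Suc_diff_Suc Suc_le_eq)
  then have "k - Suc j = m" by simp
  with Suc m show ?case by (simp add: pderiv_monom del: of_nat_Suc)
qed simp

lemma sum_swap3:
  "(\<Sum>j\<in>A. \<Sum>p\<in>B. \<Sum>q\<in>C. X j p q) = (\<Sum>p\<in>B. \<Sum>q\<in>C. \<Sum>j\<in>A. X j p q)"
proof -
  have "(\<Sum>j\<in>A. \<Sum>p\<in>B. \<Sum>q\<in>C. X j p q) = (\<Sum>p\<in>B. \<Sum>j\<in>A. \<Sum>q\<in>C. X j p q)"
    by (rule sum.swap)
  also have "\<dots> = (\<Sum>p\<in>B. \<Sum>q\<in>C. \<Sum>j\<in>A. X j p q)"
    by (rule sum.cong[OF refl], rule sum.swap)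
  finally show ?thesis .
qed

text \<open>As the argument depends on \<open>i + j\<close> only, differences of orders
  \<open>p\<close> and \<open>q\<close> in the two indices give one of order \<open>p + q\<close>.
  The matrix of difference quotients is thus a congruence transform of a positive semidefinite
  kernel, and \<open>h\<close> tends to 0.\<close>

lemma hankel_of_kernel:
  assumes D: "deriv_tower UNIV D" and "0 < e"
    and psd: "\<And>h. 0 < h \<Longrightarrow> h < e \<Longrightarrow> psd_kernel n (\<lambda>i j. D 0 (h * (real i + real j)))"
  shows "psd_kernel n (\<lambda>i j. D (i + j) 0)"
proof (rule psd_kernel_limit[where F = "at_right 0"])
  show "((\<lambda>h. (diff_quot h ^^ (i + j)) (D 0) 0) \<longlongrightarrow> D (i + j) 0) (at_right 0)" for i j
    by (rule diff_quot_tendsto[OF D])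
  show "\<forall>\<^sub>F h in at_right 0. psd_kernel n (\<lambda>i j. (diff_quot h ^^ (i + j)) (D 0) 0)"
    unfolding eventually_at_right_field
  proof (intro exI[of _ e] conjI allI impI)
    fix h :: real assume h: "0 < h" "h < e"
    show "psd_kernel n (\<lambda>i j. (diff_quot h ^^ (i + j)) (D 0) 0)"
      unfolding psd_kernel_def
    proof
      fix v
      define c where "c i = (\<Sum>p<n. v p * diff_coeff h p i)" for i
      have inner: "(\<Sum>i<n. \<Sum>j<n. diff_coeff h p i * diff_coeff h q j * D 0 (h * (real i + real j))) =
          (diff_quot h ^^ (p + q)) (D 0) 0" if "p < n" "q < n" for p q
      proof -
        have "(\<Sum>i<n. \<Sum>j<n. diff_coeff h p i * diff_coeff h q j * D 0 (h * (real i + real j))) =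
            (\<Sum>i<n. diff_coeff h p i * (\<Sum>j<n. diff_coeff h q j * D 0 ((0 + real i * h) + real j * h)))"
          by (simp add: sum_distrib_left algebra_simps)
        also have "\<dots> = (diff_quot h ^^ p) ((diff_quot h ^^ q) (D 0)) 0"
          using sum_diff_coeff[OF that(2), of h "D 0"] sum_diff_coeff[OF that(1), of h _ 0] by simp
        finally show ?thesis by (simp add: funpow_add)
      qed
      have "quad_form n (\<lambda>i j. D 0 (h * (real i + real j))) c =
          (\<Sum>i<n. \<Sum>j<n. \<Sum>p<n. \<Sum>q<n. v p * v q * (diff_coeff h p i * diff_coeff h q j * D 0 (h * (real i + real j))))"
        unfolding quad_form_def c_def sum_product unfolding sum_distrib_right
        by (intro sum.cong refl) (simp add: ac_simps)
      also have "\<dots> = (\<Sum>i<n. \<Sum>p<n. \<Sum>q<n. \<Sum>j<n. v p * v q * (diff_coeff h p i * diff_coeff h q j * D 0 (h * (real i + real j))))"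
        by (rule sum.cong[OF refl], rule sum_swap3)
      also have "\<dots> = (\<Sum>p<n. \<Sum>q<n. \<Sum>i<n. \<Sum>j<n. v p * v q * (diff_coeff h p i * diff_coeff h q j * D 0 (h * (real i + real j))))"
        by (rule sum_swap3)
      also have "\<dots> = quad_form n (\<lambda>i j. (diff_quot h ^^ (i + j)) (D 0) 0) v"
        unfolding quad_form_def by (intro sum.cong refl) (simp add: inner flip: sum_distrib_left)
      finally show "0 \<le> quad_form n (\<lambda>i j. (diff_quot h ^^ (i + j)) (D 0) 0) v"
        using psd[OF h, unfolded psd_kernel_def, rule_format, of c] by simp
    qed
  qed (rule \<open>0 < e\<close>)
qed simp

text \<open>With the coefficients of the \<open>k\<close>-th difference, the quadratic form annihilates the Taylor terms of
  order below \<open>k\<close>, so its leading term is \<open>h\<^sup>k D\<^sub>k(0)\<close> up to a positive factor.\<close>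

lemma deriv_nonneg_of_kernel:
  assumes D: "deriv_tower UNIV D" and "0 < e" and "k < n"
    and psd: "\<And>h. 0 < h \<Longrightarrow> h < e \<Longrightarrow> psd_kernel n (\<lambda>i j. D 0 (h * (real i * real j)))"
  shows "0 \<le> D k 0"
proof -
  define c where "c = diff_coeff 1 k"
  define P where "P h i \<xi> \<longleftrightarrow> 0 \<le> \<xi> \<and> \<xi> \<le> real k \<and>
      (\<Sum>j<n. c j * D 0 (h * (real i * real j))) = (h * real i) ^ k * D k (h * real i * \<xi>)" for h i \<xi>
  have "\<exists>\<xi>. P h i \<xi>" for h i
  proof -
    \<comment> \<open>The inner sum is the \<open>k\<close>-th difference with step 1 of
      \<open>y -> D 0 (h i y)\<close>, evaluated by the mean value theorem.\<close>
    define E where "E m y = (h * real i) ^ m * D m (h * real i * y)" for m y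
    have "deriv_tower UNIV E"
      unfolding deriv_tower_def
    proof (intro allI ballI)
      fix m y
      have "((\<lambda>y. D m (h * real i * y)) has_real_derivative D (Suc m) (h * real i * y) * (h * real i)) (at y)"
        by (rule DERIV_chain2[OF deriv_towerD[OF D]]) (auto intro!: derivative_eq_intros)
      from DERIV_cmult[OF this, of "(h * real i) ^ m"]
      show "(E m has_real_derivative E (Suc m) y) (at y)"
        by (simp add: E_def[abs_def] mult_ac)
    qed
    from diff_quot_mean_value[OF this, of 1 0 k] obtain \<xi> where
      "0 \<le> \<xi>" "\<xi> \<le> real k" "(diff_quot 1 ^^ k) (E 0) 0 = E k \<xi>" by auto
    then show ?thesis
      using sum_diff_coeff[OF \<open>k < n\<close>, of 1 "E 0" 0]
      unfolding P_def by (intro exI[of _ \<xi>]) (simp add: c_def E_def mult.assoc)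
  qed
  then have P: "P h i (SOME \<xi>. P h i \<xi>)" for h i by (rule someI_ex)
  define \<xi> where "\<xi> h i = (SOME \<xi>. P h i \<xi>)" for h i
  have \<xi>: "0 \<le> \<xi> h i" "\<xi> h i \<le> real k"
    "(\<Sum>j<n. c j * D 0 (h * (real i * real j))) = (h * real i) ^ k * D k (h * real i * \<xi> h i)" for h i
    using P[of h i] unfolding P_def \<xi>_def by blast+
  define S where "S h = (\<Sum>i<n. c i * real i ^ k * D k (h * real i * \<xi> h i))" for h
  have S_nonneg: "0 \<le> S h" if h: "0 < h" "h < e" for h
  proof -
    have "quad_form n (\<lambda>i j. D 0 (h * (real i * real j))) c =
        (\<Sum>i<n. c i * (\<Sum>j<n. c j * D 0 (h * (real i * real j))))"
      by (simp add: quad_form_def sum_distrib_left mult.assoc)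
    also have "\<dots> = h ^ k * S h"
      by (simp add: \<xi>(3) S_def sum_distrib_left power_mult_distrib ac_simps)
    finally have "0 \<le> h ^ k * S h"
      using psd[OF h, unfolded psd_kernel_def, rule_format, of c] by simp
    then show ?thesis by (meson h(1) zero_less_power mult_pos_neg not_le)
  qed
  have arg: "((\<lambda>h. h * real i * \<xi> h i) \<longlongrightarrow> 0) (at_right 0)" for i
  proof (rule tendsto_sandwich[of "\<lambda>h. 0"])
    show "\<forall>\<^sub>F h in at_right 0. 0 \<le> h * real i * \<xi> h i"
      by (rule eventually_mono[OF eventually_at_right_less]) (simp add: \<xi>(1))
    show "\<forall>\<^sub>F h in at_right 0. h * real i * \<xi> h i \<le> h * real i * real k"
      by (rule eventually_mono[OF eventually_at_right_less]) (intro mult_left_mono \<xi>(2), simp)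
    show "((\<lambda>h. h * real i * real k) \<longlongrightarrow> 0) (at_right 0)"
      by (rule tendsto_eq_intros refl tendsto_ident_at | simp)+
  qed simp
  have "isCont (D k) 0" using deriv_towerD[OF D] DERIV_isCont by blast
  then have "((\<lambda>h. D k (h * real i * \<xi> h i)) \<longlongrightarrow> D k 0) (at_right 0)" for i
    using isCont_tendsto_compose[OF _ arg] by blast
  then have "(S \<longlongrightarrow> (\<Sum>i<n. c i * real i ^ k * D k 0)) (at_right 0)"
    unfolding S_def by (intro tendsto_sum tendsto_mult tendsto_const)
  moreover have "\<forall>\<^sub>F h in at_right 0. 0 \<le> S h"
    unfolding eventually_at_right_field using S_nonneg \<open>0 < e\<close> by (intro exI[of _ e]) simp
  ultimately have "0 \<le> (\<Sum>i<n. c i * real i ^ k * D k 0)"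
    by (intro tendsto_lowerbound[where F = "at_right (0::real)"]) auto
  also have "\<dots> = (\<Sum>i<n. c i * real i ^ k) * D k 0" by (simp add: sum_distrib_right)
  \<comment> \<open>This is the \<open>k\<close>-th difference with step 1 of the monomial of degree
    \<open>k\<close>; its positivity settles the sign.\<close>
  also have "(\<Sum>i<n. c i * real i ^ k) = fact k"
  proof -
    define E where "E m = poly ((pderiv ^^ m) (monom (1::real) k))" for m
    have "deriv_tower UNIV E" unfolding deriv_tower_def E_def by (simp add: poly_DERIV)
    from diff_quot_mean_value[OF this, of 1 0 k] obtain z where "(diff_quot 1 ^^ k) (E 0) 0 = E k z" by auto
    moreover have "E k z = fact k"
      by (simp add: E_def pderiv_pow_monom poly_monom)
    ultimately show ?thesis
      using sum_diff_coeff[OF \<open>k < n\<close>, of 1 "E 0" 0] by (simp add: c_def E_def poly_monom)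
  qed
  finally show ?thesis by (meson fact_gt_zero mult_pos_neg not_le)
qed

section \<open>Properties of an entrywise positivity preserver\<close>

context
  fixes n :: nat and J :: "real set" and f g :: "real \<Rightarrow> real"
  assumes n: "2 \<le> n" and J: "open J" "is_interval J" "J \<noteq> {}"
    and down: "\<And>s t. t \<in> J \<Longrightarrow> s \<le> t \<Longrightarrow> s \<in> J"
    and fg: "\<And>t. t \<in> J \<Longrightarrow> g t = f (exp t)"
    and pres: "\<forall>K. psd_kernel n K \<longrightarrow> (\<forall>i j. K i j = K j i) \<longrightarrow>
      (\<forall>i<n. \<forall>j<n. K i j \<in> exp ` J) \<longrightarrow> psd_kernel n (\<lambda>i j. f (K i j))"
begin

lemma presD:
  assumes "psd_kernel n A" "\<And>i j. A i j = A j i" "\<And>i j. i < n \<Longrightarrow> j < n \<Longrightarrow> A i j \<in> exp ` J"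
  shows "psd_kernel n (\<lambda>i j. f (A i j))"
  using pres assms by blast

lemma preserver_two:
  assumes "a \<in> exp ` J" "b \<in> exp ` J" "c \<in> exp ` J" "b\<^sup>2 \<le> a * c"
  shows "0 \<le> f a" "(f b)\<^sup>2 \<le> f a * f c"
proof -
  \<comment> \<open>The 2 by 2 matrix with rows \<open>a b\<close> and \<open>b c\<close> is
    inflated to size \<open>n\<close> by repeating its second index; \<open>u\<close> is its
    Cholesky factor.\<close>
  define A where "A i j = (if i = 0 \<and> j = 0 then a else if i = 0 \<or> j = 0 then b else c)" for i j :: nat
  define u where "u k i = (if k = (0::nat) then (if i = 0 then sqrt a else b / sqrt a)
    else (if i = 0 then 0 else sqrt (c - b\<^sup>2 / a)))" for k and i :: nat
  have a: "0 < a" using assms(1) by (simp add: exp_image_iff)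
  have "b\<^sup>2 / a \<le> c" using assms(4) a by (simp add: field_simps)
  then have "A i j = (\<Sum>k<2. u k i * u k j)" for i j
    using a by (simp add: A_def u_def numeral_2_eq_2 power2_eq_square)
  then have "psd_kernel n A"
    using psd_kernel_of_gram[of n u "{..<2}"] by (metis (no_types, lifting) ext)
  then have psd: "psd_kernel n (\<lambda>i j. f (A i j))"
    by (rule presD) (use assms in \<open>auto simp: A_def\<close>)
  show "0 \<le> f a" using psd_kernel_diag_nonneg[OF psd, of 0] n by (simp add: A_def)
  show "(f b)\<^sup>2 \<le> f a * f c" using psd_kernel_2[OF psd, of 0 1] n by (simp add: A_def)
qed

lemma preserver_nonneg: "t \<in> J \<Longrightarrow> 0 \<le> g t"
  using preserver_two(1)[of "exp t" "exp t" "exp t"] fg by (simp add: power2_eq_square)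

lemma preserver_mono:
  assumes "s \<le> t" "t \<in> J"
  shows "g s \<le> g t"
proof -
  have s: "s \<in> J" using down assms by blast
  \<comment> \<open>A matrix with diagonal entries \<open>exp t\<close> and off-diagonal entries
    \<open>exp s\<close> compares the two values.\<close>
  have "(exp s)\<^sup>2 \<le> exp t * exp t" using assms(1) by (simp add: power2_eq_square mult_mono)
  then have "(g s)\<^sup>2 \<le> (g t)\<^sup>2"
    using preserver_two(2)[of "exp t" "exp s" "exp t"] s assms(2) fg by (simp add: power2_eq_square)
  then show ?thesis using preserver_nonneg[OF assms(2)] by (rule power2_le_imp_le)
qed

lemma preserver_log_convex:
  assumes "s \<in> J" "t \<in> J"
  shows "(g ((s + t) / 2))\<^sup>2 \<le> g s * g t"
proof -
  have m: "(s + t) / 2 \<in> J"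
    using down[OF assms(1), of "(s + t) / 2"] down[OF assms(2), of "(s + t) / 2"] by argo
  have "(exp ((s + t) / 2))\<^sup>2 = exp s * exp t"
    by (simp add: power2_eq_square flip: exp_add)
  then show ?thesis
    using preserver_two(2)[OF imageI[OF assms(1)] imageI[OF m] imageI[OF assms(2)]] assms m fg by simp
qed

text \<open>If \<open>L \<le> R\<close> are the one-sided limits of the monotone function \<open>g\<close> at \<open>t\<close>, then
  \<open>g(t + h)\<^sup>2 \<le> g(t - h) g(t + 3 h)\<close> gives \<open>R\<^sup>2 \<le> L R\<close> and hence \<open>L = R\<close>.\<close>

lemma preserver_continuous: "continuous_on J g"
  unfolding continuous_on_eq_continuous_at[OF J(1)]
proof
  fix t assume t: "t \<in> J"
  obtain d where d: "0 < d" "cball t d \<subseteq> J"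
    using J(1) t open_contains_cball by blast
  \<comment> \<open>The steps shrink by the factor 3 so that \<open>t + h (Suc k)\<close> is the
    midpoint of \<open>t - h (Suc k)\<close> and \<open>t + h k\<close>.\<close>
  define h where "h k = d / 3 ^ k" for k :: nat
  have h: "0 < h k" "h k \<le> d" "3 * h (Suc k) = h k" for k
    using d(1) by (auto simp: h_def field_simps)
  have mem: "t + h k \<in> J" "t - h k \<in> J" for k
    using d h(1,2)[of k] by (auto simp: subset_iff dist_real_def)
  define u v where "u k = g (t + h k)" and "v k = g (t - h k)" for k
  have h_dec: "h (Suc k) \<le> h k" for k using h(1)[of "Suc k"] h(3)[of k] by linarith
  have bounds: "v k \<le> g t" "g t \<le> u k" for k
    using preserver_mono[of "t - h k" t] preserver_mono[of t "t + h k"] h(1)[of k] mem t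
    by (auto simp: u_def v_def)
  have u_dec: "decseq u" unfolding decseq_Suc_iff u_def using preserver_mono mem h_dec by simp
  have v_inc: "incseq v" unfolding incseq_Suc_iff v_def using preserver_mono mem h_dec by simp
  have "\<forall>k. g t \<le> u k" "\<forall>k. v k \<le> g t" using bounds by auto
  note lims = decseq_convergent[OF u_dec this(1)] incseq_convergent[OF v_inc this(2)]
  obtain R where R: "u \<longlonglongrightarrow> R" by (rule lims(1)) (rule that)
  obtain L where L: "v \<longlonglongrightarrow> L" by (rule lims(2)) (rule that)
  have LR: "L \<le> g t" "g t \<le> R" using bounds L R by (auto intro: LIMSEQ_le_const LIMSEQ_le_const2)
  have Lnn: "0 \<le> L" using L preserver_nonneg mem by (auto intro!: LIMSEQ_le_const simp: v_def)
  have "(u (Suc k))\<^sup>2 \<le> v (Suc k) * u k" for k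
  proof -
    have "((t - h (Suc k)) + (t + h k)) / 2 = t + h (Suc k)" using h(3)[of k] by argo
    note e = this
    show ?thesis
      using preserver_log_convex[OF mem(2)[of "Suc k"] mem(1)[of k]] unfolding e u_def v_def .
  qed
  then have "R\<^sup>2 \<le> L * R"
    using LIMSEQ_le[OF tendsto_power[OF LIMSEQ_Suc[OF R]] tendsto_mult[OF LIMSEQ_Suc[OF L] R]] by blast
  then have RL: "R \<le> L"
  proof (cases "R \<le> 0")
    case False
    then show ?thesis using \<open>R\<^sup>2 \<le> L * R\<close> by (simp add: power2_eq_square)
  qed (use Lnn in simp)
  have "R = L" using RL LR by linarith
  then have lim: "(\<lambda>k. u k - v k) \<longlonglongrightarrow> 0"
    using tendsto_diff[OF R L] by simp
  show "isCont g t"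
    unfolding continuous_at_eps_delta
  proof (intro allI impI)
    fix e :: real assume "0 < e"
    then have "\<forall>\<^sub>F k in sequentially. u k - v k < e" by (rule order_tendstoD(2)[OF lim])
    then obtain k where k: "u k - v k < e" by (meson eventually_happens trivial_limit_sequentially)
    show "\<exists>d>0. \<forall>x'. dist x' t < d \<longrightarrow> dist (g x') (g t) < e"
    proof (intro exI[of _ "h k"] conjI allI impI)
      fix s assume "dist s t < h k"
      then have s: "t - h k \<le> s" "s \<le> t + h k" by (auto simp: dist_real_def)
      then have "v k \<le> g s" "g s \<le> u k"
        using preserver_mono[OF s(1) down[OF mem(1) s(2)]] preserver_mono[OF s(2) mem(1)]
        by (auto simp: u_def v_def)
      then show "dist (g s) (g t) < e" using bounds[of k] k by (simp add: dist_real_def abs_less_iff)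
    qed (rule h)
  qed
qed

lemma preserver_continuous_exp_image: "continuous_on (exp ` J) f"
proof -
  have "continuous_on (exp ` J) (\<lambda>x. g (ln x))"
    by (rule continuous_on_compose2[OF preserver_continuous])
      (auto intro!: continuous_intros)
  then show ?thesis by (rule continuous_on_eq) (auto simp: fg)
qed

lemma preserver_hankel: "hankel_dist_psd n J g"
  unfolding hankel_dist_psd_def
proof (intro ballI impI)
  fix \<psi> assume \<psi>: "\<psi> \<in> test_functions J" and nonneg: "\<forall>x\<in>J. 0 \<le> \<psi> x"
  obtain a b \<eta> :: real and D where D: "0 < \<eta>" "{a - \<eta>..b + \<eta>} \<subseteq> J" "deriv_tower UNIV D"
    "\<And>k. D k 0 = dist_deriv J k g \<psi>"
    "\<And>u. \<bar>u\<bar> \<le> \<eta> \<Longrightarrow> D 0 u = integral {a..b} (\<lambda>x. g (x + u) * \<psi> x)"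
    by (rule test_functions_translate[OF J \<psi> preserver_continuous]) (rule that)
  have smooth: "smooth_on UNIV \<psi>" using \<psi> by (auto simp: test_functions_def smooth_on_iff)
  have "psd_kernel n (\<lambda>i j. D (i + j) 0)"
  proof (rule hankel_of_kernel[OF D(3)])
    show "0 < \<eta> / (2 * real n)" using D(1) n by simp
    fix h assume h: "0 < h" "h < \<eta> / (2 * real n)"
    have u: "0 \<le> h * (real i + real j)" "h * (real i + real j) \<le> \<eta>" if "i < n" "j < n" for i j
    proof -
      have "h * (real i + real j) \<le> h * (2 * real n)" using h(1) that by (intro mult_left_mono) auto
      also have "\<dots> \<le> \<eta>" using h n by (simp add: field_simps)
      finally show "h * (real i + real j) \<le> \<eta>" .
    qed (use h in simp)
    show "psd_kernel n (\<lambda>i j. D 0 (h * (real i + real j)))"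
    proof (rule quad_form_translate_nonneg[OF D(2) preserver_continuous smooth _ D(5)])
      show "0 \<le> \<psi> x" if "x \<in> {a..b}" for x using nonneg D(1,2) that by (auto simp: subset_iff)
      show "\<bar>h * (real i + real j)\<bar> \<le> \<eta>" if "i < n" "j < n" for i j using u[OF that] by simp
      fix x assume x: "x \<in> {a..b}"
      define A where "A i j = exp (x + h * (real i + real j))" for i j :: nat
      have mem: "x + h * (real i + real j) \<in> J" if "i < n" "j < n" for i j
        using D(1,2) u[OF that] x by (auto simp: subset_iff)
      have "A = (\<lambda>i j. \<Sum>k<(1::nat). exp (x / 2 + h * real i) * exp (x / 2 + h * real j))"
        by (intro ext) (simp add: A_def algebra_simps flip: exp_add)
      then have "psd_kernel n A" by (simp only: psd_kernel_of_gram)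
      then have "psd_kernel n (\<lambda>i j. f (A i j))"
        by (rule presD) (use mem in \<open>auto simp: A_def add.commute\<close>)
      then show "psd_kernel n (\<lambda>i j. g (x + h * (real i + real j)))"
        by (rule iffD1[OF psd_kernel_cong, rotated]) (simp add: A_def fg mem)
    qed
  qed
  then show "psd_mat (hankel_dist n J g \<psi>)"
    unfolding hankel_dist_def psd_mat_iff D(4)[symmetric] by (simp add: add.commute)
qed

lemma preserver_dist_nonneg:
  assumes "k < n"
  shows "dist_nonneg (exp ` J) (dist_deriv (exp ` J) k f)"
  unfolding dist_nonneg_def
proof (intro ballI impI)
  fix \<psi> assume \<psi>: "\<psi> \<in> test_functions (exp ` J)" and nonneg: "\<forall>x\<in>exp ` J. 0 \<le> \<psi> x"
  have I: "open (exp ` J)" "is_interval (exp ` J)" "exp ` J \<noteq> {}"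
  proof -
    have "exp ` J = {0<..} \<inter> ln -` J" by (auto simp: exp_image_iff)
    moreover have "open ({0<..} \<inter> ln -` J)"
      by (rule continuous_open_preimage[OF _ _ J(1)]) (auto intro!: continuous_intros)
    ultimately show "open (exp ` J)" by simp
    show "is_interval (exp ` J)"
      by (intro is_interval_connected_1[THEN iffD2] connected_continuous_image continuous_intros)
        (use J(2) in \<open>simp add: is_interval_connected_1\<close>)
  qed (use J(3) in simp)
  obtain a b \<eta> :: real and D where D: "0 < \<eta>" "{a - \<eta>..b + \<eta>} \<subseteq> exp ` J" "deriv_tower UNIV D"
    "\<And>k. D k 0 = dist_deriv (exp ` J) k f \<psi>"
    "\<And>u. \<bar>u\<bar> \<le> \<eta> \<Longrightarrow> D 0 u = integral {a..b} (\<lambda>x. f (x + u) * \<psi> x)"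
    by (rule test_functions_translate[OF I \<psi> preserver_continuous_exp_image]) (rule that)
  have smooth: "smooth_on UNIV \<psi>" using \<psi> by (auto simp: test_functions_def smooth_on_iff)
  have "0 \<le> D k 0"
  proof (rule deriv_nonneg_of_kernel[OF D(3) _ assms])
    show "0 < \<eta> / (real n * real n)" using D(1) n by simp
    fix h assume h: "0 < h" "h < \<eta> / (real n * real n)"
    have u: "0 \<le> h * (real i * real j)" "h * (real i * real j) \<le> \<eta>" if "i < n" "j < n" for i j
    proof -
      have "h * (real i * real j) \<le> h * (real n * real n)"
        using h(1) that by (intro mult_left_mono mult_mono) auto
      also have "\<dots> \<le> \<eta>" using h n by (simp add: field_simps)
      finally show "h * (real i * real j) \<le> \<eta>" .
    qed (use h in simp)
    show "psd_kernel n (\<lambda>i j. D 0 (h * (real i * real j)))"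
    proof (rule quad_form_translate_nonneg[OF D(2) preserver_continuous_exp_image smooth _ D(5)])
      show "0 \<le> \<psi> x" if "x \<in> {a..b}" for x
        by (rule nonneg[rule_format], rule D(2)[THEN subsetD]) (use D(1) that in auto)
      show "\<bar>h * (real i * real j)\<bar> \<le> \<eta>" if "i < n" "j < n" for i j using u[OF that] by simp
      fix x assume x: "x \<in> {a..b}"
      \<comment> \<open>A sum of two rank-one matrices, from the constant vector
        \<open>sqrt x\<close> and the vector \<open>sqrt h * i\<close>.\<close>
      define A where "A i j = x + h * (real i * real j)" for i j :: nat
      have mem: "A i j \<in> exp ` J" if "i < n" "j < n" for i j
      proof -
        have "A i j \<in> {a - \<eta>..b + \<eta>}" using D(1) u[OF that] x by (simp add: A_def)
        then show ?thesis using D(2) by blast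
      qed
      have "0 < x" using mem[of 0 0] n by (simp add: A_def exp_image_iff)
      then have "A = (\<lambda>i j. \<Sum>k<2. (if k = (0::nat) then sqrt x else sqrt h * real i) *
          (if k = (0::nat) then sqrt x else sqrt h * real j))"
        using h(1) by (intro ext) (simp add: A_def numeral_2_eq_2)
      then have "psd_kernel n A"
        by (simp only: psd_kernel_of_gram[where w = "\<lambda>k i. if k = (0::nat) then sqrt x else sqrt h * real i"])
      then show "psd_kernel n (\<lambda>i j. f (x + h * (real i * real j)))"
        using presD[of A] mem by (simp add: A_def mult.commute)
    qed
  qed
  then show "0 \<le> dist_deriv (exp ` J) k f \<psi>" by (simp add: D(4))
qed

end

section \<open>The equivalence\<close>

lemma psd_mats_over_iff:
  "A \<in> psd_mats_over n I \<longleftrightarrow> (\<exists>K. A = mat n n (\<lambda>(i, j). K i j) \<and> (\<forall>i j. K i j = K j i) \<and>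
    psd_kernel n K \<and> (\<forall>i<n. \<forall>j<n. K i j \<in> I))"
proof
  assume A: "A \<in> psd_mats_over n I"
  \<comment> \<open>Entries outside the block are set to 0, which makes the symmetry hold for all
    indices.\<close>
  define K where "K i j = (if i < n \<and> j < n then A $$ (i, j) else 0)" for i j
  have c: "A \<in> carrier_mat n n" using A by (simp add: psd_mats_over_def)
  have eq: "A = mat n n (\<lambda>(i, j). K i j)" using c by (auto simp: K_def)
  have "psd_mat (mat n n (\<lambda>(i, j). K i j))" using A eq by (simp add: psd_mats_over_def)
  then have "\<forall>i<n. \<forall>j<n. K i j = K j i" and psd: "psd_kernel n K" unfolding psd_mat_iff by auto
  then have sym: "K i j = K j i" for i j
    by (cases "i < n \<and> j < n") (blast, auto simp: K_def)
  moreover have "K i j \<in> I" if "i < n" "j < n" for i j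
    using A c that elements_matI[of A n n i j] by (auto simp: psd_mats_over_def K_def)
  ultimately show "\<exists>K. A = mat n n (\<lambda>(i, j). K i j) \<and> (\<forall>i j. K i j = K j i) \<and>
      psd_kernel n K \<and> (\<forall>i<n. \<forall>j<n. K i j \<in> I)"
    using eq psd by (intro exI[of _ K] conjI) blast+
next
  assume "\<exists>K. A = mat n n (\<lambda>(i, j). K i j) \<and> (\<forall>i j. K i j = K j i) \<and>
    psd_kernel n K \<and> (\<forall>i<n. \<forall>j<n. K i j \<in> I)"
  then obtain K where K: "A = mat n n (\<lambda>(i, j). K i j)" "\<And>i j. K i j = K j i"
    "psd_kernel n K" "\<forall>i<n. \<forall>j<n. K i j \<in> I" by blast
  have "psd_mat A" unfolding K(1) psd_mat_iff using K(2,3) by blast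
  moreover have "elements_mat A \<subseteq> I" using K(4) by (auto simp: K(1) dest!: elements_matD)
  ultimately show "A \<in> psd_mats_over n I" by (simp add: psd_mats_over_def K(1))
qed

lemma preserver_iff_kernel:
  "(\<forall>A \<in> psd_mats_over n I. psd_mat (map_mat f A)) \<longleftrightarrow>
    (\<forall>K. psd_kernel n K \<longrightarrow> (\<forall>i j. K i j = K j i) \<longrightarrow> (\<forall>i<n. \<forall>j<n. K i j \<in> I) \<longrightarrow>
      psd_kernel n (\<lambda>i j. f (K i j)))"
proof -
  have map: "map_mat f (mat n n (\<lambda>(i, j). K i j)) = mat n n (\<lambda>(i, j). f (K i j))" for K
    by auto
  have *: "psd_mat (map_mat f (mat n n (\<lambda>(i, j). K i j))) \<longleftrightarrow> psd_kernel n (\<lambda>i j. f (K i j))"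
    if "\<forall>i j. K i j = K j i" for K
    unfolding map psd_mat_iff using that by metis
  show ?thesis
  proof (intro iffI allI impI ballI)
    fix K assume "\<forall>A \<in> psd_mats_over n I. psd_mat (map_mat f A)"
      and K: "psd_kernel n K" "\<forall>i j. K i j = K j i" "\<forall>i<n. \<forall>j<n. K i j \<in> I"
    moreover have "mat n n (\<lambda>(i, j). K i j) \<in> psd_mats_over n I"
      unfolding psd_mats_over_iff using K by (intro exI[of _ K]) simp
    ultimately show "psd_kernel n (\<lambda>i j. f (K i j))" using *[OF K(2)] by simp
  next
    fix A assume pres: "\<forall>K. psd_kernel n K \<longrightarrow> (\<forall>i j. K i j = K j i) \<longrightarrow> (\<forall>i<n. \<forall>j<n. K i j \<in> I) \<longrightarrow>
      psd_kernel n (\<lambda>i j. f (K i j))" and "A \<in> psd_mats_over n I"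
    then obtain K where K: "A = mat n n (\<lambda>(i, j). K i j)" "\<forall>i j. K i j = K j i" "psd_kernel n K"
      "\<forall>i<n. \<forall>j<n. K i j \<in> I" unfolding psd_mats_over_iff by blast
    have "psd_kernel n (\<lambda>i j. f (K i j))" using pres K by simp
    then show "psd_mat (map_mat f A)" unfolding K(1) *[OF K(2)] .
  qed
qed

theorem theorem4p1:
  fixes n :: nat and \<rho> :: ereal and I J :: "real set" and f g :: "real \<Rightarrow> real"
  assumes "n \<ge> 2" and "0 < \<rho>"
    and "I = {x. 0 < x \<and> ereal x < \<rho>}"
    and "J = {t. ereal t < log_ereal \<rho>}"
    and "\<And>t. t \<in> J \<Longrightarrow> g t = f (exp t)"
  shows "(\<forall>A \<in> psd_mats_over n I. psd_mat (map_mat f A)) \<longleftrightarrow>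
    (continuous_on I f \<and>
     (\<forall>k. k \<le> n - 1 \<longrightarrow> dist_nonneg I (dist_deriv I k f)) \<and>
     hankel_dist_psd n J g)"
proof -
  have J: "open J" "is_interval J" "J \<noteq> {}" "I = exp ` J"
    and down: "\<And>s t. t \<in> J \<Longrightarrow> s \<le> t \<Longrightarrow> s \<in> J"
  proof -
    \<comment> \<open>Infinite and finite \<rho>; in the finite case positivity of \<rho> makes
      \<open>ln\<close> the true logarithm.\<close>
    have "J = UNIV \<and> I = {0<..} \<or> (\<exists>r>0. J = {..<ln r} \<and> I = {0<..<r})"
      using assms(2) unfolding assms(3,4) by (cases \<rho>) (auto simp: log_ereal_def)
    then have "open J \<and> is_interval J \<and> J \<noteq> {} \<and> I = exp ` J \<and> (\<forall>t\<in>J. \<forall>s\<le>t. s \<in> J)"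
    proof (elim disjE exE conjE)
      assume "J = UNIV" "I = {0<..}"
      then show ?thesis by (auto simp: exp_image_iff)
    next
      fix r :: real assume r: "0 < r" "J = {..<ln r}" "I = {0<..<r}"
      have "x \<in> {0<..<r} \<longleftrightarrow> x \<in> exp ` {..<ln r}" for x
        unfolding exp_image_iff using r(1) by auto
      then have "I = exp ` J" unfolding r by blast
      then show ?thesis using r by (auto simp: is_interval_1 lessThan_empty_iff)
    qed
    then show "open J" "is_interval J" "J \<noteq> {}" "I = exp ` J"
      "\<And>s t. t \<in> J \<Longrightarrow> s \<le> t \<Longrightarrow> s \<in> J" by auto
  qed
  \<comment> \<open>Subtraction on natural numbers: \<open>n - 1\<close> is the true predecessor
    because \<open>n >= 2\<close>.\<close>
  have k: "k \<le> n - 1 \<longleftrightarrow> k < n" for k using assms(1) by auto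
  show ?thesis
    unfolding preserver_iff_kernel k
  proof (intro iffI conjI allI impI)
    assume *: "\<forall>K. psd_kernel n K \<longrightarrow> (\<forall>i j. K i j = K j i) \<longrightarrow> (\<forall>i<n. \<forall>j<n. K i j \<in> I) \<longrightarrow>
      psd_kernel n (\<lambda>i j. f (K i j))"
    note ctx = assms(1) J(1-3) down assms(5) *[unfolded J(4)]
    show "continuous_on I f" unfolding J(4) by (rule preserver_continuous_exp_image[OF ctx])
    show "dist_nonneg I (dist_deriv I k f)" if "k < n" for k
      unfolding J(4) by (rule preserver_dist_nonneg[OF ctx that])
    show "hankel_dist_psd n J g" by (rule preserver_hankel[OF ctx])
  next
    fix K assume **: "continuous_on I f \<and> (\<forall>k<n. dist_nonneg I (dist_deriv I k f)) \<and> hankel_dist_psd n J g"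
      and K: "psd_kernel n K" "\<forall>i j. K i j = K j i" "\<forall>i<n. \<forall>j<n. K i j \<in> I"
    show "psd_kernel n (\<lambda>i j. f (K i j))"
    proof (rule preserver_if_dist_conditions[where f = f and A = K, OF J(1,2)])
      show "\<And>s t. t \<in> J \<Longrightarrow> s \<le> t \<Longrightarrow> s \<in> J" by (rule down)
      show "continuous_on (exp ` J) f" "hankel_dist_psd n J g" using ** J(4) by auto
      show "g t = f (exp t)" if "t \<in> J" for t by (rule assms(5)[OF that])
      show "dist_nonneg (exp ` J) (dist_deriv (exp ` J) k f)" if "k < n" for k using ** that J(4) by auto
      show "K i j \<in> exp ` J" if "i < n" "j < n" for i j using K(3) that J(4) by auto
      show "K i j = K j i" for i j using K(2) by blast
    qed (rule K(1))
  qed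
qed

end
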